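(* Let $\mathcal H_1,\mathcal H_2$ be nonzero Hilbert spaces, let $T=\begin{bmatrix} V & E\\ 0 & S\end{bmatrix}\in B(\mathcal H_1\oplus\mathcal H_2)$, and let $\mathcal D$ be a closed subspace of $\mathcal H_1\ominus\big(\operatorname{ran}V\vee\overline{\operatorname{ran}E}\big)$. Then the following conditions are equivalent: (i) $T\in\mathscr S_{\mathcal H_1,\mathcal H_2}$; (ii) there exist Hilbert spaces $\mathcal K_1$ and $\mathcal K_2$ and $\begin{bmatrix}\tilde V&\tilde E\\0&N\end{bmatrix}\in\mathscr N_{\mathcal K_1,\mathcal K_2}$ such that $T\preceq\begin{bmatrix}\tilde V&\tilde E\\0&N\end{bmatrix}$ and $|E|\subseteq|\tilde E|$; (iii) $S$ is subnormal and for any minimal normal extension $N\in B(\mathcal K_2)$ of $S$ there exist a Hilbert space $\mathcal K_1$ and operators $\tilde V\in B(\mathcal K_1)$ and $\tilde E\in B(\mathcal K_2,\mathcal K_1)$ such that $\begin{bmatrix}\tilde V&\tilde E\\0&N\end{bmatrix}\in\mathscr N_{\mathcal K_1,\mathcal K_2}$, $T\preceq\begin{bmatrix}\tilde V&\tilde E\\0&N\end{bmatrix}$, $|E|\subseteq|\tilde E|$, $\dim\mathcal K_j=\dim\mathcal H_j$ for $j=1,2$, and $\mathcal D=\mathcal K_1\ominus\big(\operatorname{ran}\tilde V\oplus\overline{\operatorname{ran}\tilde E}\big)$. Moreover, if $\begin{bmatrix}\tilde V&\tilde E\\0&N\end{bmatrix}$ is as in (ii) and $N$ is a minimal normal extension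 of $S$, then (a) $|\tilde E|$ is the lift of $|E|$ relative to $\{N\}'$; (b) $E$ is injective (resp., left-invertible, isometric) if and only if $\tilde E$ is injective (resp., left-invertible, isometric).
   Context: All Hilbert spaces are complex; $\dim$ is Hilbert-space dimension (a cardinal); $B(\mathcal H,\mathcal K)$ is the space of bounded linear operators and $B(\mathcal H)=B(\mathcal H,\mathcal H)$; $|E|=(E^*E)^{1/2}$; $\vee$ denotes closed linear span; $\mathscr F'$ denotes the commutant of a set $\mathscr F$ of operators. For $A\in B(\mathcal H)$, $B\in B(\mathcal K)$ (and similarly for operators between two spaces), $A\subseteq B$ means $\mathcal H\subseteq\mathcal K$ (isometric embedding) and $Ah=Bh$ for all $h\in\mathcal H$. Brownian-type operators: for nonzero Hilbert spaces $\mathcal H_1,\mathcal H_2$, the operator $\begin{bmatrix}V&E\\0&X\end{bmatrix}\in B(\mathcal H_1\oplus\mathcal H_2)$ (with $V\in B(\mathcal H_1)$, $E\in B(\mathcal H_2,\mathcal H_1)$, $X\in B(\mathcal H_2)$) is of Brownian type if $V^*V=I$, $V^*E=0$ and $XE^*E=E^*EX$. It belongs to $\mathscr S_{\mathcal H_1,\mathcal H_2}$ (resp. $\mathscr N_{\mathcal H_1,\mathcal H_2}$) if in addition $X$ is subnormal (resp. normal). Subnormality: $S\in B(\mathcal H)$ is subnormal if $S\subseteq N$ for some normal $N\in B(\mathcal K)$, $\mathcal K\supseteq\mathcal H$ (a normal extension of $S$). The normal extension $N$ is minimal if $\mathcal K$ is the only closed subspace of $\mathcal K$ that contains $\mathcal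 H$ and reduces $N$. Lift: if $N\in B(\mathcal K)$ is a minimal normal extension of $S\in B(\mathcal H)$, $P$ is the orthogonal projection of $\mathcal K$ onto $\mathcal H$, and $A\in\{S,S^*\}'$, then the lift of $A$ relative to $\{N\}'$ is the (unique) operator $B\in\{N\}'\cap\{P\}'$ with $A\subseteq B$. Entrywise extension: $\begin{bmatrix}A_{11}&A_{12}\\ A_{21}&A_{22}\end{bmatrix}\preceq\begin{bmatrix}\tilde A_{11}&\tilde A_{12}\\ \tilde A_{21}&\tilde A_{22}\end{bmatrix}$, for operators on $\mathcal H_1\oplus\mathcal H_2$ and $\mathcal K_1\oplus\mathcal K_2$ respectively, means $\mathcal H_j\subseteq\mathcal K_j$ and $A_{ij}h_j=\tilde A_{ij}h_j$ for all $h_j\in\mathcal H_j$ and $i,j\in\{1,2\}$. *)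

theory Defs
  imports "HOL-Analysis.Analysis" "HOL-Library.Equipollence"
begin

section \<open>Complex Hilbert spaces\<close>

text \<open>
  The class provides ambient complex Hilbert spaces.  The norm, the topology and completeness come
  from the underlying real Hilbert space; the complex inner product is linear in its first
  argument and its real part is the real inner product.
\<close>

class complex_inner = real_inner +
  fixes scaleC :: "complex \<Rightarrow> 'a \<Rightarrow> 'a" (infixr "*\<^sub>C" 75)
    and cinner :: "'a \<Rightarrow> 'a \<Rightarrow> complex"
  assumes scaleC_add_right: "c *\<^sub>C (x + y) = c *\<^sub>C x + c *\<^sub>C y"
    and scaleC_add_left: "(c + d) *\<^sub>C x = c *\<^sub>C x + d *\<^sub>C x"
    and scaleC_scaleC: "c *\<^sub>C d *\<^sub>C x = (c * d) *\<^sub>C x"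
    and scaleC_of_real: "of_real r *\<^sub>C x = r *\<^sub>R x"
    and cinner_commute: "cinner x y = cnj (cinner y x)"
    and cinner_add_left: "cinner (x + y) z = cinner x z + cinner y z"
    and cinner_scaleC_left: "cinner (c *\<^sub>C x) y = c * cinner x y"
    and Re_cinner: "Re (cinner x y) = inner x y"

class chilbert = complex_inner + complete_space

instantiation complex :: chilbert
begin

definition scaleC_complex :: "complex \<Rightarrow> complex \<Rightarrow> complex" where
  "scaleC_complex c x = c * x"

definition cinner_complex :: "complex \<Rightarrow> complex \<Rightarrow> complex" where
  "cinner_complex x y = x * cnj y"

instance
  by standard
    (auto simp: scaleC_complex_def cinner_complex_def algebra_simps scaleR_conv_of_real
      inner_complex_def)

end

text \<open>The orthogonal sum of two Hilbert spaces.\<close>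

instantiation prod :: (complex_inner, complex_inner) complex_inner
begin

definition scaleC_prod :: "complex \<Rightarrow> 'a \<times> 'b \<Rightarrow> 'a \<times> 'b" where
  "scaleC_prod c z = (c *\<^sub>C fst z, c *\<^sub>C snd z)"

definition cinner_prod :: "'a \<times> 'b \<Rightarrow> 'a \<times> 'b \<Rightarrow> complex" where
  "cinner_prod z w = cinner (fst z) (fst w) + cinner (snd z) (snd w)"

instance
proof
  fix x y :: "'a \<times> 'b"
  show "cinner x y = cnj (cinner y x)"
    unfolding cinner_prod_def complex_cnj_add by (intro arg_cong2[where f = "(+)"] cinner_commute)
qed (auto simp: scaleC_prod_def cinner_prod_def scaleC_add_right scaleC_add_left scaleC_scaleC
      scaleC_of_real scaleR_prod_def cinner_add_left cinner_scaleC_left Re_cinner inner_prod_def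
      algebra_simps)

end

instance prod :: (chilbert, chilbert) chilbert ..

text \<open>
  A Hilbert space is rendered as a closed complex subspace of an ambient type of class
  \<open>chilbert\<close>, so that Hilbert spaces can be quantified over.  Inclusions \<open>H \<subseteq> K\<close> of Hilbert
  spaces are explicit isometric embeddings \<open>j\<close>, not inclusions of subsets of the ambient type:
  the ambient type only plays the role of a universe, and \<open>K\<close> may also be found there when \<open>H\<close>
  is the whole type.
\<close>

definition csubspace :: "'a::complex_inner set \<Rightarrow> bool" where
  "csubspace M \<longleftrightarrow> 0 \<in> M \<and> (\<forall>x\<in>M. \<forall>y\<in>M. x + y \<in> M) \<and> (\<forall>c. \<forall>x\<in>M. c *\<^sub>C x \<in> M)"

definition closed_csubspace :: "'a::complex_inner set \<Rightarrow> bool" where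
  "closed_csubspace M \<longleftrightarrow> csubspace M \<and> closed M"

definition closed_cspan :: "'a::complex_inner set \<Rightarrow> 'a set" where
  "closed_cspan X = \<Inter>{M. closed_csubspace M \<and> X \<subseteq> M}"

definition ominus :: "'a::complex_inner set \<Rightarrow> 'a set \<Rightarrow> 'a set" (infixl "\<ominus>\<^sub>H" 65) where
  "K \<ominus>\<^sub>H M = {x \<in> K. \<forall>y\<in>M. cinner x y = 0}"

definition orthonormal_basis :: "'a::complex_inner set \<Rightarrow> 'a set \<Rightarrow> bool" where
  "orthonormal_basis H B \<longleftrightarrow> B \<subseteq> H \<and>
     (\<forall>x\<in>B. \<forall>y\<in>B. cinner x y = (if x = y then 1 else 0)) \<and> closed_cspan B = H"

text \<open>Equality of Hilbert-space dimensions, as cardinals.\<close>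

definition same_hilbert_dim :: "'a::complex_inner set \<Rightarrow> 'b::complex_inner set \<Rightarrow> bool" where
  "same_hilbert_dim H K \<longleftrightarrow>
     (\<exists>B C. orthonormal_basis H B \<and> orthonormal_basis K C \<and> B \<approx> C)"


section \<open>Bounded operators\<close>

text \<open>
  An operator from \<open>H\<close> to \<open>K\<close> is a HOL function whose values outside \<open>H\<close> are irrelevant; every
  statement about operators below is restricted to their domains.
\<close>

definition bops :: "'a::complex_inner set \<Rightarrow> 'b::complex_inner set \<Rightarrow> ('a \<Rightarrow> 'b) set" where
  "bops H K = {A. (\<forall>x\<in>H. A x \<in> K) \<and> (\<forall>x\<in>H. \<forall>y\<in>H. A (x + y) = A x + A y) \<and>
     (\<forall>c. \<forall>x\<in>H. A (c *\<^sub>C x) = c *\<^sub>C A x) \<and> (\<exists>M. \<forall>x\<in>H. norm (A x) \<le> M * norm x)}"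

definition adj :: "'a::complex_inner set \<Rightarrow> 'b::complex_inner set \<Rightarrow> ('a \<Rightarrow> 'b) \<Rightarrow> 'b \<Rightarrow> 'a" where
  "adj H K A y = (THE x. x \<in> H \<and> (\<forall>h\<in>H. cinner (A h) y = cinner h x))"

definition positive_op :: "'a::complex_inner set \<Rightarrow> ('a \<Rightarrow> 'a) \<Rightarrow> bool" where
  "positive_op H A \<longleftrightarrow> A \<in> bops H H \<and> (\<forall>x\<in>H. cinner (A x) x \<in> \<real>\<^sub>\<ge>\<^sub>0)"

text \<open>The positive square root is unique as an operator on \<open>H\<close>; hence the choice only concerns
  its irrelevant values outside \<open>H\<close>.\<close>

definition sqrt_op :: "'a::complex_inner set \<Rightarrow> ('a \<Rightarrow> 'a) \<Rightarrow> 'a \<Rightarrow> 'a" where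
  "sqrt_op H A = (SOME P. positive_op H P \<and> (\<forall>x\<in>H. P (P x) = A x))"

definition abs_op :: "'a::complex_inner set \<Rightarrow> 'b::complex_inner set \<Rightarrow> ('a \<Rightarrow> 'b) \<Rightarrow> 'a \<Rightarrow> 'a" where
  "abs_op H K A = sqrt_op H (\<lambda>x. adj H K A (A x))"

definition isometric :: "'a::complex_inner set \<Rightarrow> 'b::complex_inner set \<Rightarrow> ('a \<Rightarrow> 'b) \<Rightarrow> bool" where
  "isometric H K A \<longleftrightarrow> A \<in> bops H K \<and> (\<forall>x\<in>H. norm (A x) = norm x)"

definition left_invertible ::
    "'a::complex_inner set \<Rightarrow> 'b::complex_inner set \<Rightarrow> ('a \<Rightarrow> 'b) \<Rightarrow> bool" where
  "left_invertible H K A \<longleftrightarrow> (\<exists>L\<in>bops K H. \<forall>x\<in>H. L (A x) = x)"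

definition commutant :: "'a::complex_inner set \<Rightarrow> ('a \<Rightarrow> 'a) set \<Rightarrow> ('a \<Rightarrow> 'a) set" where
  "commutant H F = {A \<in> bops H H. \<forall>B\<in>F. \<forall>x\<in>H. A (B x) = B (A x)}"

definition ortho_proj :: "'a::complex_inner set \<Rightarrow> 'a \<Rightarrow> 'a" where
  "ortho_proj M x = (THE y. y \<in> M \<and> (\<forall>z\<in>M. cinner (x - y) z = 0))"

text \<open>\<open>A \<subseteq> B\<close> for operators \<open>A\<close> on \<open>H\<close> and \<open>B\<close> on \<open>K\<close>, where \<open>H\<close> sits in \<open>K\<close> via \<open>j\<close>.\<close>

definition op_extends :: "'a set \<Rightarrow> ('a \<Rightarrow> 'b) \<Rightarrow> ('a \<Rightarrow> 'a) \<Rightarrow> ('b \<Rightarrow> 'b) \<Rightarrow> bool" where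
  "op_extends H j A B \<longleftrightarrow> (\<forall>h\<in>H. j (A h) = B (j h))"


section \<open>Subnormal operators\<close>

definition normal_op :: "'a::complex_inner set \<Rightarrow> ('a \<Rightarrow> 'a) \<Rightarrow> bool" where
  "normal_op K N \<longleftrightarrow> N \<in> bops K K \<and> (\<forall>x\<in>K. adj K K N (N x) = N (adj K K N x))"

definition normal_extension ::
    "'a::complex_inner set \<Rightarrow> ('a \<Rightarrow> 'a) \<Rightarrow> 'b::complex_inner set \<Rightarrow> ('a \<Rightarrow> 'b) \<Rightarrow> ('b \<Rightarrow> 'b) \<Rightarrow> bool"
  where
  "normal_extension H S K j N \<longleftrightarrow>
     closed_csubspace K \<and> isometric H K j \<and> normal_op K N \<and> op_extends H j S N"

text \<open>
  The extension space ranges over the closed subspaces of the ambient type of \<open>H\<close>.  This is no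
  restriction: a minimal normal extension acts on a space of the same dimension as \<open>H\<close>, hence
  on a unitary copy of \<open>H\<close> itself.
\<close>

definition subnormal :: "'a::complex_inner set \<Rightarrow> ('a \<Rightarrow> 'a) \<Rightarrow> bool" where
  "subnormal H S \<longleftrightarrow> S \<in> bops H H \<and> (\<exists>(K :: 'a set) j N. normal_extension H S K j N)"

definition reduces :: "'a::complex_inner set \<Rightarrow> ('a \<Rightarrow> 'a) \<Rightarrow> 'a set \<Rightarrow> bool" where
  "reduces K N M \<longleftrightarrow> (\<forall>x\<in>M. N x \<in> M) \<and> (\<forall>x\<in>K \<ominus>\<^sub>H M. N x \<in> K \<ominus>\<^sub>H M)"

definition minimal_normal_extension ::
    "'a::complex_inner set \<Rightarrow> ('a \<Rightarrow> 'a) \<Rightarrow> 'b::complex_inner set \<Rightarrow> ('a \<Rightarrow> 'b) \<Rightarrow> ('b \<Rightarrow> 'b) \<Rightarrow> bool"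
  where
  "minimal_normal_extension H S K j N \<longleftrightarrow> normal_extension H S K j N \<and>
     (\<forall>M. closed_csubspace M \<and> M \<subseteq> K \<and> j ` H \<subseteq> M \<and> reduces K N M \<longrightarrow> M = K)"

text \<open>\<open>B\<close> is the lift of \<open>A\<close> relative to the commutant of \<open>N\<close>, for a minimal normal extension
  \<open>N\<close> of \<open>S\<close>.\<close>

definition is_lift ::
    "'a::complex_inner set \<Rightarrow> ('a \<Rightarrow> 'a) \<Rightarrow> 'b::complex_inner set \<Rightarrow> ('a \<Rightarrow> 'b) \<Rightarrow> ('b \<Rightarrow> 'b) \<Rightarrow>
     ('a \<Rightarrow> 'a) \<Rightarrow> ('b \<Rightarrow> 'b) \<Rightarrow> bool" where
  "is_lift H S K j N A B \<longleftrightarrow> A \<in> commutant H {S, adj H H S} \<and>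
     B \<in> commutant K {N} \<inter> commutant K {ortho_proj (j ` H)} \<and> op_extends H j A B"


section \<open>Operator matrices and Brownian-type operators\<close>

definition op_matrix ::
    "('a::complex_inner \<Rightarrow> 'a) \<Rightarrow> ('b::complex_inner \<Rightarrow> 'a) \<Rightarrow> ('a \<Rightarrow> 'b) \<Rightarrow> ('b \<Rightarrow> 'b) \<Rightarrow>
     'a \<times> 'b \<Rightarrow> 'a \<times> 'b"
  where
  "op_matrix A B C D = (\<lambda>(x, y). (A x + B y, C x + D y))"

definition entry11 :: "('a::complex_inner \<times> 'b::complex_inner \<Rightarrow> 'a \<times> 'b) \<Rightarrow> 'a \<Rightarrow> 'a" where
  "entry11 T x = fst (T (x, 0))"

definition entry12 :: "('a::complex_inner \<times> 'b::complex_inner \<Rightarrow> 'a \<times> 'b) \<Rightarrow> 'b \<Rightarrow> 'a" where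
  "entry12 T y = fst (T (0, y))"

definition entry21 :: "('a::complex_inner \<times> 'b::complex_inner \<Rightarrow> 'a \<times> 'b) \<Rightarrow> 'a \<Rightarrow> 'b" where
  "entry21 T x = snd (T (x, 0))"

definition entry22 :: "('a::complex_inner \<times> 'b::complex_inner \<Rightarrow> 'a \<times> 'b) \<Rightarrow> 'b \<Rightarrow> 'b" where
  "entry22 T y = snd (T (0, y))"

definition matrix_extends ::
    "'a::complex_inner set \<Rightarrow> 'b::complex_inner set \<Rightarrow> ('a \<Rightarrow> 'c::complex_inner) \<Rightarrow>
     ('b \<Rightarrow> 'd::complex_inner) \<Rightarrow> ('a \<times> 'b \<Rightarrow> 'a \<times> 'b) \<Rightarrow> ('c \<times> 'd \<Rightarrow> 'c \<times> 'd) \<Rightarrow> bool" where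
  "matrix_extends H1 H2 j1 j2 T T' \<longleftrightarrow>
     (\<forall>x\<in>H1. j1 (entry11 T x) = entry11 T' (j1 x)) \<and>
     (\<forall>y\<in>H2. j1 (entry12 T y) = entry12 T' (j2 y)) \<and>
     (\<forall>x\<in>H1. j2 (entry21 T x) = entry21 T' (j1 x)) \<and>
     (\<forall>y\<in>H2. j2 (entry22 T y) = entry22 T' (j2 y))"

definition brownian_type ::
    "'a::complex_inner set \<Rightarrow> 'b::complex_inner set \<Rightarrow> ('a \<times> 'b \<Rightarrow> 'a \<times> 'b) set" where
  "brownian_type H1 H2 = {T \<in> bops (H1 \<times> H2) (H1 \<times> H2).
     closed_csubspace H1 \<and> H1 \<noteq> {0} \<and> closed_csubspace H2 \<and> H2 \<noteq> {0} \<and>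
     (\<forall>x\<in>H1. entry21 T x = 0) \<and>
     (let V = entry11 T; E = entry12 T; X = entry22 T in
       (\<forall>x\<in>H1. adj H1 H1 V (V x) = x) \<and>
       (\<forall>y\<in>H2. adj H1 H1 V (E y) = 0) \<and>
       (\<forall>y\<in>H2. X (adj H2 H1 E (E y)) = adj H2 H1 E (E (X y))))}"

definition brownian_subnormal ::
    "'a::complex_inner set \<Rightarrow> 'b::complex_inner set \<Rightarrow> ('a \<times> 'b \<Rightarrow> 'a \<times> 'b) set" where
  "brownian_subnormal H1 H2 = {T \<in> brownian_type H1 H2. subnormal H2 (entry22 T)}"

definition brownian_normal ::
    "'a::complex_inner set \<Rightarrow> 'b::complex_inner set \<Rightarrow> ('a \<times> 'b \<Rightarrow> 'a \<times> 'b) set" where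
  "brownian_normal H1 H2 = {T \<in> brownian_type H1 H2. normal_op H2 (entry22 T)}"

text \<open>
  The operator matrix with rows \<open>V' E'\<close> and \<open>0 N\<close> is a Brownian-type operator with normal
  corner on \<open>K1 \<oplus> K2\<close>; it extends the matrix with rows \<open>V E\<close> and \<open>0 S\<close> entrywise, and
  \<open>|E'|\<close> extends \<open>|E|\<close>, all with respect to the same isometric embeddings \<open>j1\<close> and \<open>j2\<close>.
\<close>

definition brownian_normal_extension ::
    "'a::complex_inner set \<Rightarrow> 'b::complex_inner set \<Rightarrow> ('a \<Rightarrow> 'a) \<Rightarrow> ('b \<Rightarrow> 'a) \<Rightarrow> ('b \<Rightarrow> 'b) \<Rightarrow>
     'c::complex_inner set \<Rightarrow> 'd::complex_inner set \<Rightarrow> ('a \<Rightarrow> 'c) \<Rightarrow> ('b \<Rightarrow> 'd) \<Rightarrow>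
     ('c \<Rightarrow> 'c) \<Rightarrow> ('d \<Rightarrow> 'c) \<Rightarrow> ('d \<Rightarrow> 'd) \<Rightarrow> bool" where
  "brownian_normal_extension H1 H2 V E S K1 K2 j1 j2 V' E' N \<longleftrightarrow>
     closed_csubspace K1 \<and> closed_csubspace K2 \<and> isometric H1 K1 j1 \<and> isometric H2 K2 j2 \<and>
     V' \<in> bops K1 K1 \<and> E' \<in> bops K2 K1 \<and> N \<in> bops K2 K2 \<and>
     op_matrix V' E' (\<lambda>_. 0) N \<in> brownian_normal K1 K2 \<and>
     matrix_extends H1 H2 j1 j2 (op_matrix V E (\<lambda>_. 0) S) (op_matrix V' E' (\<lambda>_. 0) N) \<and>
     op_extends H2 j2 (abs_op H2 H1 E) (abs_op K2 K1 E')"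

end

theory Submission
  imports Defs
begin

text \<open>
  Let \<open>S\<close> commute with \<open>A = \<bar>E\<bar>\<close> and let \<open>N\<close> on \<open>K\<close> be a minimal normal extension of \<open>S\<close>, so that
  the sums \<open>\<Sum>\<^sub>k N*\<^sup>k h\<^sub>k\<close> are dense in \<open>K\<close>.  For a positive operator \<open>C = Q\<^sup>2\<close> commuting with \<open>S\<close> one has
  \<open>\<langle>\<Sum>\<^sub>k N*\<^sup>k C h\<^sub>k, \<Sum>\<^sub>k N*\<^sup>k h\<^sub>k\<rangle> = \<parallel>\<Sum>\<^sub>k N*\<^sup>k Q h\<^sub>k\<parallel>\<^sup>2 \<ge> 0\<close>.  With \<open>C = c\<^sup>2 I - A\<^sup>2\<close> this shows that \<open>A\<close> extends to a
  bounded positive operator \<open>B\<close> commuting with \<open>N\<close>, and with \<open>C = A\<^sup>2 - c\<^sup>2 I\<close> that lower bounds of \<open>A\<close> pass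
  to \<open>B\<close>.  The operator \<open>B\<close> is \<open>\<bar>E'\<bar>\<close> for an \<open>E'\<close> that agrees with \<open>E\<close> on \<open>H\<^sub>2\<close> and with \<open>B\<close> on
  \<open>K \<ominus> H\<^sub>2\<close>, with values in \<open>H\<^sub>1\<close> enlarged by \<open>L = closure (B (K \<ominus> H\<^sub>2))\<close>.  A further copy of
  \<open>H\<^sub>1\<close> gives room to extend \<open>V\<close> to an isometry whose range misses exactly \<open>D\<close> and the range of \<open>E'\<close>.
\<close>

section \<open>Complex inner product spaces\<close>

text \<open>The positivity argument needs a root Q of C that commutes with S. This is why square
  roots are built from the binomial series: such a root is a limit of polynomials in C and commutes
  with whatever commutes with C. The bound on the sums also makes the lift well defined, since a
  vector of K has many representations as a sum.

  The obstacle in (iii) is dim K1 = dim H1. The space L comes from K, whose dimension is that of H2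
  and may exceed that of H1. It is small all the same: the closed range of B is generated by the
  vectors N*^k E* x with x in H1, so an infinite-dimensional H1 bounds its dimension. V' has to
  cover the part R of the defect space left over by D, and dim R may differ from dim L; adding a
  copy of H1 to both makes them isomorphic. If H1 is finite-dimensional there is no room for such a
  copy, but then V is unitary, which forces E = 0 and D = 0.\<close>

instance chilbert \<subseteq> banach ..

lemma scaleC_zero_left [simp]: "0 *\<^sub>C x = (0::'a::complex_inner)"
  using scaleC_of_real[of 0 x] by simp

lemma scaleC_zero_right [simp]: "c *\<^sub>C (0::'a::complex_inner) = 0"
  using scaleC_add_right[of c 0 "0::'a"] by simp

lemma scaleC_one [simp]: "1 *\<^sub>C x = (x::'a::complex_inner)"
  using scaleC_of_real[of 1 x] by simp

lemma scaleC_minus_one: "(-1) *\<^sub>C x = - (x::'a::complex_inner)"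
  using scaleC_of_real[of "-1" x] by simp

lemma scaleC_minus_right [simp]: "c *\<^sub>C (- x) = - (c *\<^sub>C (x::'a::complex_inner))"
  using scaleC_add_right[of c x "-x"] by (simp add: eq_neg_iff_add_eq_0 add.commute)

lemma scaleC_diff_right: "c *\<^sub>C (x - y) = c *\<^sub>C x - c *\<^sub>C (y::'a::complex_inner)"
  using scaleC_add_right[of c x "-y"] by simp

lemma cinner_add_right: "cinner x (y + z) = cinner x y + cinner x (z::'a::complex_inner)"
  by (metis cinner_add_left cinner_commute complex_cnj_add)

lemma cinner_scaleC_right [simp]: "cinner x (c *\<^sub>C y) = cnj c * cinner x (y::'a::complex_inner)"
  by (metis cinner_scaleC_left cinner_commute complex_cnj_mult)

declare cinner_scaleC_left [simp]

lemma cinner_scaleR_left [simp]: "cinner (r *\<^sub>R x) y = of_real r * cinner x (y::'a::complex_inner)"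
  by (metis cinner_scaleC_left scaleC_of_real)

lemma cinner_scaleR_right [simp]: "cinner x (r *\<^sub>R y) = of_real r * cinner x (y::'a::complex_inner)"
  by (metis cinner_scaleC_right complex_cnj_complex_of_real scaleC_of_real)

lemma cinner_zero_left [simp]: "cinner 0 (x::'a::complex_inner) = 0"
  using cinner_add_left[of 0 0 x] by simp

lemma cinner_zero_right [simp]: "cinner (x::'a::complex_inner) 0 = 0"
  using cinner_add_right[of x 0 0] by simp

lemma cinner_minus_left [simp]: "cinner (- x) y = - cinner x (y::'a::complex_inner)"
  using cinner_add_left[of x "-x" y] by (simp add: eq_neg_iff_add_eq_0 add.commute)

lemma cinner_minus_right [simp]: "cinner x (- y) = - cinner x (y::'a::complex_inner)"
  using cinner_add_right[of x y "-y"] by (simp add: eq_neg_iff_add_eq_0 add.commute)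

lemma cinner_diff_left: "cinner (x - y) z = cinner x z - cinner y (z::'a::complex_inner)"
  using cinner_add_left[of x "-y" z] by simp

lemma cinner_diff_right: "cinner x (y - z) = cinner x y - cinner x (z::'a::complex_inner)"
  using cinner_add_right[of x y "-z"] by simp

lemma cinner_sum_left: "cinner (\<Sum>i\<in>I. f i) x = (\<Sum>i\<in>I. cinner (f i) (x::'a::complex_inner))"
  by (induction I rule: infinite_finite_induct) (auto simp: cinner_add_left)

lemma cinner_sum_right: "cinner x (\<Sum>i\<in>I. f i) = (\<Sum>i\<in>I. cinner (x::'a::complex_inner) (f i))"
  by (induction I rule: infinite_finite_induct) (auto simp: cinner_add_right)

lemma cinner_self: "cinner x x = of_real ((norm (x::'a::complex_inner))\<^sup>2)"
proof -
  have "Im (cinner x x) = 0"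
    using cinner_commute[of x x] by (metis Reals_cnj_iff complex_is_Real_iff)
  then show ?thesis
    by (simp add: complex_eq_iff Re_cinner power2_norm_eq_inner)
qed

lemma cinner_self_eq_0 [simp]: "cinner x x = 0 \<longleftrightarrow> x = (0::'a::complex_inner)"
  by (simp add: cinner_self)

lemma norm_eq_of_cinner_eq: "cinner x x = cinner y y \<Longrightarrow> norm x = norm y"
proof -
  assume "cinner x x = cinner y y"
  then have "(norm x)\<^sup>2 = (norm y)\<^sup>2"
    unfolding cinner_self by (simp only: of_real_eq_iff)
  then show "norm x = norm y" by (simp add: power2_eq_iff_nonneg)
qed

lemma cinner_eq_0_commute: "cinner x y = 0 \<longleftrightarrow> cinner y (x::'a::complex_inner) = 0"
  by (metis cinner_commute complex_cnj_zero)

lemma norm_scaleC [simp]: "norm (c *\<^sub>C (x::'a::complex_inner)) = cmod c * norm x"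
proof -
  have "complex_of_real ((norm (c *\<^sub>C x))\<^sup>2) = complex_of_real ((cmod c * norm x)\<^sup>2)"
  proof -
    have "complex_of_real ((norm (c *\<^sub>C x))\<^sup>2) = c * cnj c * cinner x x"
      unfolding cinner_self[symmetric] by (simp add: mult.assoc mult.left_commute)
    then show ?thesis
      by (simp only: cinner_self complex_norm_square[symmetric] power_mult_distrib of_real_mult)
  qed
  then have "(norm (c *\<^sub>C x))\<^sup>2 = (cmod c * norm x)\<^sup>2"
    by (simp only: of_real_eq_iff)
  then show ?thesis
    by (simp add: power2_eq_iff_nonneg)
qed

text \<open>Multiplication of \<open>x\<close> by a unimodular scalar makes the inner product real
  and nonnegative, so the Cauchy-Schwarz inequality of the underlying real space applies.\<close>

lemma cinner_bound: "cmod (cinner x y) \<le> norm x * norm (y::'a::complex_inner)"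
proof (cases "cinner x y = 0")
  case False
  define c where "c = cnj (cinner x y) / cmod (cinner x y)"
  have c1: "cmod c = 1"
    using False by (simp add: c_def norm_divide)
  have "c * cinner x y = cmod (cinner x y)"
    using False complex_norm_square[of "cinner x y"]
    by (simp add: c_def field_simps power2_eq_square)
  then have "cmod (cinner x y) = Re (cinner (c *\<^sub>C x) y)"
    by simp
  also have "\<dots> \<le> norm (c *\<^sub>C x) * norm y"
    unfolding Re_cinner by (rule norm_cauchy_schwarz)
  finally show ?thesis
    using c1 by simp
qed simp

lemma bounded_bilinear_cinner: "bounded_bilinear (cinner :: 'a::complex_inner \<Rightarrow> 'a \<Rightarrow> complex)"
proof
  show "\<exists>K. \<forall>a b. norm (cinner a (b::'a)) \<le> norm a * norm b * K"
    by (rule exI[of _ 1]) (simp add: cinner_bound)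
qed (simp_all add: cinner_add_left cinner_add_right scaleR_conv_of_real)

lemmas tendsto_cinner = bounded_bilinear.tendsto[OF bounded_bilinear_cinner]
lemmas continuous_on_cinner [continuous_intros] = bounded_bilinear.continuous_on[OF bounded_bilinear_cinner]

lemma bounded_linear_scaleC: "bounded_linear (\<lambda>x::'a::complex_inner. c *\<^sub>C x)"
proof (rule bounded_linear_intro[where K = "cmod c"])
  show "c *\<^sub>C (r *\<^sub>R x) = r *\<^sub>R (c *\<^sub>C x)" for r and x :: 'a
    by (simp flip: scaleC_of_real add: scaleC_scaleC mult.commute)
qed (simp_all add: scaleC_add_right mult.commute)

lemma norm_add_cinner:
  "(norm (x + y))\<^sup>2 = (norm x)\<^sup>2 + (norm y)\<^sup>2 + 2 * Re (cinner x (y::'a::complex_inner))"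
  by (simp add: Re_cinner power2_norm_eq_inner inner_add_left inner_add_right inner_commute)

lemma norm_diff_cinner:
  "(norm (x - y))\<^sup>2 = (norm x)\<^sup>2 + (norm y)\<^sup>2 - 2 * Re (cinner x (y::'a::complex_inner))"
  by (simp add: Re_cinner power2_norm_eq_inner inner_diff_left inner_diff_right inner_commute)

lemma cinner_ext:
  assumes "x \<in> H" "y \<in> H" "csubspace H" and "\<And>h. h \<in> H \<Longrightarrow> cinner h x = cinner h (y::'a::complex_inner)"
  shows "x = y"
proof -
  have "x + (-1) *\<^sub>C y \<in> H"
    using assms unfolding csubspace_def by blast
  then have "x - y \<in> H"
    by (simp add: scaleC_minus_one)
  then have "cinner (x - y) (x - y) = 0"
    using assms(4) by (simp add: cinner_diff_right)
  then show ?thesis by simp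
qed

section \<open>Closed subspaces\<close>

lemma csubspaceD:
  assumes "csubspace M"
  shows csubspace_0: "0 \<in> M" and csubspace_add: "x \<in> M \<Longrightarrow> y \<in> M \<Longrightarrow> x + y \<in> M"
    and csubspace_scaleC: "x \<in> M \<Longrightarrow> c *\<^sub>C x \<in> M"
    and csubspace_scaleR: "x \<in> M \<Longrightarrow> r *\<^sub>R x \<in> M"
    and csubspace_minus: "x \<in> M \<Longrightarrow> - x \<in> M"
    and csubspace_diff: "x \<in> M \<Longrightarrow> y \<in> M \<Longrightarrow> x - y \<in> M"
    and csubspace_sum: "(\<And>i. i \<in> I \<Longrightarrow> f i \<in> M) \<Longrightarrow> (\<Sum>i\<in>I. f i) \<in> M"
proof -
  show 0: "0 \<in> M" and add: "\<And>x y. x \<in> M \<Longrightarrow> y \<in> M \<Longrightarrow> x + y \<in> M"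
    and sc: "\<And>x c. x \<in> M \<Longrightarrow> c *\<^sub>C x \<in> M"
    using assms by (auto simp: csubspace_def)
  show "\<And>x r. x \<in> M \<Longrightarrow> r *\<^sub>R x \<in> M"
    by (metis sc scaleC_of_real)
  show neg: "\<And>x. x \<in> M \<Longrightarrow> - x \<in> M"
    by (metis sc scaleC_minus_one)
  show "\<And>x y. x \<in> M \<Longrightarrow> y \<in> M \<Longrightarrow> x - y \<in> M"
    using add neg by fastforce
  show "(\<And>i. i \<in> I \<Longrightarrow> f i \<in> M) \<Longrightarrow> (\<Sum>i\<in>I. f i) \<in> M"
    by (induction I rule: infinite_finite_induct) (auto intro: 0 add)
qed

lemma closed_csubspaceD:
  assumes "closed_csubspace M"
  shows ccs_csubspace: "csubspace M" and ccs_closed: "closed M"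
  using assms by (auto simp: closed_csubspace_def)

lemmas ccs_0 = csubspace_0[OF ccs_csubspace]
lemmas ccs_add = csubspace_add[OF ccs_csubspace]
lemmas ccs_diff = csubspace_diff[OF ccs_csubspace]
lemmas ccs_scaleC = csubspace_scaleC[OF ccs_csubspace]
lemmas ccs_scaleR = csubspace_scaleR[OF ccs_csubspace]

lemma csubspace_closure:
  assumes "csubspace (M::'a::complex_inner set)"
  shows "closed_csubspace (closure M)"
  unfolding closed_csubspace_def csubspace_def
proof (intro conjI ballI allI)
  show "0 \<in> closure M"
    using csubspace_0[OF assms] closure_subset by blast
  show "x + y \<in> closure M" if xy: "x \<in> closure M" "y \<in> closure M" for x y
  proof -
    obtain f g where "\<forall>n. f n \<in> M" "f \<longlonglongrightarrow> x" "\<forall>n. g n \<in> M" "g \<longlonglongrightarrow> y"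
      using xy unfolding closure_sequential by blast
    then show ?thesis
      unfolding closure_sequential
      by (intro exI[of _ "\<lambda>n. f n + g n"] conjI tendsto_add) (auto intro: csubspace_add[OF assms])
  qed
  show "c *\<^sub>C x \<in> closure M" if x: "x \<in> closure M" for c x
  proof -
    obtain f where "\<forall>n. f n \<in> M" "f \<longlonglongrightarrow> x"
      using x unfolding closure_sequential by blast
    then show ?thesis
      unfolding closure_sequential
      by (intro exI[of _ "\<lambda>n. c *\<^sub>C f n"] conjI bounded_linear.tendsto[OF bounded_linear_scaleC])
        (auto intro: csubspace_scaleC[OF assms])
  qed
qed simp

lemma closed_csubspace_Inter:
  assumes "\<And>M. M \<in> F \<Longrightarrow> closed_csubspace M"
  shows "closed_csubspace (\<Inter>F)"
  using assms unfolding closed_csubspace_def csubspace_def by (auto intro: closed_Inter)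

lemma closed_csubspace_closed_cspan: "closed_csubspace (closed_cspan X)"
  unfolding closed_cspan_def by (rule closed_csubspace_Inter) auto

lemma closed_cspan_superset: "X \<subseteq> closed_cspan X"
  unfolding closed_cspan_def by auto

lemma closed_cspan_minimal: "closed_csubspace M \<Longrightarrow> X \<subseteq> M \<Longrightarrow> closed_cspan X \<subseteq> M"
  unfolding closed_cspan_def by auto

lemma closed_csubspace_Int:
  "closed_csubspace M \<Longrightarrow> closed_csubspace N \<Longrightarrow> closed_csubspace (M \<inter> N)"
  unfolding closed_csubspace_def csubspace_def by auto

lemma closed_csubspace_Times:
  "closed_csubspace M \<Longrightarrow> closed_csubspace N \<Longrightarrow> closed_csubspace (M \<times> N)"
  unfolding closed_csubspace_def csubspace_def
  by (auto simp: scaleC_prod_def closed_Times zero_prod_def)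

lemma closed_csubspace_cinner_zero: "closed_csubspace {x. \<forall>y\<in>Y. cinner x (y::'a::complex_inner) = 0}"
proof -
  have "closed (\<Inter>y\<in>Y. {x::'a. cinner x y = 0})"
    by (intro closed_INT ballI closed_Collect_eq continuous_intros)
  moreover have "(\<Inter>y\<in>Y. {x::'a. cinner x y = 0}) = {x. \<forall>y\<in>Y. cinner x y = 0}"
    by auto
  ultimately show ?thesis
    by (auto simp: closed_csubspace_def csubspace_def cinner_add_left)
qed

lemma closed_csubspace_ominus: "closed_csubspace K \<Longrightarrow> closed_csubspace (K \<ominus>\<^sub>H M)"
proof -
  assume "closed_csubspace K"
  then have "closed_csubspace (K \<inter> {x. \<forall>y\<in>M. cinner x y = 0})"
    by (intro closed_csubspace_Int closed_csubspace_cinner_zero)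
  then show ?thesis
    by (simp add: ominus_def Int_def)
qed

lemma cinner_closed_cspan_zero:
  assumes "\<And>y. y \<in> Y \<Longrightarrow> cinner x y = 0" and "y \<in> closed_cspan Y"
  shows "cinner x y = 0"
proof -
  have "closed_cspan Y \<subseteq> {y. \<forall>z\<in>{x}. cinner y z = 0}"
    by (rule closed_cspan_minimal[OF closed_csubspace_cinner_zero])
      (use assms(1) cinner_eq_0_commute in blast)
  then show ?thesis
    using assms(2) cinner_eq_0_commute by blast
qed

lemma cinner_closure_zero:
  assumes "\<And>y. y \<in> Y \<Longrightarrow> cinner x y = 0" and "y \<in> closure Y"
  shows "cinner x y = 0"
proof -
  have "closure Y \<subseteq> {y. \<forall>z\<in>{x}. cinner y z = 0}"
    by (rule closure_minimal)
      (use assms(1) cinner_eq_0_commute ccs_closed[OF closed_csubspace_cinner_zero] in blast)+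
  then show ?thesis
    using assms(2) cinner_eq_0_commute by blast
qed

section \<open>Riesz representation, adjoints and projections\<close>

text \<open>The representing vector minimises \<open>\<parallel>x\<parallel>\<^sup>2 - 2 f x\<close>.\<close>

lemma riesz_real:
  fixes H :: "'a::chilbert set" and f :: "'a \<Rightarrow> real"
  assumes H: "closed_csubspace H"
    and add: "\<And>x y. x \<in> H \<Longrightarrow> y \<in> H \<Longrightarrow> f (x + y) = f x + f y"
    and sc: "\<And>x r. x \<in> H \<Longrightarrow> f (r *\<^sub>R x) = r * f x"
    and bd: "\<And>x. x \<in> H \<Longrightarrow> \<bar>f x\<bar> \<le> M * norm x"
  obtains x where "x \<in> H" "\<And>y. y \<in> H \<Longrightarrow> f y = inner y x"
proof -
  define J where "J x = (norm x)\<^sup>2 - 2 * f x" for x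
  define m where "m = Inf (J ` H)"
  have Jlb: "J x \<ge> - M\<^sup>2" if "x \<in> H" for x
  proof -
    have "0 \<le> (norm x - M)\<^sup>2" by simp
    then show ?thesis
      using bd[OF that] unfolding J_def by (auto simp: power2_diff algebra_simps)
  qed
  have bdd: "bdd_below (J ` H)"
    using Jlb by (auto intro: bdd_belowI[of _ "- M\<^sup>2"])
  have ne: "H \<noteq> {}"
    using ccs_0[OF H] by auto
  have m: "m \<le> J x" if "x \<in> H" for x
    unfolding m_def using bdd that by (auto intro: cInf_lower)
  have "\<exists>x\<in>H. J x < m + inverse (of_nat (Suc n))" for n
    using cInf_lessD[of "J ` H" "m + inverse (of_nat (Suc n))"] ne unfolding m_def by auto
  then obtain u where u: "\<And>n. u n \<in> H" "\<And>n. J (u n) < m + inverse (of_nat (Suc n))"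
    by metis
  have fdiff: "f (x - y) = f x - f y" if "x \<in> H" "y \<in> H" for x y
    using add[of x "-1 *\<^sub>R y"] sc[of y "-1"] that csubspace_minus[OF ccs_csubspace[OF H]] by simp
  \<comment> \<open>The parallelogram law for J: the linear parts of J cancel on both sides.\<close>
  have par: "(norm (u a - u b))\<^sup>2 = 2 * J (u a) + 2 * J (u b) - 4 * J ((1/2) *\<^sub>R (u a + u b))" for a b
  proof -
    have f: "f ((1/2) *\<^sub>R (u a + u b)) = (f (u a) + f (u b)) / 2"
      using sc[of "u a + u b" "1/2"] add[of "u a" "u b"] u(1) ccs_add[OF H] by simp
    have "(norm ((1/2) *\<^sub>R (u a + u b)))\<^sup>2 = (norm (u a + u b))\<^sup>2 / 4"
      by (simp add: power2_eq_square)
    then show ?thesis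
      unfolding J_def f
      by (simp add: power2_norm_eq_inner inner_add_left inner_add_right inner_diff_left
          inner_diff_right inner_commute algebra_simps)
  qed
  \<comment> \<open>Both points are almost minimal while their midpoint has J at least
    \<open>m\<close>, so the identity for the midpoint bounds the distance.\<close>
  have cau: "(norm (u a - u b))\<^sup>2 \<le> 4 * inverse (of_nat (Suc k))" if "a \<ge> k" "b \<ge> k" for a b k
  proof -
    have "inverse (of_nat (Suc a)) \<le> inverse (real (Suc k))" "inverse (of_nat (Suc b)) \<le> inverse (real (Suc k))"
      using that by (auto intro: le_imp_inverse_le)
    moreover have "m \<le> J ((1/2) *\<^sub>R (u a + u b))"
      by (intro m ccs_scaleR[OF H] ccs_add[OF H] u)
    ultimately show ?thesis
      unfolding par using u(2)[of a] u(2)[of b] by linarith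
  qed
  have "Cauchy u"
  proof (rule metric_CauchyI)
    fix e :: real assume e: "e > 0"
    obtain k where k: "inverse (real (Suc k)) < e\<^sup>2 / 4"
      using reals_Archimedean[of "e\<^sup>2 / 4"] e by auto
    have "dist (u a) (u b) < e" if "a \<ge> k" "b \<ge> k" for a b
    proof -
      have "(norm (u a - u b))\<^sup>2 < e\<^sup>2"
        using cau[OF that] k by linarith
      then show ?thesis
        using e by (auto simp: dist_norm intro: power2_less_imp_less)
    qed
    then show "\<exists>k. \<forall>a\<ge>k. \<forall>b\<ge>k. dist (u a) (u b) < e" by blast
  qed
  then obtain x where x: "u \<longlonglongrightarrow> x"
    using Cauchy_convergent convergent_def by blast
  have xH: "x \<in> H"
    using closed_sequentially[OF ccs_closed[OF H] _ x] u(1) by blast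
  have "(\<lambda>n. f (u n - x)) \<longlonglongrightarrow> 0"
  proof (rule tendsto_0_le[where K = M])
    show "(\<lambda>n. u n - x) \<longlonglongrightarrow> 0" using x by (simp add: LIM_zero)
    show "\<forall>\<^sub>F n in sequentially. norm (f (u n - x)) \<le> norm (u n - x) * M"
      using bd ccs_diff[OF H u(1) xH] by (auto simp: mult.commute)
  qed
  then have "(\<lambda>n. f (u n - x) + f x) \<longlonglongrightarrow> 0 + f x"
    by (intro tendsto_intros)
  then have fl: "(\<lambda>n. f (u n)) \<longlonglongrightarrow> f x"
    by (simp add: fdiff u xH)
  have "(\<lambda>n. J (u n)) \<longlonglongrightarrow> J x"
    unfolding J_def by (intro tendsto_intros x fl)
  moreover have "(\<lambda>n. m + inverse (of_nat (Suc n))) \<longlonglongrightarrow> m + 0"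
    by (intro tendsto_intros LIMSEQ_inverse_real_of_nat)
  ultimately have Jx: "J x \<le> m"
    using u(2) by (intro LIMSEQ_le[of "\<lambda>n. J (u n)" "J x" "\<lambda>n. m + inverse (of_nat (Suc n))"])
      (auto intro: less_imp_le)
  have "f y = inner y x" if y: "y \<in> H" for y
  proof -
    define d where "d = inner y x - f y"
    have *: "0 \<le> t * (2 * d) + t\<^sup>2 * (norm y)\<^sup>2" for t
    proof -
      have "J x \<le> J (x + t *\<^sub>R y)"
        using m[of "x + t *\<^sub>R y"] Jx ccs_add[OF H] ccs_scaleR[OF H] xH y by fastforce
      moreover have "f (x + t *\<^sub>R y) = f x + t * f y"
        using add sc ccs_scaleR[OF H] xH y by simp
      moreover have "(norm (x + t *\<^sub>R y))\<^sup>2 = (norm x)\<^sup>2 + 2 * t * inner y x + t\<^sup>2 * (norm y)\<^sup>2"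
        unfolding power2_norm_eq_inner
        by (simp add: inner_add_left inner_add_right inner_commute power2_eq_square)
      ultimately show ?thesis
        unfolding J_def d_def by (simp add: algebra_simps)
    qed
    have "d = 0"
    proof (rule ccontr)
      assume d: "d \<noteq> 0"
      \<comment> \<open>The quadratic is evaluated near its minimum, at t = -d/q. Adding 1 to the
        squared norm keeps \<open>q\<close> positive also for y = 0.\<close>
      define q where "q = 1 + (norm y)\<^sup>2"
      have q: "q > 0" "(norm y)\<^sup>2 \<le> q" by (auto simp: q_def add_pos_nonneg)
      have "0 \<le> (- d / q) * (2 * d) + (- d / q)\<^sup>2 * (norm y)\<^sup>2" by (rule *)
      also have "\<dots> \<le> (- d / q) * (2 * d) + (- d / q)\<^sup>2 * q"
        using q by (intro add_left_mono mult_left_mono) auto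
      also have "\<dots> = - (d\<^sup>2 / q)"
        using q(1) by (simp add: power2_eq_square)
      finally show False using d q(1) by (simp add: divide_le_0_iff)
    qed
    then show ?thesis by (simp add: d_def)
  qed
  with that xH show ?thesis by blast
qed

text \<open>The real part is represented by \<open>riesz_real\<close>; complex linearity recovers
  the imaginary part from it, since Im f(y) = Re f(-i y).\<close>

lemma riesz:
  fixes H :: "'a::chilbert set" and f :: "'a \<Rightarrow> complex"
  assumes H: "closed_csubspace H"
    and add: "\<And>x y. x \<in> H \<Longrightarrow> y \<in> H \<Longrightarrow> f (x + y) = f x + f y"
    and sc: "\<And>x c. x \<in> H \<Longrightarrow> f (c *\<^sub>C x) = c * f x"
    and bd: "\<And>x. x \<in> H \<Longrightarrow> cmod (f x) \<le> M * norm x"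
  obtains x where "x \<in> H" "\<And>y. y \<in> H \<Longrightarrow> f y = cinner y x"
proof -
  have "\<exists>x\<in>H. \<forall>y\<in>H. Re (f y) = inner y x"
  proof (rule riesz_real[OF H, of "\<lambda>x. Re (f x)" M])
    show "Re (f (r *\<^sub>R x)) = r * Re (f x)" if "x \<in> H" for x r
      using sc[OF that, of "of_real r"] by (simp add: scaleC_of_real)
    show "\<bar>Re (f x)\<bar> \<le> M * norm x" if "x \<in> H" for x
      using bd[OF that] abs_Re_le_cmod order_trans by blast
  qed (auto simp: add)
  then obtain x where x: "x \<in> H" "\<And>y. y \<in> H \<Longrightarrow> Re (f y) = Re (cinner y x)"
    by (auto simp: Re_cinner)
  have "f y = cinner y x" if y: "y \<in> H" for y
  proof (rule complex_eqI)
    have "Re (f ((-\<i>) *\<^sub>C y)) = Re (cinner ((-\<i>) *\<^sub>C y) x)"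
      by (rule x(2)[OF ccs_scaleC[OF H y]])
    then show "Im (f y) = Im (cinner y x)"
      by (simp add: sc[OF y])
  qed (rule x(2)[OF y])
  with that x(1) show ?thesis by blast
qed

section \<open>Bounded operators and adjoints\<close>

lemma bopsD:
  assumes "A \<in> bops H K"
  shows bops_in: "x \<in> H \<Longrightarrow> A x \<in> K" and bops_add: "x \<in> H \<Longrightarrow> y \<in> H \<Longrightarrow> A (x + y) = A x + A y"
    and bops_scaleC: "x \<in> H \<Longrightarrow> A (c *\<^sub>C x) = c *\<^sub>C A x"
    and bops_scaleR: "x \<in> H \<Longrightarrow> A (r *\<^sub>R x) = r *\<^sub>R A x"
    and bops_minus: "x \<in> H \<Longrightarrow> A (- x) = - A x"
proof -
  show in_K: "x \<in> H \<Longrightarrow> A x \<in> K" and "x \<in> H \<Longrightarrow> y \<in> H \<Longrightarrow> A (x + y) = A x + A y"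
    and sc: "x \<in> H \<Longrightarrow> A (c *\<^sub>C x) = c *\<^sub>C A x" for c
    using assms unfolding bops_def by blast+
  show "x \<in> H \<Longrightarrow> A (r *\<^sub>R x) = r *\<^sub>R A x"
    using sc[of "of_real r"] by (simp add: scaleC_of_real)
  show "x \<in> H \<Longrightarrow> A (- x) = - A x"
    using sc[of "-1"] by (simp add: scaleC_minus_one)
qed

lemma bops_bound:
  assumes "A \<in> bops H K"
  obtains M where "M > 0" "\<And>x. x \<in> H \<Longrightarrow> norm (A x) \<le> M * norm x"
proof -
  obtain M where M: "\<And>x. x \<in> H \<Longrightarrow> norm (A x) \<le> M * norm x"
    using assms unfolding bops_def by blast
  have "norm (A x) \<le> (max M 1) * norm x" if "x \<in> H" for x
    using M[OF that] by (meson max.cobounded1 mult_right_mono norm_ge_zero order_trans)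
  then show ?thesis using that[of "max M 1"] by auto
qed

lemma bops_0: "csubspace H \<Longrightarrow> A \<in> bops H K \<Longrightarrow> A 0 = 0"
  by (metis bops_scaleC csubspace_0 scaleC_zero_left)

lemma bops_diff: "csubspace H \<Longrightarrow> A \<in> bops H K \<Longrightarrow> x \<in> H \<Longrightarrow> y \<in> H \<Longrightarrow> A (x - y) = A x - A y"
  using bops_add[of A H K x "-y"] bops_minus[of A H K y] csubspace_minus[of H y] by simp

lemma bops_sum:
  assumes "csubspace H" "A \<in> bops H K" "\<And>i. i \<in> I \<Longrightarrow> f i \<in> H"
  shows "A (\<Sum>i\<in>I. f i) = (\<Sum>i\<in>I. A (f i))"
  using assms(3)
proof (induction I rule: infinite_finite_induct)
  case (insert i I)
  then show ?case
    using bops_add[OF assms(2), of "f i" "\<Sum>i\<in>I. f i"] csubspace_sum[OF assms(1), of I f] by simp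
qed (simp_all add: bops_0[OF assms(1,2)])

lemma bopsI:
  assumes "\<And>x. x \<in> H \<Longrightarrow> A x \<in> K" "\<And>x y. x \<in> H \<Longrightarrow> y \<in> H \<Longrightarrow> A (x + y) = A x + A y"
    "\<And>c x. x \<in> H \<Longrightarrow> A (c *\<^sub>C x) = c *\<^sub>C A x" "\<And>x. x \<in> H \<Longrightarrow> norm (A x) \<le> M * norm x"
  shows "A \<in> bops H K"
  unfolding bops_def using assms by blast

lemma bops_mono: "A \<in> bops H K \<Longrightarrow> H' \<subseteq> H \<Longrightarrow> (\<And>x. x \<in> H' \<Longrightarrow> A x \<in> K') \<Longrightarrow> A \<in> bops H' K'"
  unfolding bops_def by blast

lemma bops_id: "(\<lambda>x. x) \<in> bops H H"
  by (rule bopsI[where M = 1]) auto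

lemma bops_zero: "0 \<in> K \<Longrightarrow> (\<lambda>x. 0) \<in> bops H K"
  by (rule bopsI[where M = 0]) auto

lemma bops_comp:
  assumes "A \<in> bops H K" "B \<in> bops K L"
  shows "(\<lambda>x. B (A x)) \<in> bops H L"
proof -
  obtain M M' where M: "M > 0" "\<And>x. x \<in> H \<Longrightarrow> norm (A x) \<le> M * norm x"
    "M' > 0" "\<And>x. x \<in> K \<Longrightarrow> norm (B x) \<le> M' * norm x"
    using bops_bound[OF assms(1)] bops_bound[OF assms(2)] by metis
  show ?thesis
  proof (rule bopsI[where M = "M' * M"])
    show "norm (B (A x)) \<le> M' * M * norm x" if x: "x \<in> H" for x
    proof -
      have "norm (B (A x)) \<le> M' * norm (A x)"
        using M(4) bops_in[OF assms(1) x] by blast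
      also have "\<dots> \<le> M' * (M * norm x)"
        using M x by (intro mult_left_mono) auto
      finally show ?thesis by (simp add: mult.assoc)
    qed
  qed (auto simp: bops_in[OF assms(1)] bops_in[OF assms(2)] bops_add[OF assms(1)] bops_add[OF assms(2)]
      bops_scaleC[OF assms(1)] bops_scaleC[OF assms(2)])
qed

lemma bops_funpow: "A \<in> bops H H \<Longrightarrow> (A ^^ n) \<in> bops H H"
proof (induction n)
  case 0
  then show ?case using bops_id[of H] by (simp add: id_def)
next
  case (Suc n)
  then show ?case using bops_comp[of "A ^^ n" H H A H] by (simp add: comp_def)
qed

lemma bops_lincomb:
  assumes "csubspace K" "A \<in> bops H K" "B \<in> bops H K"
  shows "(\<lambda>x. c *\<^sub>C A x + d *\<^sub>C B x) \<in> bops H K"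
proof -
  obtain M M' where M: "M > 0" "\<And>x. x \<in> H \<Longrightarrow> norm (A x) \<le> M * norm x"
    "M' > 0" "\<And>x. x \<in> H \<Longrightarrow> norm (B x) \<le> M' * norm x"
    using bops_bound[OF assms(2)] bops_bound[OF assms(3)] by metis
  show ?thesis
  proof (rule bopsI[where M = "cmod c * M + cmod d * M'"])
    show "norm (c *\<^sub>C A x + d *\<^sub>C B x) \<le> (cmod c * M + cmod d * M') * norm x" if x: "x \<in> H" for x
    proof -
      have "norm (c *\<^sub>C A x + d *\<^sub>C B x) \<le> cmod c * norm (A x) + cmod d * norm (B x)"
        using norm_triangle_ineq[of "c *\<^sub>C A x" "d *\<^sub>C B x"] by simp
      also have "\<dots> \<le> cmod c * (M * norm x) + cmod d * (M' * norm x)"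
        using M x by (intro add_mono mult_left_mono) auto
      finally show ?thesis by (simp add: algebra_simps)
    qed
    show "c *\<^sub>C A (x + y) + d *\<^sub>C B (x + y) = c *\<^sub>C A x + d *\<^sub>C B x + (c *\<^sub>C A y + d *\<^sub>C B y)"
      if "x \<in> H" "y \<in> H" for x y
      using that by (simp add: bops_add[OF assms(2)] bops_add[OF assms(3)] scaleC_add_right)
  qed (auto simp: bops_in[OF assms(2)] bops_in[OF assms(3)] bops_scaleC[OF assms(2)]
      bops_scaleC[OF assms(3)] csubspace_add[OF assms(1)] csubspace_scaleC[OF assms(1)]
      scaleC_add_right scaleC_scaleC mult.commute[of _ c] mult.commute[of _ d])
qed

lemma bops_diff_op: "csubspace K \<Longrightarrow> A \<in> bops H K \<Longrightarrow> B \<in> bops H K \<Longrightarrow> (\<lambda>x. A x - B x) \<in> bops H K"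
  using bops_lincomb[of K A H B 1 "-1"] by (simp add: scaleC_minus_one)

lemma bops_continuous:
  assumes "csubspace H" "A \<in> bops H K"
  shows "continuous_on H A"
proof -
  obtain M where M: "M > 0" "\<And>x. x \<in> H \<Longrightarrow> norm (A x) \<le> M * norm x"
    using bops_bound[OF assms(2)] by blast
  have "dist (A x) (A y) \<le> M * dist x y" if "x \<in> H" "y \<in> H" for x y
    using M(2)[of "x - y"] csubspace_diff[OF assms(1)] that bops_diff[OF assms] by (simp add: dist_norm)
  then have "M-lipschitz_on H A"
    using M(1) by (auto intro: lipschitz_onI)
  then show ?thesis
    by (rule lipschitz_on_continuous_on)
qed

lemma bops_tendsto:
  assumes "closed_csubspace H" "A \<in> bops H K" "u \<longlonglongrightarrow> x" "\<And>n. u n \<in> H"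
  shows "(\<lambda>n. A (u n)) \<longlonglongrightarrow> A x"
proof -
  have "x \<in> H"
    using closed_sequentially[OF ccs_closed[OF assms(1)] _ assms(3)] assms(4) by blast
  then show ?thesis
    using continuous_on_tendsto_compose[OF bops_continuous[OF ccs_csubspace[OF assms(1)] assms(2)]
        assms(3)] assms(4) by auto
qed

text \<open>Lets an identity between operators be checked on a generating set only.\<close>

lemma closed_csubspace_bops_eq:
  assumes "closed_csubspace H" "A \<in> bops H K" "B \<in> bops H K"
  shows "closed_csubspace {x \<in> H. A x = B x}"
proof -
  have "closed {x \<in> H. A x = B x}"
    using assms by (intro continuous_closed_preimage_constant[of H "\<lambda>x. A x - B x" 0, simplified] continuous_intros bops_continuous
        ccs_csubspace ccs_closed)
  then show ?thesis
    using assms(1) bops_0[OF ccs_csubspace assms(2)] bops_0[OF ccs_csubspace assms(3)]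
    unfolding closed_csubspace_def csubspace_def
    by (auto simp: bops_add[OF assms(2)] bops_add[OF assms(3)] bops_scaleC[OF assms(2)] bops_scaleC[OF assms(3)])
qed

lemma closed_csubspace_bops_preimage:
  assumes "closed_csubspace H" "A \<in> bops H K" "closed_csubspace M"
  shows "closed_csubspace {x \<in> H. A x \<in> M}"
proof -
  have "closed {x \<in> H. A x \<in> M}"
    using continuous_closed_preimage[OF bops_continuous[OF ccs_csubspace[OF assms(1)] assms(2)]
        ccs_closed[OF assms(1)] ccs_closed[OF assms(3)]]
    by (simp add: vimage_def Int_def)
  then show ?thesis
    using assms(1,3) bops_0[OF ccs_csubspace assms(2)]
    unfolding closed_csubspace_def csubspace_def
    by (auto simp: bops_add[OF assms(2)] bops_scaleC[OF assms(2)])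
qed

lemma csubspace_bops_image:
  assumes "csubspace H" "A \<in> bops H K"
  shows "csubspace (A ` H)"
  unfolding csubspace_def
proof (intro conjI ballI allI)
  show "0 \<in> A ` H"
    using bops_0[OF assms] csubspace_0[OF assms(1)] by force
  show "x + y \<in> A ` H" if xy: "x \<in> A ` H" "y \<in> A ` H" for x y
  proof -
    obtain a b where "a \<in> H" "b \<in> H" "x = A a" "y = A b"
      using xy by blast
    then show ?thesis
      using bops_add[OF assms(2), of a b] csubspace_add[OF assms(1), of a b] by force
  qed
  show "c *\<^sub>C x \<in> A ` H" if x: "x \<in> A ` H" for c x
  proof -
    obtain a where "a \<in> H" "x = A a"
      using x by blast
    then show ?thesis
      using bops_scaleC[OF assms(2), of a c] csubspace_scaleC[OF assms(1), of a c] by force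
  qed
qed

lemma adj_unique:
  assumes "closed_csubspace H" "x \<in> H" "\<And>h. h \<in> H \<Longrightarrow> cinner (A h) y = cinner h x"
  shows "adj H K A y = x"
  unfolding adj_def using assms
  by (intro the_equality) (auto intro!: cinner_ext[OF _ _ ccs_csubspace[OF assms(1)]])

lemma adj_works:
  fixes H :: "'a::chilbert set" and K :: "'b::chilbert set"
  assumes "closed_csubspace H" "A \<in> bops H K"
  shows adj_in: "adj H K A y \<in> H" and cinner_adj: "h \<in> H \<Longrightarrow> cinner (A h) y = cinner h (adj H K A y)"
proof -
  obtain M where M: "\<And>x. x \<in> H \<Longrightarrow> norm (A x) \<le> M * norm x"
    using bops_bound[OF assms(2)] by blast
  obtain x where x: "x \<in> H" "\<And>h. h \<in> H \<Longrightarrow> cinner (A h) y = cinner h x"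
  proof (rule riesz[OF assms(1), of "\<lambda>h. cinner (A h) y" "M * norm y"])
    show "cmod (cinner (A h) y) \<le> M * norm y * norm h" if "h \<in> H" for h
    proof -
      have "cmod (cinner (A h) y) \<le> norm (A h) * norm y" by (rule cinner_bound)
      also have "\<dots> \<le> (M * norm h) * norm y"
        by (intro mult_right_mono M that) auto
      finally show ?thesis by (simp add: mult.commute mult.left_commute)
    qed
  qed (auto simp: bops_add[OF assms(2)] bops_scaleC[OF assms(2)] cinner_add_left)
  have "adj H K A y = x"
    by (rule adj_unique[OF assms(1)]) (use x in auto)
  with x show "adj H K A y \<in> H" "h \<in> H \<Longrightarrow> cinner (A h) y = cinner h (adj H K A y)"
    by auto
qed

lemma cinner_adj':
  assumes "closed_csubspace (H::'a::chilbert set)" "A \<in> bops H (K::'b::chilbert set)" "h \<in> H"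
  shows "cinner y (A h) = cinner (adj H K A y) h"
  using cinner_adj[OF assms, of y] cinner_commute by metis

lemma norm_adj_le:
  fixes H :: "'a::chilbert set" and K :: "'b::chilbert set"
  assumes "closed_csubspace H" "A \<in> bops H K" "M \<ge> 0" "\<And>x. x \<in> H \<Longrightarrow> norm (A x) \<le> M * norm x"
  shows "norm (adj H K A y) \<le> M * norm y"
proof (cases "adj H K A y = 0")
  case False
  let ?x = "adj H K A y"
  have xH: "?x \<in> H" by (rule adj_in[OF assms(1,2)])
  have "(norm ?x)\<^sup>2 = Re (cinner ?x ?x)" by (simp add: cinner_self)
  also have "\<dots> = Re (cinner (A ?x) y)" by (simp add: cinner_adj[OF assms(1,2) xH])
  also have "\<dots> \<le> norm (A ?x) * norm y"
    by (meson cinner_bound complex_Re_le_cmod order_trans)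
  also have "\<dots> \<le> M * norm ?x * norm y"
    by (intro mult_right_mono assms(4) xH) auto
  finally show ?thesis
    using False by (simp add: power2_eq_square)
qed (use assms(3) in simp)

lemma bops_adj:
  fixes H :: "'a::chilbert set" and K :: "'b::chilbert set"
  assumes "closed_csubspace H" "A \<in> bops H K"
  shows "adj H K A \<in> bops K H"
proof -
  obtain M where M: "M > 0" "\<And>x. x \<in> H \<Longrightarrow> norm (A x) \<le> M * norm x"
    using bops_bound[OF assms(2)] by blast
  note cs = ccs_csubspace[OF assms(1)]
  note w = adj_in[OF assms] cinner_adj[OF assms]
  show ?thesis
  proof (rule bopsI[where M = M])
    show "adj H K A (x + y) = adj H K A x + adj H K A y" for x y
      by (rule adj_unique[OF assms(1)]) (auto simp: w csubspace_add[OF cs] cinner_add_right)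
    show "adj H K A (c *\<^sub>C x) = c *\<^sub>C adj H K A x" for c x
      by (rule adj_unique[OF assms(1)]) (auto simp: w csubspace_scaleC[OF cs])
    show "norm (adj H K A x) \<le> M * norm x" for x
      by (rule norm_adj_le[OF assms]) (use M in auto)
  qed (auto simp: w)
qed

text \<open>The projection of \<open>x\<close> is the Riesz vector of the functional that sends z in
  \<open>M\<close> to the inner product of z with x.\<close>

lemma ortho_proj_works:
  fixes M :: "'a::chilbert set"
  assumes "closed_csubspace M"
  shows ortho_proj_in: "ortho_proj M x \<in> M"
    and cinner_ortho_proj: "z \<in> M \<Longrightarrow> cinner (x - ortho_proj M x) z = 0"
proof -
  obtain y where y: "y \<in> M" "\<And>z. z \<in> M \<Longrightarrow> cinner z x = cinner z y"
  proof (rule riesz[OF assms, of "\<lambda>z. cinner z x" "norm x"])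
    show "cmod (cinner z x) \<le> norm x * norm z" for z
      using cinner_bound[of z x] by (simp add: mult.commute)
  qed (auto simp: cinner_add_left)
  have y': "cinner (x - y) z = 0" if "z \<in> M" for z
    using y(2)[OF that] cinner_eq_0_commute[of "x - y" z] by (simp add: cinner_diff_right)
  have "ortho_proj M x = y"
    unfolding ortho_proj_def
  proof (intro the_equality conjI ballI)
    fix u assume u: "u \<in> M \<and> (\<forall>z\<in>M. cinner (x - u) z = 0)"
    then have "u - y \<in> M"
      using y(1) ccs_diff[OF assms] by blast
    then have "cinner (x - y) (u - y) - cinner (x - u) (u - y) = 0"
      using y' u by simp
    then have "cinner (u - y) (u - y) = 0"
      by (simp add: cinner_diff_left)
    then show "u = y" by simp
  qed (use y y' in auto)
  with y y' show "ortho_proj M x \<in> M" "z \<in> M \<Longrightarrow> cinner (x - ortho_proj M x) z = 0"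
    by auto
qed

lemma ortho_proj_unique:
  fixes M :: "'a::chilbert set"
  assumes "closed_csubspace M" "y \<in> M" "\<And>z. z \<in> M \<Longrightarrow> cinner (x - y) z = 0"
  shows "ortho_proj M x = y"
proof -
  have d: "ortho_proj M x - y \<in> M"
    using assms(1,2) ortho_proj_in[OF assms(1)] ccs_diff by blast
  have "cinner (x - y) (ortho_proj M x - y) - cinner (x - ortho_proj M x) (ortho_proj M x - y) = 0"
    using assms(3)[OF d] cinner_ortho_proj[OF assms(1) d] by simp
  then have "cinner (ortho_proj M x - y) (ortho_proj M x - y) = 0"
    by (simp add: cinner_diff_left)
  then show ?thesis by simp
qed

lemma ortho_proj_id: "closed_csubspace (M::'a::chilbert set) \<Longrightarrow> x \<in> M \<Longrightarrow> ortho_proj M x = x"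
  by (rule ortho_proj_unique) auto

lemma norm_ortho_proj_le:
  fixes M :: "'a::chilbert set"
  assumes "closed_csubspace M"
  shows "norm (ortho_proj M x) \<le> norm x"
proof -
  have "(norm x)\<^sup>2 = (norm (x - ortho_proj M x))\<^sup>2 + (norm (ortho_proj M x))\<^sup>2"
    using norm_add_cinner[of "x - ortho_proj M x" "ortho_proj M x"]
      cinner_ortho_proj[OF assms ortho_proj_in[OF assms]] by simp
  then show ?thesis
    by (metis le_add_same_cancel2 norm_ge_zero power2_le_imp_le zero_le_power2)
qed

lemma bops_ortho_proj:
  fixes M :: "'a::chilbert set"
  assumes "closed_csubspace M"
  shows "ortho_proj M \<in> bops UNIV M"
proof (rule bopsI[where M = 1])
  note w = ortho_proj_in[OF assms] cinner_ortho_proj[OF assms]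
  show "ortho_proj M (x + y) = ortho_proj M x + ortho_proj M y" for x y
  proof (rule ortho_proj_unique[OF assms])
    fix z assume z: "z \<in> M"
    have "x + y - (ortho_proj M x + ortho_proj M y) = (x - ortho_proj M x) + (y - ortho_proj M y)"
      by simp
    then show "cinner (x + y - (ortho_proj M x + ortho_proj M y)) z = 0"
      using w(2)[OF z] by (simp only: cinner_add_left) simp
  qed (simp add: ccs_add[OF assms] w)
  show "ortho_proj M (c *\<^sub>C x) = c *\<^sub>C ortho_proj M x" for c x
    by (rule ortho_proj_unique[OF assms])
      (auto simp: ccs_scaleC[OF assms] w simp flip: scaleC_diff_right)
qed (auto simp: norm_ortho_proj_le[OF assms] ortho_proj_in[OF assms])

lemma ortho_decomp:
  fixes M :: "'a::chilbert set"
  assumes "closed_csubspace M" "closed_csubspace K" "M \<subseteq> K" "x \<in> K"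
  shows "x - ortho_proj M x \<in> K \<ominus>\<^sub>H M"
  using assms(3,4) ortho_proj_works[OF assms(1)] ccs_diff[OF assms(2,4), of "ortho_proj M x"]
  by (auto simp: ominus_def)

lemma ominus_ominus:
  fixes M :: "'a::chilbert set"
  assumes "closed_csubspace M" "closed_csubspace K" "M \<subseteq> K"
  shows "K \<ominus>\<^sub>H (K \<ominus>\<^sub>H M) = M"
proof (intro equalityI subsetI)
  fix x assume x: "x \<in> K \<ominus>\<^sub>H (K \<ominus>\<^sub>H M)"
  let ?d = "x - ortho_proj M x"
  have d: "?d \<in> K \<ominus>\<^sub>H M"
    using ortho_decomp[OF assms] x by (auto simp: ominus_def)
  have "cinner x ?d = 0" "cinner (ortho_proj M x) ?d = 0"
    using x d ortho_proj_in[OF assms(1)] cinner_eq_0_commute unfolding ominus_def by blast+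
  then have "cinner ?d ?d = 0"
    by (simp add: cinner_diff_left)
  then show "x \<in> M"
    using ortho_proj_in[OF assms(1), of x] by simp
next
  fix x assume "x \<in> M"
  then show "x \<in> K \<ominus>\<^sub>H (K \<ominus>\<^sub>H M)"
    using assms(3) cinner_eq_0_commute unfolding ominus_def by blast
qed

lemma ominus_eq_zero_imp:
  fixes M :: "'a::chilbert set"
  assumes "closed_csubspace M" "closed_csubspace K" "M \<subseteq> K"
    and "\<And>x. x \<in> K \<Longrightarrow> (\<And>y. y \<in> M \<Longrightarrow> cinner x y = 0) \<Longrightarrow> x = 0"
  shows "M = K"
proof -
  have "K \<ominus>\<^sub>H M \<subseteq> {0}"
    using assms(4) by (auto simp: ominus_def)
  then have "K \<subseteq> K \<ominus>\<^sub>H (K \<ominus>\<^sub>H M)"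
    by (auto simp: ominus_def)
  then show ?thesis
    using ominus_ominus[OF assms(1-3)] assms(3) by auto
qed

section \<open>Positive operators and square roots\<close>

lemma positive_op_bops: "positive_op H A \<Longrightarrow> A \<in> bops H H"
  by (simp add: positive_op_def)

lemma positive_op_iff:
  "positive_op H A \<longleftrightarrow> A \<in> bops H H \<and> (\<forall>x\<in>H. Im (cinner (A x) x) = 0 \<and> 0 \<le> Re (cinner (A x) x))"
  by (auto simp: positive_op_def complex_nonneg_Reals_iff)

text \<open>Polarisation: the quadratic form is real at x + z, so its cross terms have imaginary
  part zero. Taking z = y and z = i y gives the imaginary and the real part of the claim.\<close>

lemma positive_op_selfadjoint:
  assumes "csubspace H" "positive_op H A" "x \<in> H" "y \<in> H"
  shows "cinner (A x) y = cinner x (A y)"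
proof -
  have A: "A \<in> bops H H" and im: "\<And>z. z \<in> H \<Longrightarrow> Im (cinner (A z) z) = 0"
    using assms(2) by (auto simp: positive_op_iff)
  have *: "Im (cinner (A x) z + cinner (A z) x) = 0" if z: "z \<in> H" for z
    using im[OF csubspace_add[OF assms(1,3) z]] im[OF z] im[OF assms(3)]
    by (simp add: bops_add[OF A assms(3) z] cinner_add_left cinner_add_right)
  have c: "cinner (A y) x = cnj (cinner x (A y))"
    by (rule cinner_commute)
  show ?thesis
  proof (rule complex_eqI)
    show "Im (cinner (A x) y) = Im (cinner x (A y))"
      using *[OF assms(4)] c by simp
    show "Re (cinner (A x) y) = Re (cinner x (A y))"
      using *[OF csubspace_scaleC[OF assms(1,4)], of \<i>] c by (simp add: bops_scaleC[OF A assms(4)])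
  qed
qed

lemma positive_opI:
  assumes "A \<in> bops H H" "\<And>x y. x \<in> H \<Longrightarrow> y \<in> H \<Longrightarrow> cinner (A x) y = cinner x (A y)"
    and "\<And>x. x \<in> H \<Longrightarrow> 0 \<le> Re (cinner (A x) x)"
  shows "positive_op H A"
  unfolding positive_op_iff
proof (intro conjI ballI)
  fix x assume x: "x \<in> H"
  have "cinner (A x) x = cnj (cinner (A x) x)"
    using assms(2)[OF x x] cinner_commute[of x "A x"] by simp
  then show "Im (cinner (A x) x) = 0"
    by (simp add: complex_eq_iff)
qed (use assms in auto)

text \<open>This is A^2 \<le> c A read at a vector. Positivity is tested at x - A x / c; the
  resulting term with A (A x) is at most c times the squared norm of A x. The inequality makes I -
  A/c a contraction and identifies the kernel of the quadratic form with that of A.\<close>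

lemma positive_op_norm_le:
  assumes H: "csubspace H" and A: "positive_op H A" and c: "c > 0"
    and bd: "\<And>x. x \<in> H \<Longrightarrow> norm (A x) \<le> c * norm x" and x: "x \<in> H"
  shows "(norm (A x))\<^sup>2 \<le> c * Re (cinner (A x) x)"
proof -
  note Ab = positive_op_bops[OF A]
  let ?y = "A x"
  have y: "?y \<in> H" by (rule bops_in[OF Ab x])
  have z: "x - (1/c) *\<^sub>R ?y \<in> H"
    by (intro csubspace_diff[OF H] csubspace_scaleR[OF H] x y)
  have 1: "Re (cinner (A ?y) ?y) \<le> c * (norm ?y)\<^sup>2"
  proof -
    have "Re (cinner (A ?y) ?y) \<le> norm (A ?y) * norm ?y"
      by (meson cinner_bound complex_Re_le_cmod order_trans)
    also have "\<dots> \<le> (c * norm ?y) * norm ?y"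
      by (intro mult_right_mono bd y) auto
    finally show ?thesis by (simp add: power2_eq_square)
  qed
  have "0 \<le> Re (cinner (A (x - (1/c) *\<^sub>R ?y)) (x - (1/c) *\<^sub>R ?y))"
    using A z by (auto simp: positive_op_iff)
  also have "A (x - (1/c) *\<^sub>R ?y) = ?y - (1/c) *\<^sub>R A ?y"
    by (simp add: bops_diff[OF H Ab x csubspace_scaleR[OF H y]] bops_scaleR[OF Ab y])
  also have "Re (cinner (?y - (1/c) *\<^sub>R A ?y) (x - (1/c) *\<^sub>R ?y))
      = Re (cinner ?y x) - 2 * (norm ?y)\<^sup>2 / c + Re (cinner (A ?y) ?y) / c\<^sup>2"
  proof -
    have "cinner (A ?y) x = of_real ((norm ?y)\<^sup>2)"
      using positive_op_selfadjoint[OF H A y x] by (simp add: cinner_self)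
    then show ?thesis
      using c by (simp add: cinner_diff_left cinner_diff_right cinner_self power2_eq_square field_simps)
  qed
  also have "Re (cinner (A ?y) ?y) / c\<^sup>2 \<le> (c * (norm ?y)\<^sup>2) / c\<^sup>2"
    using 1 by (intro divide_right_mono) auto
  finally have "0 \<le> Re (cinner ?y x) - (norm ?y)\<^sup>2 / c"
    using c by (simp add: power2_eq_square)
  then show ?thesis
    using c by (simp add: field_simps)
qed

lemma positive_op_eq_0:
  assumes "csubspace H" "positive_op H A" "x \<in> H" "Re (cinner (A x) x) = 0"
  shows "A x = 0"
proof -
  obtain c where "c > 0" "\<And>x. x \<in> H \<Longrightarrow> norm (A x) \<le> c * norm x"
    using bops_bound[OF positive_op_bops[OF assms(2)]] by blast
  then have "(norm (A x))\<^sup>2 \<le> 0"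
    using positive_op_norm_le[OF assms(1,2) _ _ assms(3)] assms(4) by fastforce
  then show ?thesis by simp
qed

lemma positive_op_adj_comp:
  fixes H :: "'a::chilbert set" and K :: "'b::chilbert set"
  assumes "closed_csubspace H" "A \<in> bops H K"
  shows "positive_op H (\<lambda>x. adj H K A (A x))"
proof (rule positive_opI)
  show "(\<lambda>x. adj H K A (A x)) \<in> bops H H"
    by (rule bops_comp[OF assms(2) bops_adj[OF assms]])
  have w: "cinner (adj H K A (A x)) y = cinner (A x) (A y)" "cinner x (adj H K A (A y)) = cinner (A x) (A y)"
    if "x \<in> H" "y \<in> H" for x y
    using cinner_adj'[OF assms that(2)] cinner_adj[OF assms that(1)] by metis+
  show "cinner (adj H K A (A x)) y = cinner x (adj H K A (A y))" if "x \<in> H" "y \<in> H" for x y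
    using w(1)[OF that] w(2)[OF that] by simp
  show "0 \<le> Re (cinner (adj H K A (A x)) x)" if "x \<in> H" for x
    using w(1)[OF that that] by (simp add: cinner_self)
qed

section \<open>Square roots by the binomial series\<close>

text \<open>The Taylor coefficients of \<open>\<surd>(1 - t)\<close>.\<close>

definition sqrt_coeff :: "nat \<Rightarrow> real" where
  "sqrt_coeff n = (1/2 gchoose n) * (-1) ^ n"

lemma sqrt_coeff_0 [simp]: "sqrt_coeff 0 = 1"
  by (simp add: sqrt_coeff_def)

text \<open>In the rising factorial of -1/2 the first factor is negative and all later ones are
  positive.\<close>

lemma sqrt_coeff_nonpos: "n > 0 \<Longrightarrow> sqrt_coeff n \<le> 0"
proof -
  assume "n > 0"
  then obtain m where n: "n = Suc m" using gr0_implies_Suc by blast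
  have "sqrt_coeff n = pochhammer (- (1/2)) n / fact n"
    by (simp add: sqrt_coeff_def gbinomial_pochhammer flip: power_mult_distrib)
  also have "pochhammer (- (1/2)) n = - (1/2) * pochhammer (1/2 :: real) m"
    by (simp add: n pochhammer_rec)
  also have "\<dots> / fact n \<le> 0"
    by (intro divide_nonpos_pos mult_nonpos_nonneg pochhammer_nonneg) auto
  finally show ?thesis .
qed

text \<open>The partial sums at t = 1 have the closed form
  \<open>pochhammer (1/2) n / fact n\<close>. Together with the sign of the coefficients this bounds
  the absolute sum of all terms after the first by 1, which is what makes the series converge for
  contractions and not only for norm less than 1.\<close>

lemma sum_sqrt_coeff_nonneg: "0 \<le> (\<Sum>k\<le>n. sqrt_coeff k)"
proof -
  have "(\<Sum>k\<le>n. sqrt_coeff k) = (-1) ^ n * ((- (1/2)) gchoose n)"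
    unfolding sqrt_coeff_def by (subst gbinomial_sum_lower_neg) simp
  also have "\<dots> = pochhammer (1/2) n / fact n"
    by (simp add: gbinomial_pochhammer flip: power_mult_distrib)
  also have "\<dots> \<ge> 0"
    by (intro divide_nonneg_pos pochhammer_nonneg) auto
  finally show ?thesis .
qed

lemma sum_abs_sqrt_coeff_Suc: "(\<Sum>k<n. \<bar>sqrt_coeff (Suc k)\<bar>) \<le> 1"
proof -
  have "(\<Sum>k\<le>n. sqrt_coeff k) = 1 + (\<Sum>k<n. sqrt_coeff (Suc k))"
    by (simp add: lessThan_Suc_atMost[symmetric] sum.lessThan_Suc_shift del: sum.lessThan_Suc)
  moreover have "(\<Sum>k<n. \<bar>sqrt_coeff (Suc k)\<bar>) = - (\<Sum>k<n. sqrt_coeff (Suc k))"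
    using sqrt_coeff_nonpos by (simp add: sum_negf[symmetric] abs_of_nonpos)
  ultimately show ?thesis
    using sum_sqrt_coeff_nonneg[of n] by linarith
qed

lemma summable_abs_sqrt_coeff: "summable (\<lambda>n. \<bar>sqrt_coeff n\<bar>)"
proof -
  have "summable (\<lambda>n. \<bar>sqrt_coeff (Suc n)\<bar>)"
    by (rule summableI_nonneg_bounded[where x = 1]) (auto intro: sum_abs_sqrt_coeff_Suc)
  then show ?thesis
    using summable_Suc_iff[of "\<lambda>n. \<bar>sqrt_coeff n\<bar>"] by simp
qed

text \<open>These are the coefficients of the square of \<surd>(1 - t), that is of 1 - t; the
  identity is Vandermonde's with 1/2 + 1/2 = 1.\<close>

lemma sqrt_coeff_convolution:
  "(\<Sum>i\<le>k. sqrt_coeff i * sqrt_coeff (k - i)) = (if k = 0 then 1 else if k = 1 then -1 else 0)"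
proof -
  have "(\<Sum>i\<le>k. sqrt_coeff i * sqrt_coeff (k - i))
      = (\<Sum>i\<le>k. (-1) ^ k * ((1/2 gchoose i) * (1/2 gchoose (k - i))))"
  proof (rule sum.cong)
    fix i assume "i \<in> {..k}"
    then have "(-1::real) ^ k = (-1) ^ i * (-1) ^ (k - i)"
      by (simp flip: power_add)
    then show "sqrt_coeff i * sqrt_coeff (k - i) = (-1) ^ k * ((1/2 gchoose i) * (1/2 gchoose (k - i)))"
      unfolding sqrt_coeff_def by (simp only: mult_ac)
  qed simp
  also have "\<dots> = (-1) ^ k * ((1/2 + 1/2 :: real) gchoose k)"
    using gbinomial_Vandermonde[of "1/2 :: real" "1/2" k]
    by (simp add: sum_distrib_left[symmetric] atLeast0AtMost)
  also have "(1/2 + 1/2 :: real) gchoose k = of_nat (1 choose k)"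
    by (simp add: binomial_gbinomial)
  also have "(-1) ^ k * of_nat (1 choose k) = (if k = 0 then 1 else if k = 1 then -1 else (0::real))"
    by (auto simp: binomial_eq_0)
  finally show ?thesis .
qed

text \<open>\<open>C'\<close> may differ from \<open>C\<close>, so that the lemma covers
  intertwiners such as the embedding \<open>j\<close> of a normal extension as well as commuting
  operators.\<close>

lemma funpow_commute_on:
  assumes "C \<in> bops H H" "D \<in> bops H K" "\<And>x. x \<in> H \<Longrightarrow> D (C x) = C' (D x)" "x \<in> H"
  shows "D ((C ^^ n) x) = (C' ^^ n) (D x)"
proof (induction n)
  case (Suc n)
  have "(C ^^ n) x \<in> H"
    by (rule bops_in[OF bops_funpow[OF assms(1)] assms(4)])
  then show ?case
    using Suc assms(3) by simp
qed simp

locale contraction_on =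
  fixes H :: "'a::chilbert set" and C :: "'a \<Rightarrow> 'a"
  assumes closed_H: "closed_csubspace H" and C_bops: "C \<in> bops H H"
    and C_norm: "x \<in> H \<Longrightarrow> norm (C x) \<le> norm x"
begin

lemma csub_H: "csubspace H"
  by (rule ccs_csubspace[OF closed_H])

lemma pow_in: "x \<in> H \<Longrightarrow> (C ^^ n) x \<in> H"
  by (rule bops_in[OF bops_funpow[OF C_bops]])

lemma pow_norm: "x \<in> H \<Longrightarrow> norm ((C ^^ n) x) \<le> norm x"
  by (induction n) (auto intro: order_trans[OF C_norm[OF pow_in]])

definition root_sum :: "nat \<Rightarrow> 'a \<Rightarrow> 'a" where
  "root_sum N x = (\<Sum>n<N. sqrt_coeff n *\<^sub>R (C ^^ n) x)"

definition root_op :: "'a \<Rightarrow> 'a" where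
  "root_op x = (\<Sum>n. sqrt_coeff n *\<^sub>R (C ^^ n) x)"

lemma root_sum_bops: "root_sum N \<in> bops H H"
proof (induction N)
  case 0
  then show ?case
    using bops_zero[OF ccs_0[OF closed_H]] by (simp add: root_sum_def[abs_def])
next
  case (Suc N)
  have "root_sum (Suc N) = (\<lambda>x. 1 *\<^sub>C root_sum N x + of_real (sqrt_coeff N) *\<^sub>C (C ^^ N) x)"
    by (auto simp: root_sum_def scaleC_of_real)
  then show ?case
    using bops_lincomb[OF csub_H Suc bops_funpow[OF C_bops], of 1] by simp
qed

lemma root_term_norm: "x \<in> H \<Longrightarrow> norm (sqrt_coeff n *\<^sub>R (C ^^ n) x) \<le> \<bar>sqrt_coeff n\<bar> * norm x"
  using pow_norm[of x n] by (simp add: mult_left_mono)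

lemma root_sum_norm: "x \<in> H \<Longrightarrow> norm (root_sum N x) \<le> 2 * norm x"
proof (cases N)
  case (Suc m)
  assume x: "x \<in> H"
  have "norm (root_sum N x) \<le> (\<Sum>n<N. \<bar>sqrt_coeff n\<bar> * norm x)"
    unfolding root_sum_def by (intro sum_norm_le root_term_norm x)
  also have "\<dots> = (1 + (\<Sum>n<m. \<bar>sqrt_coeff (Suc n)\<bar>)) * norm x"
    unfolding Suc by (subst sum.lessThan_Suc_shift) (simp add: sum_distrib_right distrib_right)
  also have "\<dots> \<le> 2 * norm x"
    using sum_abs_sqrt_coeff_Suc[of m] by (intro mult_right_mono) auto
  finally show ?thesis .
qed (simp add: root_sum_def)

lemma root_sum_tendsto: "x \<in> H \<Longrightarrow> (\<lambda>N. root_sum N x) \<longlonglongrightarrow> root_op x"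
proof -
  assume x: "x \<in> H"
  have "summable (\<lambda>n. sqrt_coeff n *\<^sub>R (C ^^ n) x)"
  proof (rule summable_comparison_test[OF _ summable_mult2[OF summable_abs_sqrt_coeff, of "norm x"]])
    show "\<exists>N. \<forall>n\<ge>N. norm (sqrt_coeff n *\<^sub>R (C ^^ n) x) \<le> \<bar>sqrt_coeff n\<bar> * norm x"
      using root_term_norm[OF x] by blast
  qed
  then show ?thesis
    unfolding root_op_def root_sum_def by (rule summable_LIMSEQ)
qed

lemma root_in: "x \<in> H \<Longrightarrow> root_op x \<in> H"
  using closed_sequentially[OF ccs_closed[OF closed_H] _ root_sum_tendsto]
    bops_in[OF root_sum_bops] by blast

lemma root_norm: "x \<in> H \<Longrightarrow> norm (root_op x) \<le> 2 * norm x"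
  by (rule LIMSEQ_le_const2[OF tendsto_norm[OF root_sum_tendsto]]) (auto intro: root_sum_norm)

lemma root_bops: "root_op \<in> bops H H"
proof (rule bopsI[where M = 2])
  show "root_op (x + y) = root_op x + root_op y" if "x \<in> H" "y \<in> H" for x y
  proof (rule LIMSEQ_unique[OF root_sum_tendsto])
    show "(\<lambda>N. root_sum N (x + y)) \<longlonglongrightarrow> root_op x + root_op y"
      using tendsto_add[OF root_sum_tendsto root_sum_tendsto] that
      by (simp add: bops_add[OF root_sum_bops])
  qed (use that csubspace_add[OF csub_H] in auto)
  show "root_op (c *\<^sub>C x) = c *\<^sub>C root_op x" if "x \<in> H" for c x
  proof (rule LIMSEQ_unique[OF root_sum_tendsto])
    show "(\<lambda>N. root_sum N (c *\<^sub>C x)) \<longlonglongrightarrow> c *\<^sub>C root_op x"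
      using bounded_linear.tendsto[OF bounded_linear_scaleC root_sum_tendsto] that
      by (simp add: bops_scaleC[OF root_sum_bops])
  qed (use that csubspace_scaleC[OF csub_H] in auto)
qed (auto intro: root_in root_norm)

text \<open>Each partial sum is a polynomial in C, and the identity survives the pointwise limit.
  Commutation of roots with S later rests on this.\<close>

lemma root_commutes:
  assumes "D \<in> bops H H" "\<And>x. x \<in> H \<Longrightarrow> D (C x) = C (D x)" "x \<in> H"
  shows "D (root_op x) = root_op (D x)"
proof (rule LIMSEQ_unique)
  show "(\<lambda>N. D (root_sum N x)) \<longlonglongrightarrow> D (root_op x)"
    by (rule bops_tendsto[OF closed_H assms(1) root_sum_tendsto])
      (use assms bops_in[OF root_sum_bops] in auto)
  have "D (root_sum N x) = root_sum N (D x)" for N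
    unfolding root_sum_def
    by (simp add: bops_sum[OF csub_H assms(1)] csubspace_scaleR[OF csub_H] pow_in assms(3)
        bops_scaleR[OF assms(1)] funpow_commute_on[OF C_bops assms(1,2,3)])
  then show "(\<lambda>N. D (root_sum N x)) \<longlonglongrightarrow> root_op (D x)"
    using root_sum_tendsto[OF bops_in[OF assms(1,3)]] by simp
qed

text \<open>The square of a partial sum differs from \<open>I - C\<close> only in the terms off the triangle
  \<open>i + j < N\<close>, whose coefficients are dominated as in Mertens' theorem.\<close>

lemma root_sum_square:
  assumes x: "x \<in> H" and N: "N \<ge> 2"
  shows "norm (root_sum N (root_sum N x) - (x - C x)) \<le>
    ((\<Sum>i<N. \<bar>sqrt_coeff i\<bar>) * (\<Sum>i<N. \<bar>sqrt_coeff i\<bar>)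
      - (\<Sum>k<N. \<Sum>i\<le>k. \<bar>sqrt_coeff i\<bar> * \<bar>sqrt_coeff (k - i)\<bar>)) * norm x"
proof -
  let ?f = "\<lambda>(i, j). (sqrt_coeff i * sqrt_coeff j) *\<^sub>R (C ^^ (i + j)) x"
  let ?g = "\<lambda>(i, j). \<bar>sqrt_coeff i\<bar> * \<bar>sqrt_coeff j\<bar>"
  let ?Q = "{..<N} \<times> {..<N}" and ?T = "{(i, j). i + j < N}"
  have T: "?T \<subseteq> ?Q" "finite ?Q" by auto
  have "root_sum N (root_sum N x) = (\<Sum>i<N. \<Sum>j<N. ?f (i, j))"
  proof -
    have "(C ^^ i) (root_sum N x) = (\<Sum>j<N. sqrt_coeff j *\<^sub>R (C ^^ (i + j)) x)" for i
      unfolding root_sum_def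
      by (simp add: bops_sum[OF csub_H bops_funpow[OF C_bops]] csubspace_scaleR[OF csub_H] pow_in x
          bops_scaleR[OF bops_funpow[OF C_bops]] funpow_add)
    then show ?thesis
      by (subst root_sum_def) (simp add: scaleR_sum_right)
  qed
  also have "\<dots> = sum ?f ?Q"
    by (simp add: sum.cartesian_product)
  finally have 1: "root_sum N (root_sum N x) = sum ?f ?Q" .
  have "sum ?f ?T = (\<Sum>k<N. \<Sum>i\<le>k. ?f (i, k - i))"
    using sum.triangle_reindex[of "\<lambda>i j. ?f (i, j)" N] by simp
  also have "\<dots> = (\<Sum>k<N. (\<Sum>i\<le>k. sqrt_coeff i * sqrt_coeff (k - i)) *\<^sub>R (C ^^ k) x)"
    by (intro sum.cong refl) (simp add: scaleR_sum_left)
  also have "\<dots> = (\<Sum>k<N. (if k = 0 then x else 0) + (if k = 1 then - C x else 0))"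
    by (intro sum.cong refl) (simp add: sqrt_coeff_convolution)
  \<comment> \<open>\<open>N \<ge> 2\<close> puts both indices with nonzero coefficient, k = 0 and k
    = 1, into the range of summation.\<close>
  also have "\<dots> = x - C x"
    using N by (simp add: sum.distrib)
  finally have 2: "sum ?f ?T = x - C x" .
  have "root_sum N (root_sum N x) - (x - C x) = sum ?f (?Q - ?T)"
    unfolding 1 2[symmetric] using T by (simp add: sum_diff)
  also have "norm \<dots> \<le> (\<Sum>p\<in>?Q - ?T. ?g p * norm x)"
  proof (rule sum_norm_le)
    fix p assume "p \<in> ?Q - ?T"
    show "norm (?f p) \<le> ?g p * norm x"
      using pow_norm[OF x, of "fst p + snd p"] by (cases p) (simp add: abs_mult mult_left_mono)
  qed
  also have "\<dots> = (sum ?g ?Q - sum ?g ?T) * norm x"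
    using T by (simp add: sum_diff sum_distrib_right[symmetric])
  also have "sum ?g ?Q = (\<Sum>i<N. \<bar>sqrt_coeff i\<bar>) * (\<Sum>i<N. \<bar>sqrt_coeff i\<bar>)"
    by (simp add: sum_product sum.cartesian_product)
  also have "sum ?g ?T = (\<Sum>k<N. \<Sum>i\<le>k. \<bar>sqrt_coeff i\<bar> * \<bar>sqrt_coeff (k - i)\<bar>)"
    using sum.triangle_reindex[of "\<lambda>i j. ?g (i, j)" N] by simp
  finally show ?thesis .
qed

lemma root_square:
  assumes x: "x \<in> H"
  shows "root_op (root_op x) = x - C x"
proof -
  let ?a = "\<lambda>i. \<bar>sqrt_coeff i\<bar>"
  have s: "summable (\<lambda>i. norm (?a i))"
    using summable_abs_sqrt_coeff by simp
  have l1: "(\<lambda>N. \<Sum>i<N. ?a i) \<longlonglongrightarrow> (\<Sum>i. ?a i)"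
    by (rule summable_LIMSEQ[OF summable_abs_sqrt_coeff])
  have l2: "(\<lambda>N. \<Sum>k<N. \<Sum>i\<le>k. ?a i * ?a (k - i)) \<longlonglongrightarrow> (\<Sum>i. ?a i) * (\<Sum>i. ?a i)"
    using Cauchy_product_sums[OF s s] unfolding sums_def .
  \<comment> \<open>The bound of \<open>root_sum_square\<close> tends to 0, because the full
    products and the triangular sums have the same limit.\<close>
  have l3: "(\<lambda>N. ((\<Sum>i<N. ?a i) * (\<Sum>i<N. ?a i) - (\<Sum>k<N. \<Sum>i\<le>k. ?a i * ?a (k - i))) * norm x)
      \<longlonglongrightarrow> ((\<Sum>i. ?a i) * (\<Sum>i. ?a i) - (\<Sum>i. ?a i) * (\<Sum>i. ?a i)) * norm x"
    by (intro tendsto_intros l1 l2)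
  have A: "(\<lambda>N. root_sum N (root_sum N x) - (x - C x)) \<longlonglongrightarrow> 0"
  proof (rule Lim_null_comparison)
    show "\<forall>\<^sub>F N in sequentially. norm (root_sum N (root_sum N x) - (x - C x)) \<le>
        ((\<Sum>i<N. ?a i) * (\<Sum>i<N. ?a i) - (\<Sum>k<N. \<Sum>i\<le>k. ?a i * ?a (k - i))) * norm x"
      using eventually_ge_at_top[of 2] by eventually_elim (rule root_sum_square[OF x])
  qed (use l3 in simp)
  \<comment> \<open>The partial sums are uniformly bounded by 2, so the inner partial sum may be
    replaced by its limit.\<close>
  have B: "(\<lambda>N. root_sum N (root_sum N x - root_op x)) \<longlonglongrightarrow> 0"
  proof (rule Lim_null_comparison)
    show "\<forall>\<^sub>F N in sequentially. norm (root_sum N (root_sum N x - root_op x)) \<le> 2 * norm (root_sum N x - root_op x)"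
      by (intro always_eventually allI root_sum_norm csubspace_diff[OF csub_H] root_in
          bops_in[OF root_sum_bops] x)
    show "(\<lambda>N. 2 * norm (root_sum N x - root_op x)) \<longlonglongrightarrow> 0"
      using root_sum_tendsto[OF x] by (intro tendsto_mult_right_zero tendsto_norm_zero LIM_zero)
  qed
  have "(\<lambda>N. root_sum N (root_sum N x - root_op x) + root_sum N (root_op x)) \<longlonglongrightarrow> 0 + root_op (root_op x)"
    by (intro tendsto_add B root_sum_tendsto root_in x)
  then have "(\<lambda>N. root_sum N (root_sum N x)) \<longlonglongrightarrow> root_op (root_op x)"
    by (simp add: bops_diff[OF csub_H root_sum_bops] bops_in[OF root_sum_bops] root_in x)
  moreover have "(\<lambda>N. root_sum N (root_sum N x)) \<longlonglongrightarrow> x - C x"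
    using A by (simp add: LIM_zero_iff)
  ultimately show ?thesis
    by (rule LIMSEQ_unique)
qed

lemma root_positive:
  assumes sa: "\<And>x y. x \<in> H \<Longrightarrow> y \<in> H \<Longrightarrow> cinner (C x) y = cinner x (C y)"
  shows "positive_op H root_op"
proof (rule positive_opI[OF root_bops])
  have pow_sa: "cinner ((C ^^ n) x) y = cinner x ((C ^^ n) y)" if "x \<in> H" "y \<in> H" for n x y
    using that(2)
  proof (induction n arbitrary: y)
    case (Suc n)
    have "cinner (C ((C ^^ n) x)) y = cinner ((C ^^ n) x) (C y)"
      by (intro sa pow_in that Suc.prems)
    also have "\<dots> = cinner x ((C ^^ n) (C y))"
      by (intro Suc.IH bops_in[OF C_bops] Suc.prems)
    finally show ?case
      by (simp add: funpow_swap1)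
  qed simp
  have sum_sa: "cinner (root_sum N x) y = cinner x (root_sum N y)" if "x \<in> H" "y \<in> H" for N x y
    unfolding root_sum_def by (simp add: cinner_sum_left cinner_sum_right pow_sa[OF that])
  show "cinner (root_op x) y = cinner x (root_op y)" if "x \<in> H" "y \<in> H" for x y
  proof (rule LIMSEQ_unique)
    show "(\<lambda>N. cinner (root_sum N x) y) \<longlonglongrightarrow> cinner (root_op x) y"
      by (intro tendsto_cinner root_sum_tendsto that tendsto_const)
    show "(\<lambda>N. cinner (root_sum N x) y) \<longlonglongrightarrow> cinner x (root_op y)"
      unfolding sum_sa[OF that] by (intro tendsto_cinner root_sum_tendsto that tendsto_const)
  qed
  show "0 \<le> Re (cinner (root_op x) x)" if x: "x \<in> H" for x
  proof (rule LIMSEQ_le_const)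
    show "(\<lambda>N. Re (cinner (root_sum (Suc N) x) x)) \<longlonglongrightarrow> Re (cinner (root_op x) x)"
      by (intro tendsto_Re tendsto_cinner LIMSEQ_Suc[OF root_sum_tendsto[OF x]] tendsto_const)
    \<comment> \<open>The leading coefficient is 1 and the others have absolute sum at most 1. The
      contraction C does not increase norms, so the leading term dominates the rest.\<close>
    have "0 \<le> Re (cinner (root_sum (Suc N) x) x)" for N
    proof -
      let ?r = "\<Sum>n<N. sqrt_coeff (Suc n) *\<^sub>R (C ^^ Suc n) x"
      have e: "root_sum (Suc N) x = x + ?r"
        unfolding root_sum_def by (subst sum.lessThan_Suc_shift) simp
      have "norm ?r \<le> (\<Sum>n<N. \<bar>sqrt_coeff (Suc n)\<bar> * norm x)"
        by (intro sum_norm_le root_term_norm x)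
      also have "\<dots> \<le> 1 * norm x"
        unfolding sum_distrib_right[symmetric] by (intro mult_right_mono sum_abs_sqrt_coeff_Suc) simp
      finally have "norm ?r * norm x \<le> (norm x)\<^sup>2"
        by (simp add: power2_eq_square mult_right_mono)
      moreover have "\<bar>Re (cinner ?r x)\<bar> \<le> norm ?r * norm x"
        by (meson abs_Re_le_cmod cinner_bound order_trans)
      ultimately show ?thesis
        unfolding e by (simp add: cinner_add_left cinner_self)
    qed
    then show "\<exists>N. \<forall>n\<ge>N. 0 \<le> Re (cinner (root_sum (Suc n) x) x)"
      by blast
  qed
qed

end

text \<open>If c bounds A, then C = I - A/c is a contraction by \<open>positive_op_norm_le\<close>,
  and \<surd>c times the series for \<surd>(I - C) is a root of A. The commutation clause is kept in
  the conclusion because uniqueness of roots and the positivity argument for normal extensions both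
  depend on it.\<close>

lemma positive_root_exists:
  fixes H :: "'a::chilbert set"
  assumes H: "closed_csubspace H" and A: "positive_op H A"
  obtains P where "positive_op H P" "\<And>x. x \<in> H \<Longrightarrow> P (P x) = A x"
    "\<forall>D\<in>bops H H. (\<forall>x\<in>H. D (A x) = A (D x)) \<longrightarrow> (\<forall>x\<in>H. D (P x) = P (D x))"
proof -
  note Ab = positive_op_bops[OF A] and cs = ccs_csubspace[OF H]
  obtain c where c: "c > 0" "\<And>x. x \<in> H \<Longrightarrow> norm (A x) \<le> c * norm x"
    using bops_bound[OF Ab] by blast
  define C where "C x = x - (1/c) *\<^sub>R A x" for x
  have Cb: "C \<in> bops H H"
    using bops_lincomb[OF cs bops_id Ab, of 1 "- of_real (1/c)"]
    by (simp add: C_def[abs_def] scaleC_of_real flip: of_real_minus del: of_real_divide)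
  interpret contraction_on H C
  proof
    fix x assume x: "x \<in> H"
    have 1: "cinner (A x) x = of_real (Re (cinner (A x) x))"
      using A x by (simp add: positive_op_iff complex_eq_iff)
    have "(norm (C x))\<^sup>2 = (norm x)\<^sup>2 + (norm (A x))\<^sup>2 / c\<^sup>2 - 2 * Re (cinner (A x) x) / c"
      unfolding C_def norm_diff_cinner using cinner_commute[of x "A x"]
      by (simp add: power_divide)
    also have "\<dots> \<le> (norm x)\<^sup>2 + c * Re (cinner (A x) x) / c\<^sup>2 - 2 * Re (cinner (A x) x) / c"
      using positive_op_norm_le[OF cs A c x] by (intro diff_right_mono add_left_mono divide_right_mono) auto
    also have "\<dots> = (norm x)\<^sup>2 - Re (cinner (A x) x) / c"
      using c(1) by (simp add: power2_eq_square)
    also have "\<dots> \<le> (norm x)\<^sup>2"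
      using A x c(1) by (auto simp: positive_op_iff)
    finally show "norm (C x) \<le> norm x"
      using power2_le_imp_le norm_ge_zero by blast
  qed (use H Cb in auto)
  have Csa: "cinner (C x) y = cinner x (C y)" if "x \<in> H" "y \<in> H" for x y
    unfolding C_def using positive_op_selfadjoint[OF cs A that]
    by (simp add: cinner_diff_left cinner_diff_right)
  define P where "P x = sqrt c *\<^sub>R root_op x" for x
  have R: "positive_op H root_op" by (rule root_positive[OF Csa])
  have Pb: "P \<in> bops H H"
    using bops_lincomb[OF cs root_bops root_bops, of "of_real (sqrt c)" 0]
    by (simp add: P_def[abs_def] scaleC_of_real)
  show ?thesis
  proof
    show "positive_op H P"
      using Pb R c(1) by (auto simp: positive_op_iff P_def)
    show "P (P x) = A x" if x: "x \<in> H" for x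
      using c(1) by (simp add: P_def bops_scaleR[OF root_bops root_in[OF x]] root_square[OF x] C_def)
    show "\<forall>D\<in>bops H H. (\<forall>x\<in>H. D (A x) = A (D x)) \<longrightarrow> (\<forall>x\<in>H. D (P x) = P (D x))"
    proof (intro ballI impI)
      fix D x assume D: "D \<in> bops H H" "\<forall>x\<in>H. D (A x) = A (D x)" and x: "x \<in> H"
      have "D (C y) = C (D y)" if y: "y \<in> H" for y
        using y D bops_in[OF Ab y] csubspace_scaleR[OF cs bops_in[OF Ab y]]
        by (simp add: C_def bops_diff[OF cs D(1)] bops_scaleR[OF D(1)])
      then show "D (P x) = P (D x)"
        using root_commutes[OF D(1) _ x] root_in[OF x] by (simp add: P_def bops_scaleR[OF D(1)])
    qed
  qed
qed

lemma positive_op_square: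
  assumes "csubspace H" "positive_op H P"
  shows "positive_op H (\<lambda>x. P (P x))"
proof (rule positive_opI)
  note Pb = positive_op_bops[OF assms(2)] and sa = positive_op_selfadjoint[OF assms]
  show "(\<lambda>x. P (P x)) \<in> bops H H"
    by (rule bops_comp[OF Pb Pb])
  show "cinner (P (P x)) y = cinner x (P (P y))" if "x \<in> H" "y \<in> H" for x y
    using that by (simp add: sa bops_in[OF Pb])
  show "0 \<le> Re (cinner (P (P x)) x)" if "x \<in> H" for x
    using that by (simp add: sa bops_in[OF Pb] cinner_self)
qed

text \<open>For y = P x - R x, commutation and equality of the squares give P y + R y = 0.
  Positivity of both terms makes P y and R y vanish separately, and self-adjointness writes the
  squared norm of y as the inner product of x with P y - R y.\<close>

lemma positive_root_unique_commuting:
  assumes cs: "csubspace H" and P: "positive_op H P" and R: "positive_op H R"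
    and sq: "\<And>x. x \<in> H \<Longrightarrow> P (P x) = R (R x)" and comm: "\<And>x. x \<in> H \<Longrightarrow> P (R x) = R (P x)"
    and x: "x \<in> H"
  shows "P x = R x"
proof -
  note Pb = positive_op_bops[OF P] and Rb = positive_op_bops[OF R]
  note in_H = bops_in[OF Pb] bops_in[OF Rb]
  define y where "y = P x - R x"
  have y: "y \<in> H"
    unfolding y_def by (intro csubspace_diff[OF cs] in_H x)
  have 0: "P y + R y = 0"
    unfolding y_def by (simp add: bops_diff[OF cs Pb] bops_diff[OF cs Rb] in_H x sq comm)
  have "Re (cinner (P y) y) + Re (cinner (R y) y) = 0"
    using arg_cong[OF 0, of "\<lambda>z. Re (cinner z y)"] by (simp add: cinner_add_left)
  moreover have "Re (cinner (P y) y) \<ge> 0" "Re (cinner (R y) y) \<ge> 0"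
    using P R y by (auto simp: positive_op_iff)
  ultimately have "P y = 0" "R y = 0"
    using positive_op_eq_0[OF cs P y] positive_op_eq_0[OF cs R y] by auto
  then have "cinner y y = 0"
    using positive_op_selfadjoint[OF cs P x y] positive_op_selfadjoint[OF cs R x y]
    by (subst (1) y_def) (simp add: cinner_diff_left)
  then show ?thesis by (simp add: y_def)
qed

text \<open>P and Q need not be known to commute. Both are compared with the constructed root R of
  their common square: each commutes with that square, hence with R.\<close>

lemma positive_root_unique:
  fixes H :: "'a::chilbert set"
  assumes H: "closed_csubspace H" and P: "positive_op H P" and Q: "positive_op H Q"
    and sq: "\<And>x. x \<in> H \<Longrightarrow> P (P x) = Q (Q x)" and x: "x \<in> H"
  shows "P x = Q x"
proof -
  note cs = ccs_csubspace[OF H]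
  note Pb = positive_op_bops[OF P] and Qb = positive_op_bops[OF Q]
  obtain R where R: "positive_op H R" "\<And>x. x \<in> H \<Longrightarrow> R (R x) = P (P x)"
    "\<forall>D\<in>bops H H. (\<forall>x\<in>H. D (P (P x)) = P (P (D x))) \<longrightarrow> (\<forall>x\<in>H. D (R x) = R (D x))"
    by (rule positive_root_exists[OF H positive_op_square[OF cs P]]) blast
  have "P x = R x"
    by (rule positive_root_unique_commuting[OF cs P R(1) _ _ x]) (use R(2) R(3) Pb in auto)
  moreover have "Q x = R x"
    by (rule positive_root_unique_commuting[OF cs Q R(1) _ _ x])
      (use R(2) R(3) sq Qb bops_in[OF Qb] in auto)
  ultimately show ?thesis by simp
qed

lemma sqrt_op_works:
  fixes H :: "'a::chilbert set"
  assumes "closed_csubspace H" "positive_op H A"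
  shows positive_sqrt_op: "positive_op H (sqrt_op H A)"
    and sqrt_op_square: "x \<in> H \<Longrightarrow> sqrt_op H A (sqrt_op H A x) = A x"
proof -
  have "\<exists>P. positive_op H P \<and> (\<forall>x\<in>H. P (P x) = A x)"
    by (rule positive_root_exists[OF assms]) blast
  then have "positive_op H (sqrt_op H A) \<and> (\<forall>x\<in>H. sqrt_op H A (sqrt_op H A x) = A x)"
    unfolding sqrt_op_def by (rule someI_ex)
  then show "positive_op H (sqrt_op H A)" "x \<in> H \<Longrightarrow> sqrt_op H A (sqrt_op H A x) = A x"
    by auto
qed

text \<open>\<open>sqrt_op\<close> is an arbitrary choice; uniqueness identifies it on
  \<open>H\<close> with the constructed root, which has the commutation property.\<close>

lemma sqrt_op_commute:
  fixes H :: "'a::chilbert set"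
  assumes H: "closed_csubspace H" and A: "positive_op H A"
    and D: "D \<in> bops H H" "\<And>x. x \<in> H \<Longrightarrow> D (A x) = A (D x)" and x: "x \<in> H"
  shows "D (sqrt_op H A x) = sqrt_op H A (D x)"
proof -
  obtain R where R: "positive_op H R" "\<And>x. x \<in> H \<Longrightarrow> R (R x) = A x"
    "\<forall>D\<in>bops H H. (\<forall>x\<in>H. D (A x) = A (D x)) \<longrightarrow> (\<forall>x\<in>H. D (R x) = R (D x))"
    by (rule positive_root_exists[OF H A]) blast
  have "sqrt_op H A x = R x" if "x \<in> H" for x
    by (rule positive_root_unique[OF H positive_sqrt_op[OF H A] R(1) _ that])
      (simp add: R sqrt_op_square[OF H A])
  then show ?thesis
    using R(3) D x bops_in[OF D(1) x] by simp
qed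

lemma cinner_eq_of_norm_eq:
  assumes H: "csubspace H" and A: "A \<in> bops H K" and B: "B \<in> bops H L"
    and eq: "\<And>x. x \<in> H \<Longrightarrow> norm (A x) = norm (B x)" and xy: "x \<in> H" "y \<in> H"
  shows "cinner (A x) (A y) = cinner (B x) (B y)"
proof -
  have re: "Re (cinner (A x) (A z)) = Re (cinner (B x) (B z))" if z: "z \<in> H" for z
    using eq[OF csubspace_add[OF H xy(1) z]] eq[OF z] eq[OF xy(1)]
      norm_add_cinner[of "A x" "A z"] norm_add_cinner[of "B x" "B z"]
    by (simp add: bops_add[OF A xy(1) z] bops_add[OF B xy(1) z])
  show ?thesis
  proof (rule complex_eqI)
    show "Im (cinner (A x) (A y)) = Im (cinner (B x) (B y))"
      using re[OF csubspace_scaleC[OF H xy(2)], of \<i>]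
      by (simp add: bops_scaleC[OF A xy(2)] bops_scaleC[OF B xy(2)])
  qed (rule re[OF xy(2)])
qed

lemma isometric_cinner:
  assumes "csubspace H" "isometric H K A" "x \<in> H" "y \<in> H"
  shows "cinner (A x) (A y) = cinner x y"
  using cinner_eq_of_norm_eq[OF assms(1) _ bops_id _ assms(3,4)] assms(2)
  unfolding isometric_def by blast

lemma isometric_bops: "isometric H K A \<Longrightarrow> A \<in> bops H K"
  by (simp add: isometric_def)

lemma isometric_norm: "isometric H K A \<Longrightarrow> x \<in> H \<Longrightarrow> norm (A x) = norm x"
  by (simp add: isometric_def)

lemma bops_inj_on_iff:
  assumes "csubspace H" "A \<in> bops H K"
  shows "inj_on A H \<longleftrightarrow> (\<forall>x\<in>H. A x = 0 \<longrightarrow> x = 0)"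
proof
  assume "inj_on A H"
  then show "\<forall>x\<in>H. A x = 0 \<longrightarrow> x = 0"
    using bops_0[OF assms] csubspace_0[OF assms(1)] by (metis inj_onD)
next
  assume *: "\<forall>x\<in>H. A x = 0 \<longrightarrow> x = 0"
  show "inj_on A H"
  proof (rule inj_onI)
    fix x y assume "x \<in> H" "y \<in> H" "A x = A y"
    then have "A (x - y) = 0" "x - y \<in> H"
      using bops_diff[OF assms] csubspace_diff[OF assms(1)] by auto
    then have "x - y = 0"
      using * by blast
    then show "x = y" by simp
  qed
qed

lemma isometric_inj_on: "csubspace H \<Longrightarrow> isometric H K A \<Longrightarrow> inj_on A H"
  using bops_inj_on_iff[of H A K] by (metis isometric_def norm_eq_zero)

text \<open>The lower bound turns a Cauchy sequence of images into a Cauchy sequence of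
  preimages.\<close>

lemma closed_csubspace_bounded_below_image:
  fixes H :: "'a::chilbert set"
  assumes H: "closed_csubspace H" and A: "A \<in> bops H K" and c: "c > 0"
    and lb: "\<And>x. x \<in> H \<Longrightarrow> c * norm x \<le> norm (A x)"
  shows "closed_csubspace (A ` H)"
  unfolding closed_csubspace_def
proof
  note cs = ccs_csubspace[OF H]
  show "csubspace (A ` H)" by (rule csubspace_bops_image[OF cs A])
  show "closed (A ` H)"
    unfolding closed_sequential_limits
  proof (intro allI impI)
    fix f l assume f: "(\<forall>n. f n \<in> A ` H) \<and> f \<longlonglongrightarrow> l"
    then obtain u where u: "\<And>n. u n \<in> H" "\<And>n. f n = A (u n)"
    proof -
      have "\<forall>n. \<exists>v. v \<in> H \<and> f n = A v"
        using f by blast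
      then show ?thesis
        using that by metis
    qed
    have "Cauchy u"
    proof (rule metric_CauchyI)
      fix e :: real assume e: "e > 0"
      have "Cauchy f" using f LIMSEQ_imp_Cauchy by blast
      then obtain M where M: "\<And>m n. m \<ge> M \<Longrightarrow> n \<ge> M \<Longrightarrow> dist (f m) (f n) < c * e"
        using e c by (metis metric_CauchyD mult_pos_pos)
      have "dist (u m) (u n) < e" if "m \<ge> M" "n \<ge> M" for m n
      proof -
        have "c * norm (u m - u n) \<le> norm (A (u m - u n))"
          by (intro lb csubspace_diff[OF cs] u)
        also have "\<dots> = dist (f m) (f n)"
          by (simp add: bops_diff[OF cs A u(1) u(1)] u(2) dist_norm)
        also have "\<dots> < c * e" by (rule M[OF that])
        finally show ?thesis using c by (simp add: dist_norm)
      qed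
      then show "\<exists>M. \<forall>m\<ge>M. \<forall>n\<ge>M. dist (u m) (u n) < e" by blast
    qed
    then obtain x where x: "u \<longlonglongrightarrow> x"
      using Cauchy_convergent convergent_def by blast
    then have "x \<in> H"
      using closed_sequentially[OF ccs_closed[OF H]] u(1) by blast
    moreover have "f \<longlonglongrightarrow> A x"
      using bops_tendsto[OF H A x u(1)] u(2) by presburger
    ultimately show "l \<in> A ` H"
      using f LIMSEQ_unique by blast
  qed
qed

lemma closed_csubspace_isometric_image:
  "closed_csubspace (H::'a::chilbert set) \<Longrightarrow> isometric H K A \<Longrightarrow> closed_csubspace (A ` H)"
  by (rule closed_csubspace_bounded_below_image[where c = 1]) (auto simp: isometric_def)

section \<open>The modulus of an operator\<close>

locale hilbert_op =
  fixes H :: "'a::chilbert set" and K :: "'b::chilbert set" and E :: "'a \<Rightarrow> 'b"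
  assumes closed_dom: "closed_csubspace H" and E_bops: "E \<in> bops H K"
begin

lemma csub_dom: "csubspace H"
  by (rule ccs_csubspace[OF closed_dom])

lemma abs_op_positive: "positive_op H (abs_op H K E)"
  unfolding abs_op_def by (rule positive_sqrt_op[OF closed_dom positive_op_adj_comp[OF closed_dom E_bops]])

lemmas abs_op_bops = positive_op_bops[OF abs_op_positive]
lemmas abs_op_selfadjoint = positive_op_selfadjoint[OF csub_dom abs_op_positive]

lemma abs_op_square: "x \<in> H \<Longrightarrow> abs_op H K E (abs_op H K E x) = adj H K E (E x)"
  unfolding abs_op_def by (rule sqrt_op_square[OF closed_dom positive_op_adj_comp[OF closed_dom E_bops]])

lemma cinner_abs_op:
  "x \<in> H \<Longrightarrow> y \<in> H \<Longrightarrow> cinner (abs_op H K E x) (abs_op H K E y) = cinner (E x) (E y)"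
  by (simp add: abs_op_selfadjoint bops_in[OF abs_op_bops] abs_op_square
      cinner_adj[OF closed_dom E_bops])

lemma norm_abs_op: "x \<in> H \<Longrightarrow> norm (abs_op H K E x) = norm (E x)"
  by (intro norm_eq_of_cinner_eq cinner_abs_op)

lemma abs_op_commute:
  assumes "D \<in> bops H H" "\<And>x. x \<in> H \<Longrightarrow> D (adj H K E (E x)) = adj H K E (E (D x))" "x \<in> H"
  shows "D (abs_op H K E x) = abs_op H K E (D x)"
  unfolding abs_op_def
  by (rule sqrt_op_commute[OF closed_dom positive_op_adj_comp[OF closed_dom E_bops] assms])

text \<open>By polarisation, equality of the norms says that B^2 = E* E, so that B is the positive
  root. A modulus can thus be recognised by computing norms, without computing an adjoint.\<close>

lemma abs_op_unique:
  assumes B: "positive_op H B" and n: "\<And>x. x \<in> H \<Longrightarrow> norm (B x) = norm (E x)" and x: "x \<in> H"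
  shows "abs_op H K E x = B x"
proof (rule positive_root_unique[OF closed_dom abs_op_positive B _ x])
  note Bb = positive_op_bops[OF B]
  fix y assume y: "y \<in> H"
  show "abs_op H K E (abs_op H K E y) = B (B y)"
  proof (rule cinner_ext[OF _ _ csub_dom])
    fix h assume h: "h \<in> H"
    have "cinner h (B (B y)) = cinner (E h) (E y)"
      using cinner_eq_of_norm_eq[OF csub_dom Bb E_bops n h y]
        positive_op_selfadjoint[OF csub_dom B h bops_in[OF Bb y]] by simp
    then show "cinner h (abs_op H K E (abs_op H K E y)) = cinner h (B (B y))"
      using abs_op_selfadjoint[OF h bops_in[OF abs_op_bops y]] cinner_abs_op[OF h y] by simp
  qed (use y bops_in[OF abs_op_bops] bops_in[OF Bb] in auto)
qed

text \<open>Left-invertibility becomes a lower bound, which depends on E only through norms and so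
  can be read off |E|. For the converse, the bound makes the range closed, and the left inverse is
  the projection onto the range followed by the inverse of E there.\<close>

lemma left_invertible_iff:
  assumes K: "closed_csubspace K"
  shows "left_invertible H K E \<longleftrightarrow> (\<exists>c>0. \<forall>x\<in>H. c * norm x \<le> norm (E x))"
proof
  assume "left_invertible H K E"
  then obtain L where L: "L \<in> bops K H" "\<And>x. x \<in> H \<Longrightarrow> L (E x) = x"
    by (auto simp: left_invertible_def)
  obtain M where M: "M > 0" "\<And>x. x \<in> K \<Longrightarrow> norm (L x) \<le> M * norm x"
    using bops_bound[OF L(1)] by blast
  have "(1/M) * norm x \<le> norm (E x)" if "x \<in> H" for x
    using M(2)[OF bops_in[OF E_bops that]] L(2)[OF that] M(1) by (simp add: field_simps)
  then show "\<exists>c>0. \<forall>x\<in>H. c * norm x \<le> norm (E x)"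
    using M(1) by (intro exI[of _ "1/M"]) auto
next
  assume "\<exists>c>0. \<forall>x\<in>H. c * norm x \<le> norm (E x)"
  then obtain c where c: "c > 0" "\<And>x. x \<in> H \<Longrightarrow> c * norm x \<le> norm (E x)"
    by blast
  let ?M = "E ` H" and ?L = "\<lambda>y. inv_into H E (ortho_proj (E ` H) y)"
  have M: "closed_csubspace ?M"
    by (rule closed_csubspace_bounded_below_image[OF closed_dom E_bops c])
  have inj: "inj_on E H"
    unfolding bops_inj_on_iff[OF csub_dom E_bops]
    using c by (metis mult_le_0_iff norm_eq_zero norm_ge_zero norm_le_zero_iff not_less)
  have Lin: "?L y \<in> H" and EL: "E (?L y) = ortho_proj ?M y" for y
    using ortho_proj_in[OF M, of y] by (auto intro: inv_into_into f_inv_into_f)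
  have Leq: "?L y = x" if "x \<in> H" "E x = ortho_proj ?M y" for x y
    using that inj by (simp flip: that(2))
  note P = bops_ortho_proj[OF M]
  have "?L \<in> bops K H"
  proof (rule bopsI[where M = "1/c"])
    show "?L (x + y) = ?L x + ?L y" for x y
      by (rule Leq) (auto simp: Lin csubspace_add[OF csub_dom] bops_add[OF E_bops] EL bops_add[OF P])
    show "?L (a *\<^sub>C x) = a *\<^sub>C ?L x" for a x
      by (rule Leq) (auto simp: Lin csubspace_scaleC[OF csub_dom] bops_scaleC[OF E_bops] EL bops_scaleC[OF P])
    show "norm (?L x) \<le> 1/c * norm x" for x
      using c(2)[OF Lin, of x] norm_ortho_proj_le[OF M, of x] c(1) unfolding EL
      by (simp add: field_simps)
  qed (rule Lin)
  moreover have "?L (E x) = x" if "x \<in> H" for x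
    using that by (intro Leq) (auto simp: ortho_proj_id[OF M])
  ultimately show "left_invertible H K E"
    unfolding left_invertible_def by (intro bexI[where x = ?L] ballI)
qed

end

section \<open>Brownian-type operators\<close>

lemma entries_op_matrix:
  assumes "V 0 = 0" "E 0 = 0" "X 0 = 0"
  shows "entry11 (op_matrix V E (\<lambda>_. 0) X) = V" "entry12 (op_matrix V E (\<lambda>_. 0) X) = E"
    "entry21 (op_matrix V E (\<lambda>_. 0) X) = (\<lambda>_. 0)" "entry22 (op_matrix V E (\<lambda>_. 0) X) = X"
  using assms by (auto simp: entry11_def entry12_def entry21_def entry22_def op_matrix_def)

lemma op_matrix_bops:
  assumes "csubspace H1" "csubspace H2" "V \<in> bops H1 H1" "E \<in> bops H2 H1" "X \<in> bops H2 H2"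
  shows "op_matrix V E (\<lambda>_. 0) X \<in> bops (H1 \<times> H2) (H1 \<times> H2)"
proof -
  obtain a b c where bd: "a > 0" "\<And>x. x \<in> H1 \<Longrightarrow> norm (V x) \<le> a * norm x"
    "b > 0" "\<And>x. x \<in> H2 \<Longrightarrow> norm (E x) \<le> b * norm x"
    "c > 0" "\<And>x. x \<in> H2 \<Longrightarrow> norm (X x) \<le> c * norm x"
    using bops_bound[OF assms(3)] bops_bound[OF assms(4)] bops_bound[OF assms(5)] by metis
  show ?thesis
  proof (rule bopsI[where M = "a + b + c"])
    fix z assume z: "z \<in> H1 \<times> H2"
    obtain x y where xy: "z = (x, y)" "x \<in> H1" "y \<in> H2" using z by blast
    have n: "norm x \<le> norm z" "norm y \<le> norm z"
      using xy(1) norm_fst_le[of x y] norm_snd_le[of y x] by auto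
    have "norm (op_matrix V E (\<lambda>_. 0) X z) = norm (V x + E y, X y)"
      by (simp add: xy(1) op_matrix_def)
    also have "\<dots> \<le> norm (V x + E y) + norm (X y)"
      by (rule norm_Pair_le)
    also have "\<dots> \<le> norm (V x) + norm (E y) + norm (X y)"
      using norm_triangle_ineq[of "V x" "E y"] by simp
    also have "\<dots> \<le> a * norm x + b * norm y + c * norm y"
      using bd xy by (intro add_mono) auto
    also have "\<dots> \<le> a * norm z + b * norm z + c * norm z"
      using bd n by (intro add_mono mult_left_mono) auto
    finally show "norm (op_matrix V E (\<lambda>_. 0) X z) \<le> (a + b + c) * norm z"
      by (simp add: algebra_simps)
  next
    fix z assume "z \<in> H1 \<times> H2"
    then show "op_matrix V E (\<lambda>_. 0) X z \<in> H1 \<times> H2"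
      by (auto simp: op_matrix_def csubspace_add[OF assms(1)] bops_in[OF assms(3)] bops_in[OF assms(4)]
          bops_in[OF assms(5)])
  next
    fix z w assume "z \<in> H1 \<times> H2" "w \<in> H1 \<times> H2"
    then show "op_matrix V E (\<lambda>_. 0) X (z + w) = op_matrix V E (\<lambda>_. 0) X z + op_matrix V E (\<lambda>_. 0) X w"
      by (auto simp: op_matrix_def bops_add[OF assms(3)] bops_add[OF assms(4)] bops_add[OF assms(5)])
  next
    fix c z assume "z \<in> H1 \<times> H2"
    then show "op_matrix V E (\<lambda>_. 0) X (c *\<^sub>C z) = c *\<^sub>C op_matrix V E (\<lambda>_. 0) X z"
      by (auto simp: op_matrix_def scaleC_prod_def bops_scaleC[OF assms(3)] bops_scaleC[OF assms(4)]
          bops_scaleC[OF assms(5)] scaleC_add_right)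
  qed
qed

text \<open>V* V = I and V* E = 0 are rewritten as isometry and orthogonality of the ranges, a form
  that passes along isometric embeddings without reference to adjoints.\<close>

lemma op_matrix_brownian_iff:
  fixes H1 :: "'a::chilbert set" and H2 :: "'b::chilbert set"
  assumes H1: "closed_csubspace H1" "H1 \<noteq> {0}" and H2: "closed_csubspace H2" "H2 \<noteq> {0}"
    and V: "V \<in> bops H1 H1" and E: "E \<in> bops H2 H1" and X: "X \<in> bops H2 H2"
  shows "op_matrix V E (\<lambda>_. 0) X \<in> brownian_type H1 H2 \<longleftrightarrow>
    isometric H1 H1 V \<and> (\<forall>x\<in>H1. \<forall>y\<in>H2. cinner (V x) (E y) = 0) \<and>
    (\<forall>y\<in>H2. X (adj H2 H1 E (E y)) = adj H2 H1 E (E (X y)))"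
proof -
  note cs1 = ccs_csubspace[OF H1(1)] and cs2 = ccs_csubspace[OF H2(1)]
  note ent = entries_op_matrix[of V E X, OF bops_0[OF cs1 V] bops_0[OF cs2 E] bops_0[OF cs2 X]]
  have 1: "(\<forall>x\<in>H1. adj H1 H1 V (V x) = x) \<longleftrightarrow> isometric H1 H1 V"
  proof
    assume l: "\<forall>x\<in>H1. adj H1 H1 V (V x) = x"
    have "norm (V x) = norm x" if x: "x \<in> H1" for x
      by (rule norm_eq_of_cinner_eq) (use cinner_adj[OF H1(1) V x, of "V x"] l x in simp)
    then show "isometric H1 H1 V" using V by (simp add: isometric_def)
  next
    assume "isometric H1 H1 V"
    then show "\<forall>x\<in>H1. adj H1 H1 V (V x) = x"
      by (auto intro!: adj_unique[OF H1(1)] simp: isometric_cinner[OF cs1])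
  qed
  have 2: "(\<forall>y\<in>H2. adj H1 H1 V (E y) = 0) \<longleftrightarrow> (\<forall>x\<in>H1. \<forall>y\<in>H2. cinner (V x) (E y) = 0)"
  proof
    show "\<forall>x\<in>H1. \<forall>y\<in>H2. cinner (V x) (E y) = 0" if "\<forall>y\<in>H2. adj H1 H1 V (E y) = 0"
      using that cinner_adj[OF H1(1) V] by simp
    show "\<forall>y\<in>H2. adj H1 H1 V (E y) = 0" if "\<forall>x\<in>H1. \<forall>y\<in>H2. cinner (V x) (E y) = 0"
      using that by (auto intro!: adj_unique[OF H1(1)] ccs_0[OF H1(1)])
  qed
  show ?thesis
    unfolding brownian_type_def
    using op_matrix_bops[OF cs1 cs2 V E X] H1 H2 by (simp add: ent 1 2 Let_def)
qed

section \<open>Normal extensions\<close>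

text \<open>Both the lift and the unitary between spaces of equal dimension arise as closures of
  relations, which this lemma turns into operators. The bound makes the relation single-valued. It
  also gives norm p \<le> (1 + c) norm (fst p) on \<open>G\<close>, so that the first projection is
  bounded below and the domain is closed.\<close>

lemma graph_bops:
  fixes G :: "('a::chilbert \<times> 'b::chilbert) set"
  assumes G: "closed_csubspace G" and c: "c \<ge> 0"
    and bd: "\<And>x y. (x, y) \<in> G \<Longrightarrow> norm y \<le> c * norm x"
  obtains A where "closed_csubspace (fst ` G)" "A \<in> bops (fst ` G) (snd ` G)"
    "\<And>x. x \<in> fst ` G \<Longrightarrow> (x, A x) \<in> G" "\<And>x y. (x, y) \<in> G \<Longrightarrow> A x = y"
proof -
  note cs = ccs_csubspace[OF G]
  have addG: "(x, y) \<in> G \<Longrightarrow> (x', y') \<in> G \<Longrightarrow> (x + x', y + y') \<in> G" for x y x' y'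
    using csubspace_add[OF cs, of "(x, y)" "(x', y')"] by simp
  have diffG: "(x, y) \<in> G \<Longrightarrow> (x', y') \<in> G \<Longrightarrow> (x - x', y - y') \<in> G" for x y x' y'
    using csubspace_diff[OF cs, of "(x, y)" "(x', y')"] by simp
  have scG: "(x, y) \<in> G \<Longrightarrow> (a *\<^sub>C x, a *\<^sub>C y) \<in> G" for x y a
    using csubspace_scaleC[OF cs, of "(x, y)" a] by (simp add: scaleC_prod_def)
  have single: "y = y'" if "(x, y) \<in> G" "(x, y') \<in> G" for x y y'
    using bd[OF diffG[OF that]] by simp
  define A where "A x = (THE y. (x, y) \<in> G)" for x
  have A: "A x = y" if "(x, y) \<in> G" for x y
    unfolding A_def using that single by blast
  have AG: "(x, A x) \<in> G" if "x \<in> fst ` G" for x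
    using that A by force
  have "closed_csubspace (fst ` G)"
  proof (rule closed_csubspace_bounded_below_image[OF G])
    show "fst \<in> bops G UNIV"
      by (rule bopsI[where M = 1]) (auto simp: scaleC_prod_def norm_fst_le)
    show "1 / (1 + c) * norm p \<le> norm (fst p)" if "p \<in> G" for p
    proof -
      have "norm p \<le> norm (fst p) + norm (snd p)"
        using norm_Pair_le[of "fst p" "snd p"] by simp
      also have "\<dots> \<le> (1 + c) * norm (fst p)"
        using bd[of "fst p" "snd p"] that by (simp add: algebra_simps)
      finally show ?thesis
        using c by (simp add: field_simps)
    qed
  qed (use c in simp)
  moreover have "A \<in> bops (fst ` G) (snd ` G)"
  proof (rule bopsI[where M = c])
    show "A x \<in> snd ` G" if "x \<in> fst ` G" for x
      using AG[OF that] by force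
    show "A (x + y) = A x + A y" if "x \<in> fst ` G" "y \<in> fst ` G" for x y
      by (intro A addG AG that)
    show "A (a *\<^sub>C x) = a *\<^sub>C A x" if "x \<in> fst ` G" for a x
      by (intro A scG AG that)
    show "norm (A x) \<le> c * norm x" if "x \<in> fst ` G" for x
      by (intro bd AG that)
  qed
  ultimately show ?thesis
    using that AG A by blast
qed

text \<open>N leaves the orthogonal complement of \<open>M\<close> invariant exactly when N* leaves
  \<open>M\<close> invariant; one direction uses that the double complement of the closed subspace
  \<open>M\<close> is \<open>M\<close>.\<close>

lemma reduces_iff_adj:
  fixes K :: "'a::chilbert set"
  assumes K: "closed_csubspace K" and N: "N \<in> bops K K" and M: "closed_csubspace M" "M \<subseteq> K"
  shows "reduces K N M \<longleftrightarrow> (\<forall>x\<in>M. N x \<in> M) \<and> (\<forall>x\<in>M. adj K K N x \<in> M)"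
proof -
  have "(\<forall>x\<in>K \<ominus>\<^sub>H M. N x \<in> K \<ominus>\<^sub>H M) \<longleftrightarrow> (\<forall>x\<in>M. adj K K N x \<in> M)"
  proof
    assume l: "\<forall>x\<in>K \<ominus>\<^sub>H M. N x \<in> K \<ominus>\<^sub>H M"
    show "\<forall>x\<in>M. adj K K N x \<in> M"
    proof
      fix x assume x: "x \<in> M"
      have "cinner (adj K K N x) y = 0" if y: "y \<in> K \<ominus>\<^sub>H M" for y
      proof -
        have "cinner (N y) x = 0"
          using l y x by (auto simp: ominus_def)
        then show ?thesis
          using cinner_adj[OF K N, of y x] y cinner_eq_0_commute by (metis (mono_tags, lifting) mem_Collect_eq ominus_def)
      qed
      then have "adj K K N x \<in> K \<ominus>\<^sub>H (K \<ominus>\<^sub>H M)"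
        using adj_in[OF K N] by (auto simp: ominus_def)
      then show "adj K K N x \<in> M"
        using ominus_ominus[OF M(1) K M(2)] by simp
    qed
  next
    assume r: "\<forall>x\<in>M. adj K K N x \<in> M"
    show "\<forall>x\<in>K \<ominus>\<^sub>H M. N x \<in> K \<ominus>\<^sub>H M"
      using r bops_in[OF N] by (auto simp: ominus_def cinner_adj[OF K N])
  qed
  then show ?thesis
    by (auto simp: reduces_def)
qed

text \<open>On a subspace invariant under N and N*, the restriction of N* satisfies the identity
  defining the adjoint of the restricted operator, so normality is inherited.\<close>

lemma normal_op_restrict:
  fixes K :: "'a::chilbert set"
  assumes K: "closed_csubspace K" and N: "normal_op K N" and M: "closed_csubspace M" "M \<subseteq> K"
    and inv: "\<And>x. x \<in> M \<Longrightarrow> N x \<in> M" "\<And>x. x \<in> M \<Longrightarrow> adj K K N x \<in> M"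
  shows "normal_op M N" and "x \<in> M \<Longrightarrow> adj M M N x = adj K K N x"
proof -
  have Nb: "N \<in> bops K K" using N by (simp add: normal_op_def)
  show *: "adj M M N x = adj K K N x" if "x \<in> M" for x
    by (rule adj_unique[OF M(1)]) (use that inv M cinner_adj[OF K Nb] in auto)
  show "normal_op M N"
    unfolding normal_op_def
    using bops_mono[OF Nb M(2) inv(1)] N M(2) by (auto simp: * inv normal_op_def)
qed

section \<open>The smallest reducing subspace of a normal extension\<close>

locale normal_ext =
  fixes H :: "'a::chilbert set" and S :: "'a \<Rightarrow> 'a"
    and K :: "'b::chilbert set" and j :: "'a \<Rightarrow> 'b" and N :: "'b \<Rightarrow> 'b"
  assumes closed_H: "closed_csubspace H" and S_bops: "S \<in> bops H H"
    and ext: "normal_extension H S K j N"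
begin

lemma closed_K: "closed_csubspace K" and iso_j: "isometric H K j" and normal_N: "normal_op K N"
  and j_S: "h \<in> H \<Longrightarrow> j (S h) = N (j h)"
  using ext by (auto simp: normal_extension_def op_extends_def)

lemmas csub_H = ccs_csubspace[OF closed_H]
lemmas csub_K = ccs_csubspace[OF closed_K]
lemmas j_bops = isometric_bops[OF iso_j]
lemmas j_in = bops_in[OF j_bops]

lemma N_bops: "N \<in> bops K K"
  using normal_N by (simp add: normal_op_def)

abbreviation Na where "Na \<equiv> adj K K N"

lemmas Na_bops = bops_adj[OF closed_K N_bops]
lemmas N_in = bops_in[OF N_bops] and Na_in = bops_in[OF Na_bops]
lemmas Npow_in = bops_in[OF bops_funpow[OF N_bops]] and Napow_in = bops_in[OF bops_funpow[OF Na_bops]]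
lemmas S_in = bops_in[OF S_bops] and Spow_in = bops_in[OF bops_funpow[OF S_bops]]
lemmas cinner_N = cinner_adj[OF closed_K N_bops]
lemmas cinner_N' = cinner_adj'[OF closed_K N_bops]

lemma cinner_j: "a \<in> H \<Longrightarrow> b \<in> H \<Longrightarrow> cinner (j a) (j b) = cinner a b"
  by (rule isometric_cinner[OF csub_H iso_j])

lemma N_Na: "x \<in> K \<Longrightarrow> N (Na x) = Na (N x)"
  using normal_N by (simp add: normal_op_def)

lemma N_Napow: "x \<in> K \<Longrightarrow> N ((Na ^^ k) x) = (Na ^^ k) (N x)"
  by (rule funpow_commute_on[OF Na_bops N_bops N_Na])

lemma Npow_Napow: "x \<in> K \<Longrightarrow> (N ^^ k) ((Na ^^ l) x) = (Na ^^ l) ((N ^^ k) x)"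
  by (induction k) (auto simp: N_Napow Npow_in)

lemma cinner_Npow: "x \<in> K \<Longrightarrow> y \<in> K \<Longrightarrow> cinner ((N ^^ k) x) y = cinner x ((Na ^^ k) y)"
  by (induction k arbitrary: y) (auto simp: cinner_N Npow_in Na_in funpow_swap1[of Na])

lemma cinner_Napow: "x \<in> K \<Longrightarrow> y \<in> K \<Longrightarrow> cinner ((Na ^^ k) x) y = cinner x ((N ^^ k) y)"
  using cinner_Npow[of y x k] cinner_commute by metis

lemma Npow_j: "h \<in> H \<Longrightarrow> (N ^^ k) (j h) = j ((S ^^ k) h)"
  by (rule funpow_commute_on[OF S_bops j_bops j_S, symmetric])

lemma cinner_Napow_j:
  assumes "a \<in> H" "b \<in> H"
  shows "cinner ((Na ^^ k) (j a)) ((Na ^^ l) (j b)) = cinner ((S ^^ l) a) ((S ^^ k) b)"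
proof -
  have "cinner ((Na ^^ k) (j a)) ((Na ^^ l) (j b)) = cinner (j a) ((Na ^^ l) ((N ^^ k) (j b)))"
    using assms by (simp add: cinner_Napow j_in Napow_in Npow_Napow)
  also have "\<dots> = cinner ((N ^^ l) (j a)) ((N ^^ k) (j b))"
    using assms by (simp add: cinner_Npow j_in Npow_in)
  also have "\<dots> = cinner ((S ^^ l) a) ((S ^^ k) b)"
    using assms by (simp add: Npow_j cinner_j Spow_in)
  finally show ?thesis .
qed

text \<open>Powers of N* alone suffice: N commutes with N* and extends S, so a power of N moves
  inward and acts as a power of S on \<open>H\<close>. The family is indexed by all naturals, of
  which the first \<open>n\<close> count, so that padding with zeros brings two sums to a common
  length.\<close>

definition Zsum :: "nat \<Rightarrow> (nat \<Rightarrow> 'a) \<Rightarrow> 'b" where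
  "Zsum n f = (\<Sum>k<n. (Na ^^ k) (j (f k)))"

definition Zset :: "'b set" where
  "Zset = {Zsum n f |n f. \<forall>k. f k \<in> H}"

definition Zspace :: "'b set" where
  "Zspace = closure Zset"

lemma Zsum_in: "(\<And>k. f k \<in> H) \<Longrightarrow> Zsum n f \<in> K"
  unfolding Zsum_def by (intro csubspace_sum[OF csub_K] Napow_in j_in) auto

lemma Zsum_pad:
  assumes "n \<le> m" "\<And>k. f k \<in> H"
  shows "Zsum n f = Zsum m (\<lambda>k. if k < n then f k else 0)"
proof -
  have "Zsum m (\<lambda>k. if k < n then f k else 0) = (\<Sum>k<m. if k < n then (Na ^^ k) (j (f k)) else 0)"
    unfolding Zsum_def
    by (intro sum.cong) (auto simp: bops_0[OF csub_H j_bops] bops_0[OF csub_K bops_funpow[OF Na_bops]])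
  also have "\<dots> = (\<Sum>k<n. (Na ^^ k) (j (f k)))"
    using assms(1) by (intro sum.mono_neutral_cong_right) auto
  finally show ?thesis
    by (simp add: Zsum_def)
qed

lemma Zsum_add:
  "(\<And>k. f k \<in> H) \<Longrightarrow> (\<And>k. g k \<in> H) \<Longrightarrow> Zsum n f + Zsum n g = Zsum n (\<lambda>k. f k + g k)"
  unfolding Zsum_def
  by (simp add: sum.distrib bops_add[OF j_bops] bops_add[OF bops_funpow[OF Na_bops]] j_in)

lemma Zsum_scaleC: "(\<And>k. f k \<in> H) \<Longrightarrow> c *\<^sub>C Zsum n f = Zsum n (\<lambda>k. c *\<^sub>C f k)"
  unfolding Zsum_def
  by (induction n) (simp_all add: scaleC_add_right bops_scaleC[OF j_bops]
      bops_scaleC[OF bops_funpow[OF Na_bops]] j_in)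

lemma N_Zsum: "(\<And>k. f k \<in> H) \<Longrightarrow> N (Zsum n f) = Zsum n (\<lambda>k. S (f k))"
  unfolding Zsum_def
  by (simp add: bops_sum[OF csub_K N_bops] Napow_in j_in N_Napow j_S)

text \<open>One family \<open>h\<close> represents both the sum and its image under A acting inside
  the summands. This is what closes the graph of the future lift under addition.\<close>

lemma Zsum_pair_add:
  assumes f: "\<And>k. f k \<in> H" and g: "\<And>k. g k \<in> H" and A: "A \<in> bops H H"
  obtains h m where "\<And>k. h k \<in> H" "Zsum n f + Zsum n' g = Zsum m h"
    "Zsum n (\<lambda>k. A (f k)) + Zsum n' (\<lambda>k. A (g k)) = Zsum m (\<lambda>k. A (h k))"
proof -
  let ?m = "max n n'"
  let ?f = "\<lambda>k. if k < n then f k else 0" and ?g = "\<lambda>k. if k < n' then g k else 0"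
  have in_H: "?f k \<in> H" "?g k \<in> H" for k
    using f g csubspace_0[OF csub_H] by auto
  have "Zsum n (\<lambda>k. A (f k)) = Zsum ?m (\<lambda>k. A (?f k))" "Zsum n' (\<lambda>k. A (g k)) = Zsum ?m (\<lambda>k. A (?g k))"
    using Zsum_pad[of n ?m "\<lambda>k. A (f k)"] Zsum_pad[of n' ?m "\<lambda>k. A (g k)"] bops_in[OF A] f g
    by (simp_all add: bops_0[OF csub_H A] if_distrib cong: if_cong)
  moreover have "Zsum n f = Zsum ?m ?f" "Zsum n' g = Zsum ?m ?g"
    using Zsum_pad[of n ?m f] Zsum_pad[of n' ?m g] f g by auto
  ultimately show ?thesis
    using that[of "\<lambda>k. ?f k + ?g k" ?m] in_H csubspace_add[OF csub_H] bops_in[OF A]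
    by (simp add: Zsum_add bops_add[OF A])
qed

lemma csubspace_Zset: "csubspace Zset"
  unfolding csubspace_def
proof (intro conjI ballI allI)
  show "0 \<in> Zset"
    unfolding Zset_def Zsum_def using csubspace_0[OF csub_H] by (auto intro!: exI[of _ 0] exI[of _ "\<lambda>_. 0"])
  show "x + y \<in> Zset" if xy: "x \<in> Zset" "y \<in> Zset" for x y
  proof -
    obtain n f n' g where fg: "x = Zsum n f" "y = Zsum n' g" "\<And>k. f k \<in> H" "\<And>k. g k \<in> H"
      using xy unfolding Zset_def by blast
    obtain h m where "\<And>k. h k \<in> H" "Zsum n f + Zsum n' g = Zsum m h"
      by (rule Zsum_pair_add[of f g "\<lambda>x. x" n n', OF fg(3,4) bops_id]) blast
    then show ?thesis
      unfolding fg(1,2) Zset_def by auto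
  qed
  show "c *\<^sub>C x \<in> Zset" if "x \<in> Zset" for c x
  proof -
    obtain n f where f: "x = Zsum n f" "\<And>k. f k \<in> H"
      using \<open>x \<in> Zset\<close> unfolding Zset_def by blast
    have "c *\<^sub>C x = Zsum n (\<lambda>k. c *\<^sub>C f k)"
      unfolding f(1) by (rule Zsum_scaleC[OF f(2)])
    then show ?thesis
      using f(2) csubspace_scaleC[OF csub_H] unfolding Zset_def by blast
  qed
qed

lemma closed_Zspace: "closed_csubspace Zspace"
  unfolding Zspace_def by (rule csubspace_closure[OF csubspace_Zset])

lemma Zset_subset:
  assumes M: "csubspace M" "j ` H \<subseteq> M" "\<And>x. x \<in> M \<Longrightarrow> Na x \<in> M"
  shows "Zset \<subseteq> M"
proof -
  have "(Na ^^ k) (j h) \<in> M" if "h \<in> H" for k h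
    using M that by (induction k) auto
  then show ?thesis
    unfolding Zset_def Zsum_def by (auto intro!: csubspace_sum[OF M(1)])
qed

lemma Zspace_subset:
  assumes M: "closed_csubspace M" "j ` H \<subseteq> M" "\<And>x. x \<in> M \<Longrightarrow> Na x \<in> M"
  shows "Zspace \<subseteq> M"
  unfolding Zspace_def
  by (intro closure_minimal Zset_subset ccs_csubspace ccs_closed M)

lemma Zspace_subset_K: "Zspace \<subseteq> K"
  by (rule Zspace_subset[OF closed_K]) (auto intro: j_in Na_in)

lemma Napow_j_in_Zset: "h \<in> H \<Longrightarrow> (Na ^^ k) (j h) \<in> Zset"
proof -
  assume h: "h \<in> H"
  let ?f = "\<lambda>i. if i = k then h else 0"
  have "Zsum (Suc k) ?f = (\<Sum>i<Suc k. if i = k then (Na ^^ k) (j h) else 0)"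
    unfolding Zsum_def
    by (intro sum.cong) (auto simp: bops_0[OF csub_H j_bops] bops_0[OF csub_K bops_funpow[OF Na_bops]])
  then have "(Na ^^ k) (j h) = Zsum (Suc k) ?f"
    by simp
  then show ?thesis
    unfolding Zset_def using h csubspace_0[OF csub_H] by (intro CollectI exI[of _ "Suc k"] exI[of _ ?f]) auto
qed

lemma j_Zspace: "j ` H \<subseteq> Zspace"
  unfolding Zspace_def using Napow_j_in_Zset[of _ 0] closure_subset by fastforce

lemma Zspace_induct_closed:
  assumes "closed M" "\<And>n f. (\<And>k. f k \<in> H) \<Longrightarrow> Zsum n f \<in> M"
  shows "Zspace \<subseteq> M"
  unfolding Zspace_def by (rule closure_minimal[OF _ assms(1)]) (auto simp: Zset_def assms(2))

lemma bops_Zspace: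
  assumes A: "A \<in> bops K K" and AZ: "\<And>k h. h \<in> H \<Longrightarrow> A ((Na ^^ k) (j h)) \<in> Zset" and x: "x \<in> Zspace"
  shows "A x \<in> Zspace"
proof -
  have "Zspace \<subseteq> {x \<in> K. A x \<in> Zspace}"
  proof (rule Zspace_induct_closed)
    show "closed {x \<in> K. A x \<in> Zspace}"
      by (rule ccs_closed[OF closed_csubspace_bops_preimage[OF closed_K A closed_Zspace]])
    show "Zsum n f \<in> {x \<in> K. A x \<in> Zspace}" if f: "\<And>k. f k \<in> H" for n f
    proof -
      have "A (Zsum n f) = (\<Sum>k<n. A ((Na ^^ k) (j (f k))))"
        unfolding Zsum_def by (simp add: bops_sum[OF csub_K A] Napow_in j_in f)
      also have "\<dots> \<in> Zset"
        by (intro csubspace_sum[OF csubspace_Zset] AZ f)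
      finally show ?thesis
        using Zsum_in[OF f] closure_subset unfolding Zspace_def by auto
    qed
  qed
  then show ?thesis using x by auto
qed

lemma N_Zspace: "x \<in> Zspace \<Longrightarrow> N x \<in> Zspace"
  by (rule bops_Zspace[OF N_bops]) (auto simp: N_Napow j_in simp flip: j_S intro: Napow_j_in_Zset S_in)

lemma Na_Zspace: "x \<in> Zspace \<Longrightarrow> Na x \<in> Zspace"
  by (rule bops_Zspace[OF Na_bops]) (use Napow_j_in_Zset[of _ "Suc _"] in auto)

text \<open>\<open>Zspace\<close> contains the image of \<open>H\<close> and is invariant under N
  and N*, so it reduces N; conversely every reducing subspace containing the image of
  \<open>H\<close> is invariant under N* and hence contains \<open>Zspace\<close>.\<close>

lemma minimal_iff: "minimal_normal_extension H S K j N \<longleftrightarrow> Zspace = K"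
proof
  assume m: "minimal_normal_extension H S K j N"
  have "reduces K N Zspace"
    unfolding reduces_iff_adj[OF closed_K N_bops closed_Zspace Zspace_subset_K]
    using N_Zspace Na_Zspace by auto
  then show "Zspace = K"
    using m closed_Zspace Zspace_subset_K j_Zspace unfolding minimal_normal_extension_def by blast
next
  assume Z: "Zspace = K"
  show "minimal_normal_extension H S K j N"
    unfolding minimal_normal_extension_def
  proof (intro conjI allI impI ext)
    fix M assume M: "closed_csubspace M \<and> M \<subseteq> K \<and> j ` H \<subseteq> M \<and> reduces K N M"
    then have "Zspace \<subseteq> M"
      using reduces_iff_adj[OF closed_K N_bops, of M] by (intro Zspace_subset) auto
    then show "M = K" using M Z by auto
  qed
qed

text \<open>The locale is interpreted a second time on \<open>Zspace\<close>. The adjoint of the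
  restricted operator is the restriction of N*, so the construction does not shrink the space
  again.\<close>

lemma minimal_Zspace: "minimal_normal_extension H S Zspace j N"
proof -
  note r = normal_op_restrict[OF closed_K normal_N closed_Zspace Zspace_subset_K N_Zspace Na_Zspace]
  have e: "normal_extension H S Zspace j N"
    unfolding normal_extension_def
  proof (intro conjI closed_Zspace r(1))
    show "isometric H Zspace j"
      using iso_j bops_mono[OF j_bops subset_refl, of Zspace] j_Zspace by (auto simp: isometric_def)
    show "op_extends H j S N"
      by (auto simp: op_extends_def j_S)
  qed
  interpret Z: normal_ext H S Zspace j N
    by unfold_locales (use closed_H S_bops e in auto)
  have "x \<in> Z.Zspace \<Longrightarrow> Na x \<in> Z.Zspace" for x
    using Z.Na_Zspace[of x] r(2) Z.Zspace_subset_K by auto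
  then have "Z.Zspace = Zspace"
    using Zspace_subset[OF Z.closed_Zspace Z.j_Zspace] Z.Zspace_subset_K by auto
  then show ?thesis
    unfolding Z.minimal_iff .
qed

section \<open>Bounds for the sums and the lift of a positive operator\<close>

text \<open>Since \<open>\<langle>N*\<^sup>k j a, N*\<^sup>l j b\<rangle> = \<langle>S\<^sup>l a, S\<^sup>k b\<rangle>\<close>, an operator commuting with \<open>S\<close> can be moved
  between the two arguments.\<close>

lemma cinner_Zsum_move:
  assumes D: "D \<in> bops H H" "\<And>x y. x \<in> H \<Longrightarrow> y \<in> H \<Longrightarrow> cinner (D x) y = cinner x (D y)"
    and DS: "\<And>x. x \<in> H \<Longrightarrow> D (S x) = S (D x)"
    and f: "\<And>k. f k \<in> H" and g: "\<And>k. g k \<in> H"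
  shows "cinner (Zsum n (\<lambda>k. D (f k))) (Zsum n g) = cinner (Zsum n f) (Zsum n (\<lambda>k. D (g k)))"
proof -
  have pow: "D ((S ^^ k) x) = (S ^^ k) (D x)" if "x \<in> H" for k x
    by (rule funpow_commute_on[OF S_bops D(1) DS that])
  have "cinner ((Na ^^ k) (j (D (f k)))) ((Na ^^ l) (j (g l)))
      = cinner ((Na ^^ k) (j (f k))) ((Na ^^ l) (j (D (g l))))" for k l
    using f g by (simp add: cinner_Napow_j bops_in[OF D(1)] pow[symmetric] D(2) Spow_in)
  then show ?thesis
    unfolding Zsum_def by (simp add: cinner_sum_left cinner_sum_right)
qed

lemma cinner_Zsum_nonneg:
  assumes C: "positive_op H C" and CS: "\<And>x. x \<in> H \<Longrightarrow> S (C x) = C (S x)"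
    and f: "\<And>k. f k \<in> H"
  shows "0 \<le> Re (cinner (Zsum n (\<lambda>k. C (f k))) (Zsum n f))"
proof -
  obtain D where D: "positive_op H D" "\<And>x. x \<in> H \<Longrightarrow> D (D x) = C x"
    "\<forall>B\<in>bops H H. (\<forall>x\<in>H. B (C x) = C (B x)) \<longrightarrow> (\<forall>x\<in>H. B (D x) = D (B x))"
    by (rule positive_root_exists[OF closed_H C]) blast
  note Db = positive_op_bops[OF D(1)]
  \<comment> \<open>The root inherits commutation with S from C. This allows one of the two factors
    D to be moved to the other argument, which leaves a squared norm.\<close>
  have DS: "D (S x) = S (D x)" if "x \<in> H" for x
    using D(3) S_bops CS that by simp
  have "cinner (Zsum n (\<lambda>k. C (f k))) (Zsum n f) = cinner (Zsum n (\<lambda>k. D (D (f k)))) (Zsum n f)"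
    by (simp add: D(2) f)
  also have "\<dots> = cinner (Zsum n (\<lambda>k. D (f k))) (Zsum n (\<lambda>k. D (f k)))"
    by (rule cinner_Zsum_move[OF Db positive_op_selfadjoint[OF csub_H D(1)] DS])
      (auto simp: f bops_in[OF Db])
  finally show ?thesis
    by (simp add: cinner_self)
qed

lemma Zsum_lincomb:
  assumes "\<And>k. f k \<in> H" "A \<in> bops H H" "B \<in> bops H H"
  shows "Zsum n (\<lambda>k. of_real c *\<^sub>C A (f k) + of_real d *\<^sub>C B (f k))
    = c *\<^sub>R Zsum n (\<lambda>k. A (f k)) + d *\<^sub>R Zsum n (\<lambda>k. B (f k))"
  using assms bops_in[OF assms(2)] bops_in[OF assms(3)]
  by (simp add: scaleC_of_real[symmetric] Zsum_scaleC Zsum_add csubspace_scaleC[OF csub_H] del: scaleC_of_real)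

text \<open>Take \<open>C = c\<^sup>2 I - A\<^sup>2\<close>, respectively \<open>C = A\<^sup>2 - c\<^sup>2 I\<close>, in the previous inequality.\<close>

lemma norm_Zsum_bounds:
  assumes A: "positive_op H A" and AS: "\<And>x. x \<in> H \<Longrightarrow> A (S x) = S (A x)"
    and c: "c \<ge> 0" and f: "\<And>k. f k \<in> H"
  shows norm_Zsum_le: "(\<And>x. x \<in> H \<Longrightarrow> norm (A x) \<le> c * norm x) \<Longrightarrow>
      norm (Zsum n (\<lambda>k. A (f k))) \<le> c * norm (Zsum n f)"
    and norm_Zsum_ge: "(\<And>x. x \<in> H \<Longrightarrow> c * norm x \<le> norm (A x)) \<Longrightarrow>
      c * norm (Zsum n f) \<le> norm (Zsum n (\<lambda>k. A (f k)))"
proof -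
  note Ab = positive_op_bops[OF A] and sa = positive_op_selfadjoint[OF csub_H A]
  note AAb = bops_comp[OF Ab Ab]
  \<comment> \<open>The sign \<open>s\<close> treats both bounds at once: s = 1 yields the upper and
    s = -1 the lower one, with C = s (c^2 I - A^2).\<close>
  have *: "0 \<le> s * c\<^sup>2 * (norm (Zsum n f))\<^sup>2 - s * (norm (Zsum n (\<lambda>k. A (f k))))\<^sup>2"
    if s: "\<And>x. x \<in> H \<Longrightarrow> 0 \<le> s * (c\<^sup>2 * (norm x)\<^sup>2 - (norm (A x))\<^sup>2)" for s :: real
  proof -
    define C where "C x = of_real (s * c\<^sup>2) *\<^sub>C x + of_real (- s) *\<^sub>C A (A x)" for x
    have Cb: "C \<in> bops H H"
      unfolding C_def[abs_def] by (rule bops_lincomb[OF csub_H bops_id AAb])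
    have "positive_op H C"
    proof (rule positive_opI[OF Cb])
      show "cinner (C x) y = cinner x (C y)" if "x \<in> H" "y \<in> H" for x y
        using that by (simp add: C_def cinner_add_left cinner_add_right sa bops_in[OF Ab])
      show "0 \<le> Re (cinner (C x) x)" if "x \<in> H" for x
        using s[OF that] that
        by (simp add: C_def cinner_add_left cinner_self sa bops_in[OF Ab] algebra_simps)
    qed
    moreover have "S (C x) = C (S x)" if "x \<in> H" for x
      using that by (simp add: C_def bops_add[OF S_bops] bops_scaleC[OF S_bops] AS bops_in[OF Ab]
          csubspace_scaleC[OF csub_H] S_in)
    ultimately have "0 \<le> Re (cinner (Zsum n (\<lambda>k. C (f k))) (Zsum n f))"
      by (rule cinner_Zsum_nonneg[OF _ _ f])
    also have "Zsum n (\<lambda>k. C (f k)) = (s * c\<^sup>2) *\<^sub>R Zsum n f + (- s) *\<^sub>R Zsum n (\<lambda>k. A (A (f k)))"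
      unfolding C_def by (rule Zsum_lincomb[OF f bops_id AAb])
    also have "cinner \<dots> (Zsum n f) = of_real (s * c\<^sup>2 * (norm (Zsum n f))\<^sup>2)
        - of_real s * cinner (Zsum n (\<lambda>k. A (f k))) (Zsum n (\<lambda>k. A (f k)))"
      using cinner_Zsum_move[OF Ab sa AS, of "\<lambda>k. A (f k)" f n] f bops_in[OF Ab]
      by (simp add: cinner_diff_left cinner_self)
    finally show ?thesis
      by (simp add: cinner_self)
  qed
  show "norm (Zsum n (\<lambda>k. A (f k))) \<le> c * norm (Zsum n f)"
    if "\<And>x. x \<in> H \<Longrightarrow> norm (A x) \<le> c * norm x"
  proof -
    have "(norm (A x))\<^sup>2 \<le> c\<^sup>2 * (norm x)\<^sup>2" if "x \<in> H" for x
      using power_mono[OF \<open>\<And>x. x \<in> H \<Longrightarrow> norm (A x) \<le> c * norm x\<close>[OF that], of 2]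
      by (simp add: power_mult_distrib)
    then have "(norm (Zsum n (\<lambda>k. A (f k))))\<^sup>2 \<le> (c * norm (Zsum n f))\<^sup>2"
      using *[of 1] by (simp add: power_mult_distrib)
    then show ?thesis
      using c by (auto intro: power2_le_imp_le)
  qed
  show "c * norm (Zsum n f) \<le> norm (Zsum n (\<lambda>k. A (f k)))"
    if "\<And>x. x \<in> H \<Longrightarrow> c * norm x \<le> norm (A x)"
  proof -
    have "c\<^sup>2 * (norm x)\<^sup>2 \<le> (norm (A x))\<^sup>2" if "x \<in> H" for x
      using power_mono[OF \<open>\<And>x. x \<in> H \<Longrightarrow> c * norm x \<le> norm (A x)\<close>[OF that], of 2] c
      by (simp add: power_mult_distrib)
    then have "(c * norm (Zsum n f))\<^sup>2 \<le> (norm (Zsum n (\<lambda>k. A (f k))))\<^sup>2"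
      using *[of "-1"] by (simp add: power_mult_distrib)
    then show ?thesis
      by (auto intro: power2_le_imp_le)
  qed
qed

text \<open>A acts inside the summands, and the bound of \<open>norm_Zsum_le\<close> makes the
  closure of this relation the graph of a bounded operator. Its domain is closed and contains the
  dense sums, so it is all of \<open>K\<close>. Commutation, symmetry and positivity are closed
  conditions and are verified on the sums.\<close>

lemma positive_lift_exists:
  assumes Z: "Zspace = K" and A: "positive_op H A" and AS: "\<And>x. x \<in> H \<Longrightarrow> A (S x) = S (A x)"
  obtains B where "positive_op K B" "\<And>x. x \<in> K \<Longrightarrow> N (B x) = B (N x)"
    "\<And>h. h \<in> H \<Longrightarrow> B (j h) = j (A h)"
proof -
  note Ab = positive_op_bops[OF A] and sa = positive_op_selfadjoint[OF csub_H A]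
  obtain c where c: "c > 0" "\<And>x. x \<in> H \<Longrightarrow> norm (A x) \<le> c * norm x"
    using bops_bound[OF Ab] by blast
  \<comment> \<open>Only a relation so far: different families may give the same sum, and that their
    images agree follows from the norm bound.\<close>
  define G0 where "G0 = {(Zsum n f, Zsum n (\<lambda>k. A (f k))) |n f. \<forall>k. f k \<in> H}"
  define G where "G = closure G0"
  have "csubspace G0"
    unfolding csubspace_def
  proof (intro conjI ballI allI)
    show "0 \<in> G0"
      unfolding G0_def Zsum_def zero_prod_def using csubspace_0[OF csub_H]
      by (auto intro!: exI[of _ 0] exI[of _ "\<lambda>_. 0"])
    show "x + y \<in> G0" if xy: "x \<in> G0" "y \<in> G0" for x y
    proof -
      obtain n f n' g where fg: "x = (Zsum n f, Zsum n (\<lambda>k. A (f k)))"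
        "y = (Zsum n' g, Zsum n' (\<lambda>k. A (g k)))" "\<And>k. f k \<in> H" "\<And>k. g k \<in> H"
        using xy unfolding G0_def by blast
      obtain h m where "\<And>k. h k \<in> H" "Zsum n f + Zsum n' g = Zsum m h"
        "Zsum n (\<lambda>k. A (f k)) + Zsum n' (\<lambda>k. A (g k)) = Zsum m (\<lambda>k. A (h k))"
        by (rule Zsum_pair_add[of f g A n n', OF fg(3,4) Ab]) blast
      then show ?thesis
        unfolding fg(1,2) G0_def by auto
    qed
    show "a *\<^sub>C x \<in> G0" if x: "x \<in> G0" for a x
    proof -
      obtain n f where f: "x = (Zsum n f, Zsum n (\<lambda>k. A (f k)))" "\<And>k. f k \<in> H"
        using x unfolding G0_def by blast
      then have "a *\<^sub>C x = (Zsum n (\<lambda>k. a *\<^sub>C f k), Zsum n (\<lambda>k. A (a *\<^sub>C f k)))"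
        by (simp add: scaleC_prod_def Zsum_scaleC bops_in[OF Ab] bops_scaleC[OF Ab])
      then show ?thesis
        unfolding G0_def using f csubspace_scaleC[OF csub_H] by blast
    qed
  qed
  then have G: "closed_csubspace G"
    unfolding G_def by (rule csubspace_closure)
  have G0G: "(Zsum n f, Zsum n (\<lambda>k. A (f k))) \<in> G" if "\<And>k. f k \<in> H" for n f
  proof -
    have "(Zsum n f, Zsum n (\<lambda>k. A (f k))) \<in> G0"
      unfolding G0_def using that by (intro CollectI exI[of _ n] exI[of _ f]) simp
    then show ?thesis
      unfolding G_def using closure_subset by blast
  qed
  have GP: "G \<subseteq> P" if "closed P" "\<And>n f. (\<And>k. f k \<in> H) \<Longrightarrow> (Zsum n f, Zsum n (\<lambda>k. A (f k))) \<in> P" for P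
  proof -
    have "G0 \<subseteq> P"
      unfolding G0_def by (safe, rule that(2)) blast
    then show ?thesis
      unfolding G_def by (rule closure_minimal[OF _ that(1)])
  qed
  have bd: "norm y \<le> c * norm x" if "(x, y) \<in> G" for x y
  proof -
    have "G \<subseteq> {p. norm (snd p) \<le> c * norm (fst p)}"
      by (intro GP closed_Collect_le continuous_intros)
        (use norm_Zsum_le[OF A AS less_imp_le[OF c(1)]] c(2) in auto)
    then show ?thesis using that by auto
  qed
  obtain B where B: "closed_csubspace (fst ` G)" "B \<in> bops (fst ` G) (snd ` G)"
    "\<And>x. x \<in> fst ` G \<Longrightarrow> (x, B x) \<in> G" "\<And>x y. (x, y) \<in> G \<Longrightarrow> B x = y"
    by (rule graph_bops[OF G less_imp_le[OF c(1)] bd]) auto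
  have GK: "G \<subseteq> K \<times> K"
    by (intro GP closed_Times ccs_closed[OF closed_K])
      (auto intro!: Zsum_in bops_in[OF Ab])
  have "Zspace \<subseteq> fst ` G"
    by (rule Zspace_induct_closed[OF ccs_closed[OF B(1)]]) (use G0G in force)
  then have dom: "fst ` G = K"
    using GK Z by auto
  have Bb: "B \<in> bops K K"
    using bops_mono[OF B(2) subset_refl, of K] B(3) GK unfolding dom by blast
  have BZ: "B (Zsum n f) = Zsum n (\<lambda>k. A (f k))" if "\<And>k. f k \<in> H" for n f
    by (intro B(4) G0G that)
  have clo: "K \<subseteq> M" if "closed M" "\<And>n f. (\<And>k. f k \<in> H) \<Longrightarrow> Zsum n f \<in> M" for M
    using Zspace_induct_closed[OF that] Z by simp
  show ?thesis
  proof
    show "B (j h) = j (A h)" if h: "h \<in> H" for h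
      using BZ[of "\<lambda>_. h" 1] h by (simp add: Zsum_def)
    show "N (B x) = B (N x)" if "x \<in> K" for x
    proof -
      have "K \<subseteq> {x \<in> K. N (B x) = B (N x)}"
      proof (rule clo)
        show "closed {x \<in> K. N (B x) = B (N x)}"
          by (rule ccs_closed[OF closed_csubspace_bops_eq[OF closed_K
                bops_comp[OF Bb N_bops] bops_comp[OF N_bops Bb]]])
        show "Zsum n f \<in> {x \<in> K. N (B x) = B (N x)}" if f: "\<And>k. f k \<in> H" for n f
          using f by (simp add: Zsum_in BZ N_Zsum bops_in[OF Ab] S_in AS)
      qed
      then show ?thesis using that by auto
    qed
    show "positive_op K B"
    proof (rule positive_opI[OF Bb])
      have 1: "cinner (B (Zsum n f)) (Zsum m g) = cinner (Zsum n f) (B (Zsum m g))"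
        if f: "\<And>k. f k \<in> H" and g: "\<And>k. g k \<in> H" for n f m g
      proof -
        \<comment> \<open>Moving an operator between the arguments requires two sums of the same
          length.\<close>
        define f' where "f' k = (if k < n then f k else 0)" for k
        define g' where "g' k = (if k < m then g k else 0)" for k
        have f': "\<And>k. f' k \<in> H" "Zsum n f = Zsum (max n m) f'"
          and g': "\<And>k. g' k \<in> H" "Zsum m g = Zsum (max n m) g'"
          using Zsum_pad[of n "max n m" f] Zsum_pad[of m "max n m" g] f g csubspace_0[OF csub_H]
          by (auto simp: f'_def[abs_def] g'_def[abs_def])
        show ?thesis
          unfolding f'(2) g'(2) using f'(1) g'(1) by (simp add: BZ cinner_Zsum_move[OF Ab sa AS])
      qed
      \<comment> \<open>Density is applied to one argument at a time, here to the first and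
        afterwards to the second.\<close>
      have 2: "cinner (B x) (Zsum m g) = cinner x (B (Zsum m g))"
        if x: "x \<in> K" and g: "\<And>k. g k \<in> H" for x m g
      proof -
        have "continuous_on K (\<lambda>x. cinner (B x) (Zsum m g) - cinner x (B (Zsum m g)))"
          by (intro continuous_intros bops_continuous[OF csub_K Bb])
        then have "K \<subseteq> {x \<in> K. cinner (B x) (Zsum m g) - cinner x (B (Zsum m g)) = 0}"
          by (rule clo[OF continuous_closed_preimage_constant[OF _ ccs_closed[OF closed_K]]])
            (simp add: Zsum_in 1 g)
        then show ?thesis using x by auto
      qed
      show "cinner (B x) y = cinner x (B y)" if x: "x \<in> K" and y: "y \<in> K" for x y
      proof -
        have "continuous_on K (\<lambda>y. cinner (B x) y - cinner x (B y))"
          by (intro continuous_intros bops_continuous[OF csub_K Bb])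
        then have "K \<subseteq> {y \<in> K. cinner (B x) y - cinner x (B y) = 0}"
          by (rule clo[OF continuous_closed_preimage_constant[OF _ ccs_closed[OF closed_K]]])
            (simp add: Zsum_in 2 x)
        then show ?thesis using y by auto
      qed
      show "0 \<le> Re (cinner (B x) x)" if x: "x \<in> K" for x
      proof -
        have c: "continuous_on K (\<lambda>x. Re (cinner (B x) x))"
          by (intro continuous_intros bops_continuous[OF csub_K Bb])
        have "K \<subseteq> {x \<in> K. Re (cinner (B x) x) \<in> {0..}}"
        proof (rule clo)
          show "closed {x \<in> K. Re (cinner (B x) x) \<in> {0..}}"
            using continuous_closed_preimage[OF c ccs_closed[OF closed_K], of "{0..}"]
            by (simp add: vimage_def Int_def)
          show "Zsum n f \<in> {x \<in> K. Re (cinner (B x) x) \<in> {0..}}" if f: "\<And>k. f k \<in> H" for n f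
            using f cinner_Zsum_nonneg[OF A _ f] AS by (simp add: Zsum_in BZ)
        qed
        then show ?thesis using x by auto
      qed
    qed
  qed
qed

end

section \<open>Entrywise form of the Brownian-type conditions\<close>

lemma brownian_normal_extension_iff:
  fixes H1 :: "'a::chilbert set" and H2 :: "'b::chilbert set"
    and K1 :: "'c::chilbert set" and K2 :: "'d::chilbert set"
  assumes H1: "closed_csubspace H1" and H2: "closed_csubspace H2"
    and V: "V \<in> bops H1 H1" and E: "E \<in> bops H2 H1" and S: "S \<in> bops H2 H2"
  shows "brownian_normal_extension H1 H2 V E S K1 K2 j1 j2 V' E' N \<longleftrightarrow>
    closed_csubspace K1 \<and> K1 \<noteq> {0} \<and> K2 \<noteq> {0} \<and> normal_extension H2 S K2 j2 N \<and>
    isometric H1 K1 j1 \<and> isometric K1 K1 V' \<and> E' \<in> bops K2 K1 \<and>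
    (\<forall>x\<in>K1. \<forall>y\<in>K2. cinner (V' x) (E' y) = 0) \<and>
    (\<forall>y\<in>K2. N (adj K2 K1 E' (E' y)) = adj K2 K1 E' (E' (N y))) \<and>
    (\<forall>x\<in>H1. j1 (V x) = V' (j1 x)) \<and> (\<forall>y\<in>H2. j1 (E y) = E' (j2 y)) \<and>
    op_extends H2 j2 (abs_op H2 H1 E) (abs_op K2 K1 E')"
    (is "?L \<longleftrightarrow> ?R")
proof -
  note cs1 = ccs_csubspace[OF H1] and cs2 = ccs_csubspace[OF H2]
  note ent = entries_op_matrix[of V E S, OF bops_0[OF cs1 V] bops_0[OF cs2 E] bops_0[OF cs2 S]]
  have *: "?L \<longleftrightarrow> ?R" if c: "closed_csubspace K1" "closed_csubspace K2" "isometric H1 K1 j1" "isometric H2 K2 j2"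
    "V' \<in> bops K1 K1" "E' \<in> bops K2 K1" "N \<in> bops K2 K2"
  proof -
    note kcs = ccs_csubspace[OF c(1)] ccs_csubspace[OF c(2)]
    note ent' = entries_op_matrix[of V' E' N, OF bops_0[OF kcs(1) c(5)] bops_0[OF kcs(2) c(6)] bops_0[OF kcs(2) c(7)]]
    have m: "matrix_extends H1 H2 j1 j2 (op_matrix V E (\<lambda>_. 0) S) (op_matrix V' E' (\<lambda>_. 0) N) \<longleftrightarrow>
      (\<forall>x\<in>H1. j1 (V x) = V' (j1 x)) \<and> (\<forall>y\<in>H2. j1 (E y) = E' (j2 y)) \<and> (\<forall>y\<in>H2. j2 (S y) = N (j2 y))"
      using bops_0[OF cs2 isometric_bops[OF c(4)]] by (auto simp: matrix_extends_def ent ent')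
    show ?thesis
    \<comment> \<open>If one of the spaces is zero, both sides are false, since Brownian type
      requires nonzero summands.\<close>
    proof (cases "K1 = {0} \<or> K2 = {0}")
      case True
      then show ?thesis
        by (auto simp: brownian_normal_extension_def brownian_normal_def brownian_type_def)
    next
      case False
      then have "op_matrix V' E' (\<lambda>_. 0) N \<in> brownian_normal K1 K2 \<longleftrightarrow>
        (isometric K1 K1 V' \<and> (\<forall>x\<in>K1. \<forall>y\<in>K2. cinner (V' x) (E' y) = 0) \<and>
        (\<forall>y\<in>K2. N (adj K2 K1 E' (E' y)) = adj K2 K1 E' (E' (N y)))) \<and> normal_op K2 N"
        using op_matrix_brownian_iff[OF c(1) _ c(2) _ c(5-7)] by (simp add: brownian_normal_def ent')
      then show ?thesis
        unfolding brownian_normal_extension_def m normal_extension_def op_extends_def[of H2 j2 S]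
        using c False by blast
    qed
  qed
  show ?thesis
  proof
    assume ?L
    then show ?R
      using * by (simp add: brownian_normal_extension_def)
  next
    assume ?R
    then show ?L
      using * by (simp add: normal_extension_def normal_op_def isometric_bops)
  qed
qed

lemma op_matrix_brownian_subnormal_iff:
  fixes H1 :: "'a::chilbert set" and H2 :: "'b::chilbert set"
  assumes H1: "closed_csubspace H1" "H1 \<noteq> {0}" and H2: "closed_csubspace H2" "H2 \<noteq> {0}"
    and V: "V \<in> bops H1 H1" and E: "E \<in> bops H2 H1" and S: "S \<in> bops H2 H2"
  shows "op_matrix V E (\<lambda>_. 0) S \<in> brownian_subnormal H1 H2 \<longleftrightarrow>
    isometric H1 H1 V \<and> (\<forall>x\<in>H1. \<forall>y\<in>H2. cinner (V x) (E y) = 0) \<and>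
    (\<forall>y\<in>H2. S (adj H2 H1 E (E y)) = adj H2 H1 E (E (S y))) \<and> subnormal H2 S"
proof -
  note cs1 = ccs_csubspace[OF H1(1)] and cs2 = ccs_csubspace[OF H2(1)]
  note ent = entries_op_matrix[of V E S, OF bops_0[OF cs1 V] bops_0[OF cs2 E] bops_0[OF cs2 S]]
  show ?thesis
    using op_matrix_brownian_iff[OF assms] by (auto simp: brownian_subnormal_def ent)
qed

section \<open>The modulus of a given extension as a lift, and the properties it transfers\<close>

context normal_ext
begin

lemma Na_commute_positive:
  assumes B: "positive_op K B" and NB: "\<And>x. x \<in> K \<Longrightarrow> N (B x) = B (N x)" and x: "x \<in> K"
  shows "Na (B x) = B (Na x)"
proof (rule cinner_ext[OF _ _ csub_K])
  note Bin = bops_in[OF positive_op_bops[OF B]] and sa = positive_op_selfadjoint[OF csub_K B]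
  show "Na (B x) \<in> K" "B (Na x) \<in> K"
    by (intro Na_in Bin x)+
  fix h assume h: "h \<in> K"
  have "cinner h (Na (B x)) = cinner (B (N h)) x"
    using h x by (simp add: cinner_N[symmetric] sa Bin N_in)
  also have "\<dots> = cinner h (B (Na x))"
    using h x by (simp add: NB[symmetric] cinner_N Bin Na_in sa)
  finally show "cinner h (Na (B x)) = cinner h (B (Na x))" .
qed

context
  fixes H1 :: "'c::chilbert set" and K1 :: "'d::chilbert set" and E :: "'a \<Rightarrow> 'c" and E' :: "'b \<Rightarrow> 'd"
  assumes E: "E \<in> bops H H1" and E': "E' \<in> bops K K1"
    and comm: "\<And>x. x \<in> K \<Longrightarrow> N (adj K K1 E' (E' x)) = adj K K1 E' (E' (N x))"
    and abs_ext: "op_extends H j (abs_op H H1 E) (abs_op K K1 E')"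
begin

interpretation A: hilbert_op H H1 E
  by unfold_locales (rule closed_H, rule E)

interpretation B: hilbert_op K K1 E'
  by unfold_locales (rule closed_K, rule E')

private abbreviation (input) "A \<equiv> abs_op H H1 E"
private abbreviation (input) "B \<equiv> abs_op K K1 E'"

lemmas A_in = bops_in[OF A.abs_op_bops] and B_in = bops_in[OF B.abs_op_bops]

lemma B_j: "h \<in> H \<Longrightarrow> B (j h) = j (A h)"
  using abs_ext by (simp add: op_extends_def)

lemma N_B: "x \<in> K \<Longrightarrow> N (B x) = B (N x)"
  by (rule B.abs_op_commute[OF N_bops comm])

lemma Na_B: "x \<in> K \<Longrightarrow> Na (B x) = B (Na x)"
  by (rule Na_commute_positive[OF B.abs_op_positive N_B])

text \<open>On the image of \<open>H\<close> one has j S A = N B j = B N j = j A S, and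
  \<open>j\<close> is injective.\<close>

lemma S_A: "x \<in> H \<Longrightarrow> S (A x) = A (S x)"
proof (rule inj_onD[OF isometric_inj_on[OF csub_H iso_j]])
  assume x: "x \<in> H"
  show "j (S (A x)) = j (A (S x))"
    using x by (simp add: j_S B_j[symmetric] A_in S_in N_B j_in)
qed (auto intro: A_in S_in)

lemma adjoint_intertwines:
  assumes x: "x \<in> H"
  shows "A (adj H H S x) = adj H H S (A x)"
proof (rule cinner_ext[OF _ _ csub_H])
  note adjS = adj_in[OF closed_H S_bops] cinner_adj[OF closed_H S_bops]
  show "A (adj H H S x) \<in> H" "adj H H S (A x) \<in> H"
    by (intro A_in adjS)+
  fix h assume h: "h \<in> H"
  have "cinner h (A (adj H H S x)) = cinner (S (A h)) x"
    using h x by (simp add: A.abs_op_selfadjoint[symmetric] adjS A_in)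
  also have "\<dots> = cinner h (adj H H S (A x))"
    using h x by (simp add: S_A A.abs_op_selfadjoint S_in adjS(2)[symmetric])
  finally show "cinner h (A (adj H H S x)) = cinner h (adj H H S (A x))" .
qed

lemma closed_jH: "closed_csubspace (j ` H)"
  by (rule closed_csubspace_isometric_image[OF closed_H iso_j])

lemma B_jH: "x \<in> j ` H \<Longrightarrow> B x \<in> j ` H"
  by (auto simp: B_j intro: A_in)

text \<open>The image of \<open>H\<close> is invariant under the self-adjoint operator B, hence
  reduces it.\<close>

lemma B_proj:
  assumes x: "x \<in> K"
  shows "B (ortho_proj (j ` H) x) = ortho_proj (j ` H) (B x)"
proof (rule ortho_proj_unique[OF closed_jH, symmetric])
  let ?P = "ortho_proj (j ` H)"
  have jHK: "j ` H \<subseteq> K"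
    using j_in by auto
  have P: "?P x \<in> j ` H"
    by (rule ortho_proj_in[OF closed_jH])
  have PK: "?P x \<in> K"
    using P jHK by auto
  show "B (?P x) \<in> j ` H"
    by (rule B_jH[OF P])
  show "cinner (B x - B (?P x)) z = 0" if z: "z \<in> j ` H" for z
  proof -
    have "cinner (B x - B (?P x)) z = cinner (B (x - ?P x)) z"
      by (simp add: bops_diff[OF csub_K B.abs_op_bops x PK])
    also have "\<dots> = cinner (x - ?P x) (B z)"
      using z jHK by (intro B.abs_op_selfadjoint csubspace_diff[OF csub_K] x PK) auto
    also have "\<dots> = 0"
      by (rule cinner_ortho_proj[OF closed_jH B_jH[OF z]])
    finally show ?thesis .
  qed
qed

lemma is_lift_abs_op: "is_lift H S K j N A B"
  unfolding is_lift_def commutant_def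
proof (intro conjI IntI CollectI ballI)
  show "A (B' x) = B' (A x)" if "B' \<in> {S, adj H H S}" "x \<in> H" for B' x
    using that S_A adjoint_intertwines by auto
  show "B (C x) = C (B x)" if "C \<in> {N}" "x \<in> K" for C x
    using that N_B by auto
  show "B (C x) = C (B x)" if "C \<in> {ortho_proj (j ` H)}" "x \<in> K" for C x
    using that B_proj by auto
qed (fact A.abs_op_bops B.abs_op_bops abs_ext)+

lemma norm_E_j: "h \<in> H \<Longrightarrow> norm (E' (j h)) = norm (E h)"
  using B.norm_abs_op[OF j_in] A.norm_abs_op isometric_norm[OF iso_j A_in]
  by (metis B_j)

lemma B_Zsum: "(\<And>k. f k \<in> H) \<Longrightarrow> B (Zsum n f) = Zsum n (\<lambda>k. A (f k))"
proof -
  assume f: "\<And>k. f k \<in> H"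
  have "B ((Na ^^ k) (j h)) = (Na ^^ k) (j (A h))" if "h \<in> H" for k h
    using funpow_commute_on[OF Na_bops B.abs_op_bops Na_B[symmetric] j_in[OF that]] that
    by (simp add: B_j)
  then show ?thesis
    unfolding Zsum_def using f by (simp add: bops_sum[OF csub_K B.abs_op_bops] Napow_in j_in)
qed

text \<open>E is isometric exactly when |E| is the identity. The fixed vectors of |E'| then form a
  closed subspace that contains the image of \<open>H\<close> and is invariant under N*, so by
  minimality all vectors are fixed.\<close>

lemma isometric_lift:
  assumes Z: "Zspace = K"
  shows "isometric H H1 E \<longleftrightarrow> isometric K K1 E'"
proof
  assume i: "isometric H H1 E"
  have A1: "A h = h" if "h \<in> H" for h
  proof (rule A.abs_op_unique[OF _ _ that])
    show "positive_op H (\<lambda>x. x)"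
      by (rule positive_opI[OF bops_id]) (auto simp: cinner_self)
  qed (use i in \<open>simp add: isometric_def\<close>)
  have "Zspace \<subseteq> {x \<in> K. B x = x}"
  proof (rule Zspace_subset[OF closed_csubspace_bops_eq[OF closed_K B.abs_op_bops bops_id]])
    show "j ` H \<subseteq> {x \<in> K. B x = x}"
      using B_j A1 j_in by auto
    show "Na x \<in> {x \<in> K. B x = x}" if "x \<in> {x \<in> K. B x = x}" for x
      using that Na_B[of x] Na_in by auto
  qed
  then have "norm (E' x) = norm x" if "x \<in> K" for x
    using that Z B.norm_abs_op[OF that] by auto
  then show "isometric K K1 E'"
    using E' by (simp add: isometric_def)
next
  assume i: "isometric K K1 E'"
  have "norm (E h) = norm h" if "h \<in> H" for h
    using norm_E_j[OF that] isometric_norm[OF i j_in[OF that]] isometric_norm[OF iso_j that] by simp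
  then show "isometric H H1 E"
    using E by (simp add: isometric_def)
qed

text \<open>The same constant serves on both sides. It passes up to the dense sums by
  \<open>norm_Zsum_ge\<close> and from them to \<open>K\<close> by continuity, and it passes down
  because norms agree along \<open>j\<close>.\<close>

lemma left_invertible_lift:
  assumes Z: "Zspace = K" and H1: "closed_csubspace H1" and K1: "closed_csubspace K1"
  shows "left_invertible H H1 E \<longleftrightarrow> left_invertible K K1 E'"
  unfolding A.left_invertible_iff[OF H1] B.left_invertible_iff[OF K1]
proof (intro iff_exI conj_cong refl iffI ballI)
  fix c :: real assume c: "c > 0"
  {
    fix x assume a: "\<forall>h\<in>H. c * norm h \<le> norm (E h)" and x: "x \<in> K"
    have "continuous_on K (\<lambda>x. norm (B x) - c * norm x)"
      by (intro continuous_intros bops_continuous[OF csub_K B.abs_op_bops])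
    then have "closed {x \<in> K. norm (B x) - c * norm x \<in> {0..}}"
      using continuous_closed_preimage[OF _ ccs_closed[OF closed_K],
          of "\<lambda>x. norm (B x) - c * norm x" "{0..}"]
      by (simp add: vimage_def Int_def)
    then have "Zspace \<subseteq> {x \<in> K. norm (B x) - c * norm x \<in> {0..}}"
    proof (rule Zspace_induct_closed)
      fix n and f :: "nat \<Rightarrow> 'a" assume f: "\<And>k. f k \<in> H"
      have "c * norm (Zsum n f) \<le> norm (Zsum n (\<lambda>k. A (f k)))"
        by (rule norm_Zsum_ge[OF A.abs_op_positive S_A[symmetric] _ f])
          (use c a A.norm_abs_op in auto)
      then show "Zsum n f \<in> {x \<in> K. norm (B x) - c * norm x \<in> {0..}}"
        using f by (simp add: Zsum_in B_Zsum)
    qed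
    then show "c * norm x \<le> norm (E' x)"
      using x Z B.norm_abs_op[OF x] by auto
  next
    fix h assume "\<forall>x\<in>K. c * norm x \<le> norm (E' x)" and h: "h \<in> H"
    then show "c * norm h \<le> norm (E h)"
      using norm_E_j[OF h] isometric_norm[OF iso_j h] j_in[OF h] by metis
  }
qed

text \<open>Injectivity comes without a quantitative bound, so it does not pass from the dense sums
  to their closure. Instead the complement of the kernel of B = |E'| is shown to be all of
  \<open>K\<close>. It is invariant under N* because N preserves the kernel. It contains the image
  of \<open>H\<close> because B commutes with the projection P onto that image: if B z = 0 then B P
  z = 0, and injectivity of E gives P z = 0.\<close>

lemma inj_on_lift:
  assumes Z: "Zspace = K"
  shows "inj_on E H \<longleftrightarrow> inj_on E' K"
  unfolding bops_inj_on_iff[OF csub_H E] bops_inj_on_iff[OF csub_K E']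
proof
  have B0: "E' x = 0 \<longleftrightarrow> B x = 0" if "x \<in> K" for x
    using B.norm_abs_op[OF that] by (metis norm_eq_zero)
  assume a: "\<forall>h\<in>H. E h = 0 \<longrightarrow> h = 0"
  let ?M = "K \<ominus>\<^sub>H {x \<in> K. B x = 0}"
  have "Zspace \<subseteq> ?M"
  proof (rule Zspace_subset[OF closed_csubspace_ominus[OF closed_K]])
    show "j ` H \<subseteq> ?M"
    proof
      fix y assume y: "y \<in> j ` H"
      have "cinner y z = 0" if z: "z \<in> K" "B z = 0" for z
      proof -
        obtain h where h: "h \<in> H" "ortho_proj (j ` H) z = j h"
          using ortho_proj_in[OF closed_jH, of z] by auto
        have "B (j h) = ortho_proj (j ` H) 0"
          using B_proj[OF z(1)] z(2) h(2) by simp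
        then have "B (j h) = 0"
          using ortho_proj_id[OF closed_jH ccs_0[OF closed_jH]] by simp
        then have "E h = 0"
          using norm_E_j[OF h(1)] B0[OF j_in[OF h(1)]] by simp
        then have "ortho_proj (j ` H) z = 0"
          using a h bops_0[OF csub_H j_bops] by auto
        then show ?thesis
          using cinner_ortho_proj[OF closed_jH y, of z] cinner_eq_0_commute[of y z] by simp
      qed
      then show "y \<in> ?M"
        using y j_in by (auto simp: ominus_def)
    qed
    show "Na x \<in> ?M" if x: "x \<in> ?M" for x
    proof -
      have "cinner (Na x) z = 0" if z: "z \<in> K" "B z = 0" for z
      proof -
        have "B (N z) = 0"
          using N_B[OF z(1)] z(2) bops_0[OF csub_K N_bops] by simp
        then show ?thesis
          using x z(1) N_in[OF z(1)] cinner_N'[OF z(1), of x] by (simp add: ominus_def)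
      qed
      then show ?thesis
        using x Na_in by (auto simp: ominus_def)
    qed
  qed
  show "\<forall>x\<in>K. E' x = 0 \<longrightarrow> x = 0"
  proof (intro ballI impI)
    fix x assume x: "x \<in> K" "E' x = 0"
    then have "x \<in> ?M" using \<open>Zspace \<subseteq> ?M\<close> Z by auto
    then have "cinner x x = 0" using x B0 by (simp add: ominus_def)
    then show "x = 0" by simp
  qed
next
  assume a: "\<forall>x\<in>K. E' x = 0 \<longrightarrow> x = 0"
  show "\<forall>h\<in>H. E h = 0 \<longrightarrow> h = 0"
  proof (intro ballI impI)
    fix h assume h: "h \<in> H" "E h = 0"
    then have "j h = 0"
      using a j_in norm_E_j by (metis norm_zero norm_eq_zero)
    then show "h = 0"
      using isometric_norm[OF iso_j h(1)] by simp
  qed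
qed

lemma adj_comp_commute:
  assumes h: "h \<in> H"
  shows "S (adj H H1 E (E h)) = adj H H1 E (E (S h))"
  using h by (simp add: A.abs_op_square[symmetric] S_A A_in S_in)

end

end

text \<open>Isometry and orthogonality restrict along \<open>j1\<close> and \<open>j2\<close>.
  Commutation of S with E* E uses the inclusion of |E| in |E'|: it turns commutation of N with |E'|
  into commutation of S with |E|.\<close>

lemma brownian_subnormal_of_extension:
  fixes H1 :: "'a::chilbert set" and H2 K2 :: "'b::chilbert set" and K1 :: "'c::chilbert set"
  assumes H1: "closed_csubspace H1" "H1 \<noteq> {0}" and H2: "closed_csubspace H2" "H2 \<noteq> {0}"
    and V: "V \<in> bops H1 H1" and E: "E \<in> bops H2 H1" and S: "S \<in> bops H2 H2"
    and ext: "brownian_normal_extension H1 H2 V E S K1 K2 j1 j2 V' E' N"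
  shows "op_matrix V E (\<lambda>_. 0) S \<in> brownian_subnormal H1 H2"
proof -
  note e = ext[unfolded brownian_normal_extension_iff[OF H1(1) H2(1) V E S]]
  interpret normal_ext H2 S K2 j2 N
    by unfold_locales (use H2 S e in auto)
  have j1: "isometric H1 K1 j1" and V': "isometric K1 K1 V'" and E': "E' \<in> bops K2 K1"
    and j1V: "\<And>x. x \<in> H1 \<Longrightarrow> j1 (V x) = V' (j1 x)" and j1E: "\<And>y. y \<in> H2 \<Longrightarrow> j1 (E y) = E' (j2 y)"
    and V'E': "\<And>x y. x \<in> K1 \<Longrightarrow> y \<in> K2 \<Longrightarrow> cinner (V' x) (E' y) = 0"
    using e by auto
  note cs1 = ccs_csubspace[OF H1(1)]
  note j1_in = bops_in[OF isometric_bops[OF j1]]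
  have "norm (V x) = norm x" if x: "x \<in> H1" for x
    using isometric_norm[OF j1 bops_in[OF V x]] isometric_norm[OF j1 x]
      isometric_norm[OF V' j1_in[OF x]] j1V[OF x] by simp
  then have "isometric H1 H1 V"
    using V by (simp add: isometric_def)
  moreover have "cinner (V x) (E y) = 0" if "x \<in> H1" "y \<in> H2" for x y
    using isometric_cinner[OF cs1 j1 bops_in[OF V that(1)] bops_in[OF E that(2)]]
      V'E'[OF j1_in[OF that(1)] j_in[OF that(2)]] j1V[OF that(1)] j1E[OF that(2)] by simp
  moreover have "S (adj H2 H1 E (E y)) = adj H2 H1 E (E (S y))" if "y \<in> H2" for y
    by (rule adj_comp_commute[OF E, of E' K1]) (use e that in auto)
  moreover have "subnormal H2 S"
    unfolding subnormal_def using S normal_ext_axioms normal_ext.ext by blast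
  ultimately show ?thesis
    using op_matrix_brownian_subnormal_iff[OF H1 H2 V E S] by blast
qed

lemma minimal_normal_extension_exists:
  fixes H :: "'a::chilbert set"
  assumes "closed_csubspace H" "subnormal H S"
  obtains K :: "'a set" and j N where "minimal_normal_extension H S K j N"
proof -
  obtain K :: "'a set" and j N where "normal_extension H S K j N" and S: "S \<in> bops H H"
    using assms(2) by (auto simp: subnormal_def)
  then interpret normal_ext H S K j N
    by unfold_locales (use assms in auto)
  show ?thesis
    by (rule that[OF minimal_Zspace])
qed

section \<open>Orthonormal bases\<close>

definition orthonormal :: "'a::complex_inner set \<Rightarrow> bool" where
  "orthonormal B \<longleftrightarrow> (\<forall>x\<in>B. \<forall>y\<in>B. cinner x y = (if x = y then 1 else 0))"

lemma orthonormal_basis_alt: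
  "orthonormal_basis H B \<longleftrightarrow> B \<subseteq> H \<and> orthonormal B \<and> closed_cspan B = H"
  by (simp add: orthonormal_basis_def orthonormal_def)

lemma orthonormal_subset: "orthonormal B \<Longrightarrow> C \<subseteq> B \<Longrightarrow> orthonormal C"
  unfolding orthonormal_def by blast

lemma orthonormal_norm: "orthonormal B \<Longrightarrow> b \<in> B \<Longrightarrow> norm b = 1"
proof -
  assume "orthonormal B" "b \<in> B"
  then have "complex_of_real ((norm b)\<^sup>2) = 1"
    unfolding cinner_self[symmetric] by (simp add: orthonormal_def)
  then show "norm b = 1"
    by (simp only: of_real_eq_1_iff power2_eq_1_iff) (use norm_ge_zero[of b] in linarith)
qed

lemma orthonormal_basis_total:
  assumes "orthonormal_basis H B" "x \<in> H" "\<And>b. b \<in> B \<Longrightarrow> cinner x b = 0"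
  shows "x = 0"
proof -
  have "cinner x x = 0"
    by (rule cinner_closed_cspan_zero[of B]) (use assms in \<open>auto simp: orthonormal_basis_alt\<close>)
  then show ?thesis by simp
qed

lemma orthonormal_basisI:
  fixes H :: "'a::chilbert set"
  assumes "closed_csubspace H" "B \<subseteq> H" "orthonormal B"
    "\<And>x. x \<in> H \<Longrightarrow> (\<And>b. b \<in> B \<Longrightarrow> cinner x b = 0) \<Longrightarrow> x = 0"
  shows "orthonormal_basis H B"
proof -
  have "closed_cspan B = H"
    by (rule ominus_eq_zero_imp[OF closed_csubspace_closed_cspan assms(1) closed_cspan_minimal[OF assms(1,2)]])
      (use assms(4) closed_cspan_superset in blast)
  then show ?thesis
    using assms by (simp add: orthonormal_basis_alt)
qed

lemma orthonormal_basis_subspace: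
  assumes "orthonormal_basis H B" "closed_csubspace M" "B \<subseteq> M"
  shows "H \<subseteq> M"
  using closed_cspan_minimal[OF assms(2,3)] assms(1) by (simp add: orthonormal_basis_alt)

lemma orthonormal_basis_extend:
  fixes H :: "'a::chilbert set"
  assumes H: "closed_csubspace H" and Y: "Y \<subseteq> H" "orthonormal Y"
  obtains B where "Y \<subseteq> B" "orthonormal_basis H B"
proof -
  let ?F = "{B. Y \<subseteq> B \<and> B \<subseteq> H \<and> orthonormal B}"
  have "\<exists>M\<in>?F. \<forall>X\<in>?F. M \<subseteq> X \<longrightarrow> X = M"
  proof (rule subset_Zorn_nonempty)
    show "?F \<noteq> {}" using Y by blast
    fix C assume C: "C \<noteq> {}" "subset.chain ?F C"
    then have sub: "C \<subseteq> ?F" and ch: "\<And>A B. A \<in> C \<Longrightarrow> B \<in> C \<Longrightarrow> A \<subseteq> B \<or> B \<subseteq> A"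
      unfolding subset_chain_def by blast+
    have "orthonormal (\<Union>C)"
      unfolding orthonormal_def
    proof (intro ballI)
      fix x y assume "x \<in> \<Union>C" "y \<in> \<Union>C"
      then obtain A B where AB: "A \<in> C" "B \<in> C" "x \<in> A" "y \<in> B" by blast
      then have "\<exists>D\<in>C. x \<in> D \<and> y \<in> D"
        using ch[OF AB(1,2)] by blast
      then show "cinner x y = (if x = y then 1 else 0)"
        using sub unfolding orthonormal_def by blast
    qed
    then show "\<Union>C \<in> ?F"
      using C(1) sub by blast
  qed
  then obtain B where BF: "B \<in> ?F" and max': "\<forall>X\<in>?F. B \<subseteq> X \<longrightarrow> X = B"
    by (rule bexE)
  then have B: "Y \<subseteq> B" "B \<subseteq> H" "orthonormal B"
    by auto
  have max: "X = B" if "Y \<subseteq> X" "X \<subseteq> H" "orthonormal X" "B \<subseteq> X" for X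
    using max' that by simp
  have "orthonormal_basis H B"
  proof (rule orthonormal_basisI[OF H B(2,3)])
    fix x assume x: "x \<in> H" "\<And>b. b \<in> B \<Longrightarrow> cinner x b = 0"
    show "x = 0"
    proof (rule ccontr)
      assume nz: "x \<noteq> 0"
      define u where "u = (1 / norm x) *\<^sub>R x"
      have uu: "cinner u u = 1"
        using nz by (simp add: u_def cinner_self power2_eq_square)
      have ub: "cinner u b = 0" "cinner b u = 0" if "b \<in> B" for b
        using x(2)[OF that] cinner_eq_0_commute[of x b] by (simp_all add: u_def)
      have "u \<notin> B"
        using ub uu by force
      moreover have "orthonormal (insert u B)"
        using B(3) uu ub \<open>u \<notin> B\<close> by (auto simp: orthonormal_def)
      then have "insert u B = B"
        by (rule max[rotated 2]) (use B x ccs_scaleR[OF H] in \<open>auto simp: u_def\<close>)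
      ultimately show False by blast
    qed
  qed
  then show ?thesis
    using B(1) that by blast
qed

lemma orthonormal_basis_exists:
  fixes H :: "'a::chilbert set"
  assumes "closed_csubspace H"
  obtains B where "orthonormal_basis H B"
  by (rule orthonormal_basis_extend[OF assms, of "{}"]) (auto simp: orthonormal_def)

text \<open>Pythagoras for v and its Fourier sum. Dropping the first square gives Bessel's
  inequality; for a finite basis that square is zero.\<close>

lemma orthonormal_expansion:
  assumes F: "finite F" "orthonormal F"
  defines "s \<equiv> \<lambda>v. \<Sum>y\<in>F. cinner v y *\<^sub>C y"
  shows "y \<in> F \<Longrightarrow> cinner (v - s v) y = 0"
    and "(norm v)\<^sup>2 = (norm (v - s v))\<^sup>2 + (\<Sum>y\<in>F. (cmod (cinner v y))\<^sup>2)"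
proof -
  have 1: "cinner (s v) y = cinner v y" if "y \<in> F" for y
  proof -
    have "cinner (s v) y = (\<Sum>x\<in>F. if x = y then cinner v x else 0)"
      unfolding s_def cinner_sum_left
      by (intro sum.cong) (use F(2) that in \<open>auto simp: orthonormal_def\<close>)
    then show ?thesis using F(1) that by simp
  qed
  then show 2: "cinner (v - s v) y = 0" if "y \<in> F" for y
    using that by (simp add: cinner_diff_left)
  have "cinner (v - s v) (s v) = 0"
    by (subst (2) s_def) (simp add: cinner_sum_right 2)
  then have "(norm v)\<^sup>2 = (norm (v - s v))\<^sup>2 + (norm (s v))\<^sup>2"
    using norm_add_cinner[of "v - s v" "s v"] by simp
  moreover have "complex_of_real ((norm (s v))\<^sup>2) = complex_of_real (\<Sum>y\<in>F. (cmod (cinner v y))\<^sup>2)"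
  proof -
    have "complex_of_real ((norm (s v))\<^sup>2) = cinner (s v) (s v)"
      by (simp add: cinner_self)
    also have "\<dots> = (\<Sum>y\<in>F. cnj (cinner v y) * cinner v y)"
      by (subst (2) s_def) (simp add: cinner_sum_right 1)
    also have "\<dots> = complex_of_real (\<Sum>y\<in>F. (cmod (cinner v y))\<^sup>2)"
      unfolding of_real_sum by (intro sum.cong refl) (simp only: complex_norm_square mult.commute)
    finally show ?thesis .
  qed
  then have "(norm (s v))\<^sup>2 = (\<Sum>y\<in>F. (cmod (cinner v y))\<^sup>2)"
    by (simp only: of_real_eq_iff)
  ultimately show "(norm v)\<^sup>2 = (norm (v - s v))\<^sup>2 + (\<Sum>y\<in>F. (cmod (cinner v y))\<^sup>2)"
    by simp
qed

lemma parseval_finite: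
  assumes H: "csubspace H" and B: "orthonormal_basis H B" "finite B" and v: "v \<in> H"
  shows "(norm v)\<^sup>2 = (\<Sum>y\<in>B. (cmod (cinner v y))\<^sup>2)"
proof -
  have o: "orthonormal B" and BH: "B \<subseteq> H"
    using B(1) by (auto simp: orthonormal_basis_alt)
  note e = orthonormal_expansion[OF B(2) o]
  have "v - (\<Sum>y\<in>B. cinner v y *\<^sub>C y) = 0"
    by (rule orthonormal_basis_total[OF B(1)])
      (use e(1) v BH in \<open>auto intro!: csubspace_diff[OF H] csubspace_sum[OF H] csubspace_scaleC[OF H]\<close>)
  then show ?thesis
    using e(2)[of v] by simp
qed

section \<open>Cardinality of orthonormal sets\<close>

text \<open>Bessel's inequality bounds the number of \<open>y\<close> with \<open>\<bar>\<langle>v, y\<rangle>\<bar> > 1/n\<close>.\<close>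

lemma countable_cinner_nonzero:
  assumes Y: "orthonormal Y"
  shows "countable {y \<in> Y. cinner y v \<noteq> 0}"
proof -
  define D where "D n = {y \<in> Y. 1 / real (Suc n) < cmod (cinner v y)}" for n
  have "finite (D n)" for n
  proof (rule ccontr)
    assume "infinite (D n)"
    obtain m :: nat where m: "real m > (norm v)\<^sup>2 * (real (Suc n))\<^sup>2"
      using reals_Archimedean2 by blast
    obtain F where F: "F \<subseteq> D n" "card F = m" "finite F"
      using infinite_arbitrarily_large[OF \<open>infinite (D n)\<close>] by blast
    have "orthonormal F"
      using F(1) by (intro orthonormal_subset[OF Y]) (auto simp: D_def)
    then have "(\<Sum>y\<in>F. (cmod (cinner v y))\<^sup>2) \<le> (norm v)\<^sup>2"
      using orthonormal_expansion(2)[OF F(3), of v] by simp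
    moreover have "(\<Sum>y\<in>F. (1 / real (Suc n))\<^sup>2) \<le> (\<Sum>y\<in>F. (cmod (cinner v y))\<^sup>2)"
      using F(1) by (intro sum_mono power_mono) (auto simp: D_def intro: less_imp_le)
    ultimately have "real m * (1 / real (Suc n))\<^sup>2 \<le> (norm v)\<^sup>2"
      using F(2) by simp
    then have "real m \<le> (norm v)\<^sup>2 * (real (Suc n))\<^sup>2"
      by (simp add: power_divide field_simps)
    then show False using m by simp
  qed
  then have "countable (\<Union>n. D n)"
    by (intro countable_UN) (auto intro: countable_finite)
  moreover have "{y \<in> Y. cinner y v \<noteq> 0} \<subseteq> (\<Union>n. D n)"
  proof
    fix y assume y: "y \<in> {y \<in> Y. cinner y v \<noteq> 0}"
    then have "cinner v y \<noteq> 0"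
      using cinner_eq_0_commute[of y v] by simp
    then obtain n where "inverse (real (Suc n)) < cmod (cinner v y)"
      using reals_Archimedean[of "cmod (cinner v y)"] by auto
    then show "y \<in> (\<Union>n. D n)"
      using y by (auto simp: D_def inverse_eq_divide)
  qed
  ultimately show ?thesis
    by (rule countable_subset[rotated])
qed

text \<open>Every g is non-orthogonal to only countably many members of \<open>Y\<close>. Assigning
  to y one such g together with the number of y among the members that are non-orthogonal to this g
  is injective.\<close>

lemma orthonormal_lepoll:
  assumes Y: "orthonormal Y" and G: "\<And>y. y \<in> Y \<Longrightarrow> \<exists>g\<in>G. cinner y g \<noteq> 0"
  shows "Y \<lesssim> G \<times> (UNIV :: nat set)"
proof -
  define N where "N g = {y \<in> Y. cinner y g \<noteq> 0}" for g
  have N: "countable (N g)" for g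
    unfolding N_def by (rule countable_cinner_nonzero[OF Y])
  obtain g where g: "\<And>y. y \<in> Y \<Longrightarrow> g y \<in> G \<and> cinner y (g y) \<noteq> 0"
    using G by metis
  have "inj_on (\<lambda>y. (g y, to_nat_on (N (g y)) y)) Y"
  proof (rule inj_onI)
    fix x y assume xy: "x \<in> Y" "y \<in> Y"
      and "(g x, to_nat_on (N (g x)) x) = (g y, to_nat_on (N (g y)) y)"
    then have eq: "g x = g y" "to_nat_on (N (g y)) x = to_nat_on (N (g y)) y" by auto
    have "x \<in> N (g y)" "y \<in> N (g y)"
      using g[OF xy(1)] g[OF xy(2)] xy unfolding eq(1) by (auto simp: N_def)
    then show "x = y"
      using eq(2) inj_on_to_nat_on[OF N] by (meson inj_onD)
  qed
  then show ?thesis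
    unfolding lepoll_def using g by (intro exI[of _ "\<lambda>y. (g y, to_nat_on (N (g y)) y)"]) auto
qed

lemma infinite_times_lepoll:
  assumes "infinite X" "A \<lesssim> X" "B \<lesssim> X"
  shows "A \<times> B \<lesssim> X"
proof -
  have "X \<times> X \<approx> X"
    using card_of_Times_same_infinite[OF assms(1)] by (simp add: eqpoll_iff_card_of_ordIso)
  then show ?thesis
    using times_lepoll_mono[OF assms(2,3)] lepoll_trans2 by blast
qed

lemma infinite_Plus_eqpoll:
  assumes "infinite X" "A \<lesssim> X"
  shows "A <+> X \<approx> X" "X <+> A \<approx> X"
proof -
  have XX: "X <+> X \<approx> X"
    using card_of_Plus_infinite1[OF assms(1) card_of_mono1[OF subset_refl]]
    by (simp add: eqpoll_iff_card_of_ordIso)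
  have "A <+> X \<lesssim> X" "X <+> A \<lesssim> X"
    using sum_lepoll_mono[OF assms(2) lepoll_refl] sum_lepoll_mono[OF lepoll_refl assms(2)]
      lepoll_trans2[OF _ XX] by blast+
  moreover have "X \<lesssim> A <+> X" "X \<lesssim> X <+> A"
    unfolding lepoll_def by (auto intro!: exI[of _ Inr] exI[of _ Inl])
  ultimately show "A <+> X \<approx> X" "X <+> A \<approx> X"
    by (auto intro: lepoll_antisym)
qed

lemma orthonormal_basis_lepoll:
  assumes X: "orthonormal_basis H X" "infinite X" and Y: "orthonormal Y" "Y \<subseteq> H"
  shows "Y \<lesssim> X"
proof -
  have "Y \<lesssim> X \<times> (UNIV :: nat set)"
  proof (rule orthonormal_lepoll[OF Y(1)])
    fix y assume y: "y \<in> Y"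
    show "\<exists>g\<in>X. cinner y g \<noteq> 0"
    proof (rule ccontr)
      assume "\<not> (\<exists>g\<in>X. cinner y g \<noteq> 0)"
      then have "y = 0"
        using orthonormal_basis_total[OF X(1)] y Y(2) by blast
      then show False
        using orthonormal_norm[OF Y(1) y] by simp
    qed
  qed
  also have "\<dots> \<lesssim> X"
    by (rule infinite_times_lepoll[OF X(2) lepoll_refl]) (use X(2) infinite_le_lepoll in blast)
  finally show ?thesis .
qed

section \<open>Orthogonal sums and unitaries between spaces of equal dimension\<close>

lemma orthonormal_basis_Times:
  fixes H :: "'a::chilbert set" and M :: "'b::chilbert set"
  assumes H: "closed_csubspace H" and M: "closed_csubspace M"
    and X: "orthonormal_basis H X" and Y: "orthonormal_basis M Y"
  obtains Z where "orthonormal_basis (H \<times> M) Z" "Z \<approx> X <+> Y"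
proof
  let ?f = "case_sum (\<lambda>x. (x, 0)) (\<lambda>y. (0, y)) :: 'a + 'b \<Rightarrow> 'a \<times> 'b"
  let ?Z = "?f ` (X <+> Y)"
  note X' = X[unfolded orthonormal_basis_alt] and Y' = Y[unfolded orthonormal_basis_alt]
  have nz: "0 \<notin> X" "0 \<notin> Y"
    using X' Y' orthonormal_norm[of X 0] orthonormal_norm[of Y 0] by auto
  show "?Z \<approx> X <+> Y"
    by (rule inj_on_image_eqpoll_self) (use nz in \<open>auto simp: inj_on_def split: sum.splits\<close>)
  show "orthonormal_basis (H \<times> M) ?Z"
  proof (rule orthonormal_basisI[OF closed_csubspace_Times[OF H M]])
    show "?Z \<subseteq> H \<times> M"
      using X' Y' ccs_0[OF H] ccs_0[OF M] by auto
    show "orthonormal ?Z"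
      using X' Y' nz unfolding orthonormal_def by (auto simp: cinner_prod_def)
    fix z assume z: "z \<in> H \<times> M" and o: "\<And>b. b \<in> ?Z \<Longrightarrow> cinner z b = 0"
    have "cinner (fst z) x = 0" if "x \<in> X" for x
    proof -
      have "(x, 0) \<in> ?Z"
        using that by (intro image_eqI[of _ _ "Inl x"]) auto
      then show ?thesis
        using o by (fastforce simp: cinner_prod_def)
    qed
    then have "fst z = 0"
      using orthonormal_basis_total[OF X] z by auto
    moreover have "cinner (snd z) y = 0" if "y \<in> Y" for y
    proof -
      have "(0, y) \<in> ?Z"
        using that by (intro image_eqI[of _ _ "Inr y"]) auto
      then show ?thesis
        using o by (fastforce simp: cinner_prod_def)
    qed
    then have "snd z = 0"
      using orthonormal_basis_total[OF Y] z by auto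
    ultimately show "z = 0"
      by (simp add: prod_eq_iff)
  qed
qed

text \<open>The unitary is the closed span of the graph of a bijection of the bases. That pairs (x,
  y) in this span have equal norms is expressed as orthogonality of (x, y) to (x, -y), a condition
  that is bilinear over the reals and can be extended from the generators in one argument at a
  time.\<close>

lemma isometry_of_orthonormal_bases:
  fixes U :: "'a::chilbert set" and W :: "'b::chilbert set"
  assumes U: "closed_csubspace U" and W: "closed_csubspace W"
    and B: "orthonormal_basis U B" and C: "orthonormal_basis W C" and BC: "B \<approx> C"
  obtains F where "isometric U W F" "F ` U = W"
proof -
  obtain \<phi> where \<phi>: "bij_betw \<phi> B C"
    using BC by (auto simp: eqpoll_def)
  note B' = B[unfolded orthonormal_basis_alt] and C' = C[unfolded orthonormal_basis_alt]
  define G0 where "G0 = (\<lambda>b. (b, \<phi> b)) ` B"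
  define G where "G = closed_cspan G0"
  have G: "closed_csubspace G"
    unfolding G_def by (rule closed_csubspace_closed_cspan)
  have 1: "cinner p (b, - \<phi> b) = 0" if "p \<in> G" "b \<in> B" for p b
  proof -
    have "G \<subseteq> {p. \<forall>q\<in>{(b, - \<phi> b)}. cinner p q = 0}"
      unfolding G_def
    proof (rule closed_cspan_minimal[OF closed_csubspace_cinner_zero])
      have "cinner b' b - cinner (\<phi> b') (\<phi> b) = 0" if "b' \<in> B" for b'
      proof -
        have "\<phi> b' = \<phi> b \<longleftrightarrow> b' = b"
          using \<phi> that \<open>b \<in> B\<close> by (auto simp: bij_betw_def inj_on_def)
        then show ?thesis
          using B' C' bij_betwE[OF \<phi>] that \<open>b \<in> B\<close> by (auto simp: orthonormal_def)
      qed
      then show "G0 \<subseteq> {p. \<forall>q\<in>{(b, - \<phi> b)}. cinner p q = 0}"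
        by (auto simp: G0_def cinner_prod_def)
    qed
    then show ?thesis using that by auto
  qed
  have 2: "cinner q (x, - y) = 0" if "q \<in> G" "(x, y) \<in> G" for q x y
  proof -
    have "G \<subseteq> {q. \<forall>p\<in>{(x, - y)}. cinner q p = 0}"
      unfolding G_def
    proof (rule closed_cspan_minimal[OF closed_csubspace_cinner_zero])
      have "cinner b x - cinner (\<phi> b) y = 0" if "b \<in> B" for b
        using 1[OF \<open>(x, y) \<in> G\<close> that] cinner_commute[of b x] cinner_commute[of "\<phi> b" y]
        by (simp add: cinner_prod_def)
      then show "G0 \<subseteq> {q. \<forall>p\<in>{(x, - y)}. cinner q p = 0}"
        by (auto simp: G0_def cinner_prod_def)
    qed
    then show ?thesis using that by auto
  qed
  have norm_eq: "norm x = norm y" if "(x, y) \<in> G" for x y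
  proof -
    have "cinner x x = cinner y y"
      using 2[OF that that] by (simp add: cinner_prod_def)
    then show ?thesis by (rule norm_eq_of_cinner_eq)
  qed
  obtain F where F: "closed_csubspace (fst ` G)" "F \<in> bops (fst ` G) (snd ` G)"
    "\<And>x. x \<in> fst ` G \<Longrightarrow> (x, F x) \<in> G" "\<And>x y. (x, y) \<in> G \<Longrightarrow> F x = y"
    by (rule graph_bops[OF G, of 1]) (auto simp: norm_eq)
  have G0G: "G0 \<subseteq> G"
    unfolding G_def by (rule closed_cspan_superset)
  have GUW: "G \<subseteq> U \<times> W"
    unfolding G_def
    by (rule closed_cspan_minimal[OF closed_csubspace_Times[OF U W]])
      (use B' C' bij_betwE[OF \<phi>] in \<open>auto simp: G0_def\<close>)
  have "B \<subseteq> fst ` G"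
    using G0G by (force simp: G0_def)
  then have dom: "fst ` G = U"
    using orthonormal_basis_subspace[OF B F(1)] GUW by auto
  have iso: "isometric U W F"
    unfolding isometric_def
  proof (intro conjI ballI)
    show "F \<in> bops U W"
      by (rule bops_mono[OF F(2)]) (use dom GUW F(3) in auto)
    show "norm (F x) = norm x" if "x \<in> U" for x
      using norm_eq[OF F(3)] that dom by simp
  qed
  moreover have "F ` U = W"
  proof
    show "F ` U \<subseteq> W"
      using bops_in[OF isometric_bops[OF iso]] by auto
    have "C \<subseteq> F ` U"
    proof
      fix c assume "c \<in> C"
      then obtain b where "b \<in> B" "c = \<phi> b"
        using \<phi> by (auto simp: bij_betw_def)
      then have "F b = c"
        using G0G by (auto simp: G0_def intro: F(4))
      then show "c \<in> F ` U"
        using \<open>b \<in> B\<close> B' by blast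
    qed
    then show "W \<subseteq> F ` U"
      by (rule orthonormal_basis_subspace[OF C closed_csubspace_isometric_image[OF U iso]])
  qed
  ultimately show ?thesis
    using that by blast
qed

section \<open>Finite dimension\<close>

text \<open>The squared Hilbert-Schmidt norm: by Parseval both sides are the sum of the squared
  moduli of all matrix entries.\<close>

lemma sum_norm_adj_finite:
  fixes H :: "'a::chilbert set"
  assumes H: "closed_csubspace H" and B: "orthonormal_basis H B" "finite B" and A: "A \<in> bops H H"
  shows "(\<Sum>x\<in>B. (norm (A x))\<^sup>2) = (\<Sum>x\<in>B. (norm (adj H H A x))\<^sup>2)"
proof -
  note cs = ccs_csubspace[OF H]
  have BH: "B \<subseteq> H" using B(1) by (simp add: orthonormal_basis_alt)
  have "(\<Sum>x\<in>B. (norm (A x))\<^sup>2) = (\<Sum>x\<in>B. \<Sum>y\<in>B. (cmod (cinner (A x) y))\<^sup>2)"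
    using BH by (intro sum.cong refl parseval_finite[OF cs B] bops_in[OF A]) auto
  also have "\<dots> = (\<Sum>y\<in>B. \<Sum>x\<in>B. (cmod (cinner (A x) y))\<^sup>2)"
    by (rule sum.swap)
  also have "\<dots> = (\<Sum>y\<in>B. \<Sum>x\<in>B. (cmod (cinner (adj H H A y) x))\<^sup>2)"
  proof (intro sum.cong refl)
    fix x y assume "y \<in> B" "x \<in> B"
    then have "cinner (A x) y = cnj (cinner (adj H H A y) x)"
      using cinner_adj[OF H A, of x y] BH cinner_commute by fastforce
    then show "(cmod (cinner (A x) y))\<^sup>2 = (cmod (cinner (adj H H A y) x))\<^sup>2"
      by simp
  qed
  also have "\<dots> = (\<Sum>y\<in>B. (norm (adj H H A y))\<^sup>2)"
    by (intro sum.cong refl parseval_finite[OF cs B, symmetric] adj_in[OF H A])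
  finally show ?thesis .
qed

text \<open>V and V* have the same Hilbert-Schmidt norm, while V* does not increase the norm of any
  basis vector; hence it preserves the norm of each. For such a vector x this gives V V* x =
  x.\<close>

lemma isometric_surj_finite:
  fixes H :: "'a::chilbert set"
  assumes H: "closed_csubspace H" and B: "orthonormal_basis H B" "finite B" and V: "isometric H H V"
  shows "V ` H = H"
proof -
  note Vb = isometric_bops[OF V]
  have BH: "B \<subseteq> H" and o: "orthonormal B" using B(1) by (auto simp: orthonormal_basis_alt)
  let ?W = "adj H H V"
  have le: "norm (?W x) \<le> norm x" for x
    using norm_adj_le[OF H Vb, of 1 x] isometric_norm[OF V] by simp
  have "(\<Sum>x\<in>B. 1 - (norm (?W x))\<^sup>2) = (\<Sum>x\<in>B. (norm (V x))\<^sup>2) - (\<Sum>x\<in>B. (norm (?W x))\<^sup>2)"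
    unfolding sum_subtractf[symmetric]
    by (intro sum.cong refl) (use BH isometric_norm[OF V] orthonormal_norm[OF o] in auto)
  then have "(\<Sum>x\<in>B. 1 - (norm (?W x))\<^sup>2) = 0"
    using sum_norm_adj_finite[OF H B Vb] by simp
  moreover have "0 \<le> 1 - (norm (?W x))\<^sup>2" if "x \<in> B" for x
    using le[of x] orthonormal_norm[OF o that] by (simp add: power_le_one)
  ultimately have W1: "(norm (?W x))\<^sup>2 = 1" if "x \<in> B" for x
    using sum_nonneg_eq_0_iff[OF B(2), of "\<lambda>x. 1 - (norm (?W x))\<^sup>2"] that by auto
  have "B \<subseteq> V ` H"
  proof
    fix x assume x: "x \<in> B"
    have w: "?W x \<in> H" by (rule adj_in[OF H Vb])
    have "(norm (V (?W x) - x))\<^sup>2 = (norm (V (?W x)))\<^sup>2 + (norm x)\<^sup>2 - 2 * Re (cinner (V (?W x)) x)"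
      by (rule norm_diff_cinner)
    also have "cinner (V (?W x)) x = of_real ((norm (?W x))\<^sup>2)"
      using cinner_adj[OF H Vb w, of x] by (simp add: cinner_self)
    finally have "(norm (V (?W x) - x))\<^sup>2 = 0"
      using W1[OF x] isometric_norm[OF V w] orthonormal_norm[OF o x] by simp
    then show "x \<in> V ` H"
      using w by (metis image_eqI eq_iff_diff_eq_0 norm_eq_zero zero_eq_power2)
  qed
  then show ?thesis
    using orthonormal_basis_subspace[OF B(1) closed_csubspace_isometric_image[OF H V]]
      bops_in[OF Vb] by auto
qed

section \<open>The dimension of a minimal normal extension\<close>

context normal_ext
begin

text \<open>A subnormal operator on a finite-dimensional space is normal: \<open>\<parallel>S\<parallel>\<close> and \<open>\<parallel>S*\<parallel>\<close> agree in the
  Hilbert-Schmidt norm, whereas \<open>\<parallel>N* j x\<parallel> = \<parallel>S x\<parallel>\<close> and \<open>j S* x\<close> is the projection of \<open>N* j x\<close>.\<close>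

lemma Zspace_finite:
  assumes B: "orthonormal_basis H B" "finite B"
  shows "Zspace = j ` H"
proof
  have BH: "B \<subseteq> H" using B(1) by (auto simp: orthonormal_basis_alt)
  let ?T = "adj H H S"
  have T: "?T x \<in> H" for x by (rule adj_in[OF closed_H S_bops])
  have pyth: "(norm (Na (j x)))\<^sup>2 = (norm (Na (j x) - j (?T x)))\<^sup>2 + (norm (?T x))\<^sup>2" if x: "x \<in> H" for x
  proof -
    have "cinner (Na (j x)) (j h) = cinner (j (?T x)) (j h)" if h: "h \<in> H" for h
      using h x by (simp add: cinner_N'[symmetric] j_in j_S[symmetric] cinner_j S_in T
          cinner_adj'[OF closed_H S_bops])
    then have "cinner (Na (j x) - j (?T x)) (j (?T x)) = 0"
      using T by (simp add: cinner_diff_left)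
    then show ?thesis
      using norm_add_cinner[of "Na (j x) - j (?T x)" "j (?T x)"] isometric_norm[OF iso_j T] by simp
  qed
  have NaS: "norm (Na (j x)) = norm (S x)" if x: "x \<in> H" for x
    by (rule norm_eq_of_cinner_eq) (use cinner_Napow_j[OF x x, of 1 1] in simp)
  have "(\<Sum>x\<in>B. (norm (Na (j x) - j (?T x)))\<^sup>2) = (\<Sum>x\<in>B. (norm (S x))\<^sup>2) - (\<Sum>x\<in>B. (norm (?T x))\<^sup>2)"
    unfolding sum_subtractf[symmetric] using BH pyth NaS by (intro sum.cong refl) fastforce
  then have "(\<Sum>x\<in>B. (norm (Na (j x) - j (?T x)))\<^sup>2) = 0"
    using sum_norm_adj_finite[OF closed_H B S_bops] by simp
  then have "Na (j x) = j (?T x)" if "x \<in> B" for x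
    using sum_nonneg_eq_0_iff[OF B(2), of "\<lambda>x. (norm (Na (j x) - j (?T x)))\<^sup>2"] that by auto
  then have "B \<subseteq> {x \<in> H. Na (j x) = j (?T x)}"
    using BH by auto
  then have "H \<subseteq> {x \<in> H. Na (j x) = j (?T x)}"
    by (rule orthonormal_basis_subspace[OF B(1) closed_csubspace_bops_eq[OF closed_H
          bops_comp[OF j_bops Na_bops] bops_comp[OF bops_adj[OF closed_H S_bops] j_bops]]])
  then have "Na x \<in> j ` H" if "x \<in> j ` H" for x
    using that T by auto
  then show "Zspace \<subseteq> j ` H"
    by (intro Zspace_subset closed_csubspace_isometric_image[OF closed_H iso_j]) auto
qed (rule j_Zspace)

lemma Zspace_total:
  assumes Z: "Zspace = K" and y: "y \<in> K" and o: "\<And>n h. h \<in> H \<Longrightarrow> cinner y ((Na ^^ n) (j h)) = 0"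
  shows "y = 0"
proof -
  have "cinner y z = 0" if "z \<in> Zset" for z
    using that o by (auto simp: Zset_def Zsum_def cinner_sum_right)
  then have "cinner y y = 0"
    by (rule cinner_closure_zero) (use y Z Zspace_def in auto)
  then show ?thesis by simp
qed

lemma cinner_zero_on_basis:
  assumes M: "closed_csubspace M" and X: "orthonormal_basis M X" and A: "A \<in> bops M L"
    and o: "\<And>x. x \<in> X \<Longrightarrow> cinner y (A x) = 0" and h: "h \<in> M"
  shows "cinner y (A h) = 0"
proof -
  have "M \<subseteq> {x \<in> M. A x \<in> {x. \<forall>z\<in>{y}. cinner x z = 0}}"
    by (rule orthonormal_basis_subspace[OF X closed_csubspace_bops_preimage[OF M A closed_csubspace_cinner_zero]])
      (use o X cinner_eq_0_commute in \<open>auto simp: orthonormal_basis_alt\<close>)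
  then show ?thesis
    using h cinner_eq_0_commute by auto
qed

text \<open>Countably many images of an infinite basis \<open>X\<close> still have at most the
  cardinality of \<open>X\<close>. The auxiliary space \<open>M\<close> and the operator
  \<open>A\<close> leave room for two uses: \<open>M = H\<close> with the identity bounds the
  dimension of \<open>K\<close>, and \<open>M = H1\<close> with the adjoint of E bounds the closed
  range of the lift.\<close>

lemma orthonormal_lepoll_Napow:
  assumes M: "closed_csubspace M" and X: "orthonormal_basis M X" "infinite X" and A: "A \<in> bops M H"
    and Y: "orthonormal Y"
    and total: "\<And>y. y \<in> Y \<Longrightarrow> (\<And>n x. x \<in> M \<Longrightarrow> cinner y ((Na ^^ n) (j (A x))) = 0) \<Longrightarrow> y = 0"
  shows "Y \<lesssim> X"
proof -
  let ?A = "\<lambda>n x. (Na ^^ n) (j (A x))"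
  have Ab: "?A n \<in> bops M K" for n
    by (rule bops_comp[OF bops_comp[OF A j_bops] bops_funpow[OF Na_bops]])
  let ?G = "(\<lambda>(n, x). ?A n x) ` ((UNIV :: nat set) \<times> X)"
  have nat: "(UNIV :: nat set) \<lesssim> X"
    using X(2) infinite_le_lepoll by blast
  have "Y \<lesssim> ?G \<times> (UNIV :: nat set)"
  proof (rule orthonormal_lepoll[OF Y])
    fix y assume y: "y \<in> Y"
    show "\<exists>g\<in>?G. cinner y g \<noteq> 0"
    proof (rule ccontr)
      assume n: "\<not> (\<exists>g\<in>?G. cinner y g \<noteq> 0)"
      have "cinner y (?A n x) = 0" if "x \<in> M" for n x
        by (rule cinner_zero_on_basis[OF M X(1) Ab _ that]) (use n in force)
      then have "y = 0"
        by (rule total[OF y])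
      then show False
        using orthonormal_norm[OF Y y] by simp
    qed
  qed
  also have "\<dots> \<lesssim> X"
    using infinite_times_lepoll[OF X(2) nat lepoll_refl] image_lepoll lepoll_trans
    by (intro infinite_times_lepoll[OF X(2) _ nat]) blast
  finally show ?thesis .
qed

text \<open>In finite dimension a minimal extension adds nothing. Otherwise the image of a basis of
  \<open>H\<close> is extended to a basis of \<open>K\<close>, which gives one inequality of
  cardinals at once; the other comes from the generating vectors N*^n j x.\<close>

lemma same_hilbert_dim_minimal:
  assumes Z: "Zspace = K"
  shows "same_hilbert_dim K H"
proof -
  obtain X where X: "orthonormal_basis H X"
    using orthonormal_basis_exists[OF closed_H] by blast
  have XH: "X \<subseteq> H" and o: "orthonormal X" using X by (auto simp: orthonormal_basis_alt)
  have inj: "inj_on j X"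
    using isometric_inj_on[OF csub_H iso_j] XH inj_on_subset by blast
  have oj: "orthonormal (j ` X)"
    using o XH inj unfolding orthonormal_def by (auto simp: cinner_j subset_iff inj_on_def)
  have jXK: "j ` X \<subseteq> K"
    using XH j_in by auto
  have jX: "j ` X \<approx> X"
    by (rule inj_on_image_eqpoll_self[OF inj])
  show ?thesis
  proof (cases "finite X")
    case True
    then have KH: "K = j ` H"
      using Zspace_finite[OF X] Z by simp
    have "orthonormal_basis K (j ` X)"
    proof (rule orthonormal_basisI[OF closed_K jXK oj])
      fix x assume x: "x \<in> K" and 0: "\<And>b. b \<in> j ` X \<Longrightarrow> cinner x b = 0"
      obtain h where h: "h \<in> H" "x = j h" using x KH by auto
      have "h = 0"
        by (rule orthonormal_basis_total[OF X h(1)]) (use 0 h XH cinner_j in force)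
      then show "x = 0"
        using h bops_0[OF csub_H j_bops] by simp
    qed
    then show ?thesis
      using X jX by (auto simp: same_hilbert_dim_def)
  next
    case False
    obtain Y where Y: "j ` X \<subseteq> Y" "orthonormal_basis K Y"
      by (rule orthonormal_basis_extend[OF closed_K jXK oj])
    have YK: "Y \<subseteq> K" and oY: "orthonormal Y" using Y(2) by (auto simp: orthonormal_basis_alt)
    have "Y \<lesssim> X"
      by (rule orthonormal_lepoll_Napow[OF closed_H X False bops_id oY])
        (use Zspace_total[OF Z] YK in blast)
    moreover have "X \<lesssim> Y"
      using jX Y(1) by (meson eqpoll_sym lepoll_trans1 subset_imp_lepoll)
    ultimately have "Y \<approx> X"
      by (rule lepoll_antisym)
    then show ?thesis
      using X Y(2) by (auto simp: same_hilbert_dim_def)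
  qed
qed

end

section \<open>Construction of the extension\<close>

lemma isometric_inverse:
  assumes U: "csubspace U" and F: "isometric U W F" "F ` U = W"
  obtains G where "isometric W U G" "\<And>x. x \<in> U \<Longrightarrow> G (F x) = x" "\<And>y. y \<in> W \<Longrightarrow> F (G y) = y"
proof
  let ?G = "inv_into U F"
  note Fb = isometric_bops[OF F(1)]
  have inj: "inj_on F U" by (rule isometric_inj_on[OF U F(1)])
  show GF: "?G (F x) = x" if "x \<in> U" for x using inj that by simp
  show FG: "F (?G y) = y" if "y \<in> W" for y using F(2) that by (simp add: f_inv_into_f)
  have G_in: "?G y \<in> U" if "y \<in> W" for y using F(2) that by (auto intro: inv_into_into)
  have norm_G: "norm (?G y) = norm y" if "y \<in> W" for y
    using isometric_norm[OF F(1) G_in[OF that]] FG[OF that] by simp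
  have "?G \<in> bops W U"
  proof (rule bopsI[where M = 1])
    show "?G (x + y) = ?G x + ?G y" if "x \<in> W" "y \<in> W" for x y
      using GF[OF csubspace_add[OF U G_in[OF that(1)] G_in[OF that(2)]]] that
      by (simp add: bops_add[OF Fb] G_in FG)
    show "?G (c *\<^sub>C x) = c *\<^sub>C ?G x" if "x \<in> W" for c x
      using GF[OF csubspace_scaleC[OF U G_in[OF that], of c]] that
      by (simp add: bops_scaleC[OF Fb] G_in FG)
  qed (auto simp: G_in norm_G)
  then show "isometric W U ?G"
    by (simp add: isometric_def norm_G)
qed

lemma isometric_comp: "isometric U W F \<Longrightarrow> isometric W X G \<Longrightarrow> isometric U X (\<lambda>x. G (F x))"
  using bops_comp[of F U W G X] bops_in[of F U W] by (simp add: isometric_def)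

lemma power2_norm_Pair: "(norm (x, y))\<^sup>2 = (norm x)\<^sup>2 + (norm y)\<^sup>2"
  by (simp add: norm_Pair)

context normal_ext
begin

text \<open>Since B is positive and has the same norms as E', it equals |E'|, and E'* E' = B^2. The
  commutation required of a Brownian-type operator then follows from N B = B N.\<close>

lemma brownian_normal_extensionI:
  fixes H1 :: "'c::chilbert set" and K1 :: "'d::chilbert set"
  assumes H1: "closed_csubspace H1" and K1: "closed_csubspace K1" "K1 \<noteq> {0}" and H0: "H \<noteq> {0}"
    and V: "V \<in> bops H1 H1" and E: "E \<in> bops H H1"
    and B: "positive_op K B" "\<And>x. x \<in> K \<Longrightarrow> N (B x) = B (N x)"
    "\<And>h. h \<in> H \<Longrightarrow> B (j h) = j (abs_op H H1 E h)"
    and j1: "isometric H1 K1 j1" and V': "isometric K1 K1 V'" and E': "E' \<in> bops K K1"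
    and norm_E': "\<And>x. x \<in> K \<Longrightarrow> norm (B x) = norm (E' x)"
    and j1V: "\<And>x. x \<in> H1 \<Longrightarrow> j1 (V x) = V' (j1 x)"
    and j1E: "\<And>y. y \<in> H \<Longrightarrow> j1 (E y) = E' (j y)"
    and V'E': "\<And>x y. x \<in> K1 \<Longrightarrow> y \<in> K \<Longrightarrow> cinner (V' x) (E' y) = 0"
  shows "brownian_normal_extension H1 H V E S K1 K j1 j V' E' N"
proof -
  interpret E': hilbert_op K K1 E'
    by unfold_locales (rule closed_K, rule E')
  have abs: "abs_op K K1 E' x = B x" if "x \<in> K" for x
    by (rule E'.abs_op_unique[OF B(1) norm_E' that])
  note Bin = bops_in[OF positive_op_bops[OF B(1)]]
  have sq: "adj K K1 E' (E' x) = B (B x)" if "x \<in> K" for x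
    using E'.abs_op_square[OF that] that by (simp add: abs Bin)
  have "K \<noteq> {0}"
  proof
    assume K: "K = {0}"
    have "H \<subseteq> {0}"
    proof
      fix h assume h: "h \<in> H"
      then show "h \<in> {0}"
        using isometric_norm[OF iso_j h] j_in[OF h] K by simp
    qed
    then show False
      using H0 csubspace_0[OF csub_H] by blast
  qed
  moreover have "op_extends H j (abs_op H H1 E) (abs_op K K1 E')"
    unfolding op_extends_def using B(3) by (simp add: abs j_in)
  ultimately show ?thesis
    unfolding brownian_normal_extension_iff[OF H1 closed_H V E S_bops]
    using K1 ext j1 V' E' V'E' j1V j1E B(2) by (simp add: sq N_in Bin)
qed

text \<open>The range of E is orthogonal to that of V, which is everything, so E = 0. This covers a
  finite-dimensional \<open>H1\<close>, where every isometry is onto.\<close>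

lemma brownian_extension_surjective:
  fixes H1 :: "'c::chilbert set"
  assumes H1: "closed_csubspace H1" "H1 \<noteq> {0}" and H0: "H \<noteq> {0}"
    and V: "isometric H1 H1 V" "V ` H1 = H1" and E: "E \<in> bops H H1"
    and VE: "\<And>x y. x \<in> H1 \<Longrightarrow> y \<in> H \<Longrightarrow> cinner (V x) (E y) = 0"
  shows "brownian_normal_extension H1 H V E S H1 K (\<lambda>x. x) j V (\<lambda>_. 0) N"
proof -
  interpret E: hilbert_op H H1 E
    by unfold_locales (rule closed_H, rule E)
  have E0: "E h = 0" if h: "h \<in> H" for h
  proof -
    obtain x where "x \<in> H1" "E h = V x"
      using V(2) bops_in[OF E h] by (metis imageE)
    then have "cinner (E h) (E h) = 0"
      using VE[OF _ h] by metis
    then show ?thesis by simp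
  qed
  have A0: "abs_op H H1 E h = 0" if "h \<in> H" for h
    using E.norm_abs_op[OF that] E0[OF that] by simp
  have z: "(\<lambda>_. 0) \<in> bops K K" "(\<lambda>_. 0) \<in> bops K H1"
    by (intro bops_zero csubspace_0[OF csub_K] ccs_0[OF H1(1)])+
  show ?thesis
  proof (rule brownian_normal_extensionI[OF H1(1) H1 H0 isometric_bops[OF V(1)] E, where B = "\<lambda>_. 0"])
    show "positive_op K (\<lambda>_. 0)"
      using z by (auto simp: positive_op_iff)
    show "isometric H1 H1 (\<lambda>x. x)"
      by (simp add: isometric_def bops_id)
  qed (use z V E0 A0 bops_0[OF csub_K N_bops] bops_0[OF csub_H j_bops] in auto)
qed

text \<open>The bound is in terms of \<open>H1\<close>, although B acts on a space that may be much
  larger. If y is orthogonal to all N*^n j E* x, then x = E h makes it orthogonal to B^2 N*^n j h;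
  hence B^2 y = 0 and B y = 0. So y is orthogonal to the range of B, and if it lies in the closure
  of that range it is zero.\<close>

lemma lift_range_lepoll:
  fixes H1 :: "'c::chilbert set"
  assumes Z: "Zspace = K" and H1: "closed_csubspace H1" and E: "E \<in> bops H H1"
    and B: "positive_op K B" "\<And>x. x \<in> K \<Longrightarrow> N (B x) = B (N x)"
    "\<And>h. h \<in> H \<Longrightarrow> B (j h) = j (abs_op H H1 E h)"
    and X: "orthonormal_basis H1 X" "infinite X"
    and Y: "orthonormal Y" "Y \<subseteq> closure (B ` K)"
  shows "Y \<lesssim> X"
proof -
  interpret E: hilbert_op H H1 E
    by unfold_locales (rule closed_H, rule E)
  note Bb = positive_op_bops[OF B(1)]
  note Bin = bops_in[OF Bb] and sa = positive_op_selfadjoint[OF csub_K B(1)]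
  have BNa: "B ((Na ^^ n) x) = (Na ^^ n) (B x)" if "x \<in> K" for n x
    by (rule funpow_commute_on[OF Na_bops Bb Na_commute_positive[OF B(1,2), symmetric] that])
  have YK: "Y \<subseteq> K"
    using Y(2) closure_minimal[OF _ ccs_closed[OF closed_K], of "B ` K"] Bin by blast
  show ?thesis
  proof (rule orthonormal_lepoll_Napow[OF H1 X bops_adj[OF closed_H E] Y(1)])
    fix y assume y: "y \<in> Y" and *: "\<And>n x. x \<in> H1 \<Longrightarrow> cinner y ((Na ^^ n) (j (adj H H1 E x))) = 0"
    then have yK: "y \<in> K" using YK by blast
    have "B (B y) = 0"
    proof (rule Zspace_total[OF Z])
      fix n h assume h: "h \<in> H"
      have "B (B ((Na ^^ n) (j h))) = (Na ^^ n) (j (abs_op H H1 E (abs_op H H1 E h)))"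
        using h by (simp add: BNa j_in Bin B(3) bops_in[OF E.abs_op_bops])
      also have "\<dots> = (Na ^^ n) (j (adj H H1 E (E h)))"
        using h by (simp add: E.abs_op_square)
      finally have "cinner y (B (B ((Na ^^ n) (j h)))) = 0"
        using *[OF bops_in[OF E h]] by simp
      then show "cinner (B (B y)) ((Na ^^ n) (j h)) = 0"
        using h yK by (simp add: sa Bin Napow_in j_in)
    qed (intro Bin yK)
    then have "cinner (B y) (B y) = 0"
      using sa[OF Bin[OF yK] yK] by simp
    then have "B y = 0"
      by simp
    then have "cinner y z = 0" if "z \<in> B ` K" for z
      using that sa[OF yK] by auto
    then have "cinner y y = 0"
      by (rule cinner_closure_zero) (use y Y(2) in auto)
    then show "y = 0" by simp
  qed
qed

text \<open>Writing \<open>L\<close> for the closed range of the lift on \<open>K \<ominus> H\<close> and \<open>R\<close> for the part of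
  \<open>H\<^sub>1 \<ominus> (ran V \<or> ran E)\<close> outside \<open>D\<close>, the extension lives on \<open>H\<^sub>1 \<oplus> L \<oplus> H\<^sub>1\<close>, where it extends
  \<open>V\<close> by a unitary from \<open>L \<oplus> H\<^sub>1\<close> onto \<open>R \<oplus> H\<^sub>1\<close>.  Since \<open>dim L \<le> dim H\<^sub>1\<close> and \<open>H\<^sub>1\<close> is
  infinite-dimensional, this space is a copy of \<open>H\<^sub>1\<close>.\<close>

lemma brownian_extension_infinite:
  fixes H1 D :: "'c::chilbert set"
  assumes Z: "Zspace = K" and H1: "closed_csubspace H1" "H1 \<noteq> {0}" and H0: "H \<noteq> {0}"
    and V: "isometric H1 H1 V" and E: "E \<in> bops H H1"
    and VE: "\<And>x y. x \<in> H1 \<Longrightarrow> y \<in> H \<Longrightarrow> cinner (V x) (E y) = 0"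
    and comm: "\<And>y. y \<in> H \<Longrightarrow> S (adj H H1 E (E y)) = adj H H1 E (E (S y))"
    and D: "closed_csubspace D" "D \<subseteq> H1 \<ominus>\<^sub>H (V ` H1 \<union> E ` H)"
    and X: "orthonormal_basis H1 X" "infinite X"
  obtains j1 V' E' where "brownian_normal_extension H1 H V E S H1 K j1 j V' E' N"
    "j1 ` D = H1 \<ominus>\<^sub>H {u + v |u v. u \<in> V' ` H1 \<and> v \<in> closure (E' ` K)}"
proof -
  interpret E: hilbert_op H H1 E
    by unfold_locales (rule closed_H, rule E)
  note cs1 = ccs_csubspace[OF H1(1)]
  note Vb = isometric_bops[OF V]
  obtain B where B: "positive_op K B" "\<And>x. x \<in> K \<Longrightarrow> N (B x) = B (N x)"
    "\<And>h. h \<in> H \<Longrightarrow> B (j h) = j (abs_op H H1 E h)"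
    by (rule positive_lift_exists[OF Z E.abs_op_positive E.abs_op_commute[OF S_bops comm, symmetric]]) auto
  note Bb = positive_op_bops[OF B(1)]
  note Bin = bops_in[OF Bb] and sa = positive_op_selfadjoint[OF csub_K B(1)]

  define J where "J = j ` H"
  have J: "closed_csubspace J" "J \<subseteq> K"
    unfolding J_def using closed_csubspace_isometric_image[OF closed_H iso_j] j_in by auto
  have "isometric H J j"
    using iso_j bops_mono[OF j_bops subset_refl, of J] by (simp add: J_def isometric_def)
  then obtain ji where ji: "isometric J H ji" "\<And>h. h \<in> H \<Longrightarrow> ji (j h) = h" "\<And>y. y \<in> J \<Longrightarrow> j (ji y) = y"
    using isometric_inverse[OF csub_H _ J_def[symmetric]] by blast
  let ?P = "ortho_proj J"
  have P_in: "?P k \<in> J" for k by (rule ortho_proj_in[OF J(1)])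
  have PK: "?P k \<in> K" for k using P_in J(2) by blast
  have Q_in: "k - ?P k \<in> K \<ominus>\<^sub>H J" if "k \<in> K" for k
    by (rule ortho_decomp[OF J(1) closed_K J(2) that])
  have BJ: "B x \<in> J" if "x \<in> J" for x
    using that B(3) bops_in[OF E.abs_op_bops] unfolding J_def by force

  define L where "L = closure (B ` (K \<ominus>\<^sub>H J))"
  have KJ: "closed_csubspace (K \<ominus>\<^sub>H J)" "K \<ominus>\<^sub>H J \<subseteq> K"
    by (rule closed_csubspace_ominus[OF closed_K]) (auto simp: ominus_def)
  have L: "closed_csubspace L"
    unfolding L_def by (intro csubspace_closure csubspace_bops_image[where K = K]
        ccs_csubspace KJ bops_mono[OF Bb KJ(2)]) (use Bin KJ(2) in blast)
  \<comment> \<open>What the range of V' has to fill so that exactly D remains uncovered.\<close>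
  define R where "R = H1 \<ominus>\<^sub>H (V ` H1 \<union> E ` H \<union> D)"
  have R: "closed_csubspace R"
    unfolding R_def by (rule closed_csubspace_ominus[OF H1(1)])
  have RH1: "R \<subseteq> H1" and DH1: "D \<subseteq> H1"
    using D(2) by (auto simp: R_def ominus_def)
  obtain XL where XL: "orthonormal_basis L XL"
    by (rule orthonormal_basis_exists[OF L])
  obtain XR where XR: "orthonormal_basis R XR"
    by (rule orthonormal_basis_exists[OF R])
  have "L \<subseteq> closure (B ` K)"
    unfolding L_def using KJ(2) by (intro closure_mono image_mono)
  then have XLX: "XL \<lesssim> X"
    by (intro lift_range_lepoll[OF Z H1(1) E B X]) (use XL in \<open>auto simp: orthonormal_basis_alt\<close>)
  have XRX: "XR \<lesssim> X"
    by (rule orthonormal_basis_lepoll[OF X]) (use XR RH1 in \<open>auto simp: orthonormal_basis_alt\<close>)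
  obtain XLH where XLH: "orthonormal_basis (L \<times> H1) XLH" "XLH \<approx> XL <+> X"
    by (rule orthonormal_basis_Times[OF L H1(1) XL X(1)])
  obtain XRH where XRH: "orthonormal_basis (R \<times> H1) XRH" "XRH \<approx> XR <+> X"
    by (rule orthonormal_basis_Times[OF R H1(1) XR X(1)])
  have XLHX: "XLH \<approx> X" and XRHX: "XRH \<approx> X"
    using XLH(2) XRH(2) infinite_Plus_eqpoll(1)[OF X(2)] XLX XRX eqpoll_trans by blast+
  have LH: "closed_csubspace (L \<times> H1)" and RH: "closed_csubspace (R \<times> H1)"
    by (intro closed_csubspace_Times L R H1)+
  define U where "U = H1 \<times> (L \<times> H1)"
  have U: "closed_csubspace U"
    unfolding U_def by (rule closed_csubspace_Times[OF H1(1) LH])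
  note csU = ccs_csubspace[OF U]
  obtain XU where XU: "orthonormal_basis U XU" "XU \<approx> X <+> XLH"
    unfolding U_def by (rule orthonormal_basis_Times[OF H1(1) LH X(1) XLH(1)])
  have XUX: "XU \<approx> X"
    using XU(2) infinite_Plus_eqpoll(2)[OF X(2) eqpoll_imp_lepoll[OF XLHX]] eqpoll_trans by blast
  obtain \<Phi> where \<Phi>: "isometric U H1 \<Phi>" "\<Phi> ` U = H1"
    by (rule isometry_of_orthonormal_bases[OF U H1(1) XU(1) X(1) XUX])
  \<comment> \<open>Both sums have the dimension of \<open>H1\<close>, whatever the dimensions of L
    and R: the added copy of \<open>H1\<close> absorbs the difference.\<close>
  have "XLH \<approx> XRH"
    using XLHX XRHX eqpoll_sym eqpoll_trans by blast
  then obtain \<Psi> where \<Psi>: "isometric (L \<times> H1) (R \<times> H1) \<Psi>" "\<Psi> ` (L \<times> H1) = R \<times> H1"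
    by (rule isometry_of_orthonormal_bases[OF LH RH XLH(1) XRH(1)])
  obtain \<Phi>i where \<Phi>i: "isometric H1 U \<Phi>i" "\<And>x. x \<in> U \<Longrightarrow> \<Phi>i (\<Phi> x) = x" "\<And>y. y \<in> H1 \<Longrightarrow> \<Phi> (\<Phi>i y) = y"
    using isometric_inverse[OF csU \<Phi>] by blast
  note \<Phi>b = isometric_bops[OF \<Phi>(1)] and \<Psi>b = isometric_bops[OF \<Psi>(1)]
  note \<Phi>_in = bops_in[OF \<Phi>b] and \<Phi>i_in = bops_in[OF isometric_bops[OF \<Phi>i(1)]]
  have \<Psi>_in: "fst (\<Psi> q) \<in> R" "snd (\<Psi> q) \<in> H1" if "q \<in> L \<times> H1" for q
    using bops_in[OF \<Psi>b that] by (auto simp: mem_Times_iff)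
  have zL: "0 \<in> L" and z1: "0 \<in> H1"
    using ccs_0[OF L] ccs_0[OF H1(1)] by auto

  define I where "I x = (x, (0, 0) :: 'b \<times> 'c)" for x :: 'c
  \<comment> \<open>W has range (ran V + R) \<times> 0 \<times> H1, while the closed range of F is
    closure (ran E) \<times> L \<times> 0. The ranges are orthogonal, and what they leave free is D
    \<times> 0 \<times> 0.\<close>
  define W where "W z = (V (fst z) + fst (\<Psi> (snd z)), (0 :: 'b, snd (\<Psi> (snd z))))" for z
  define F where "F k = (E (ji (?P k)), (B (k - ?P k), 0 :: 'c))" for k
  have zI: "I x = (x, 0)" for x
    by (simp add: I_def zero_prod_def)

  have I: "isometric H1 U I"
    unfolding isometric_def
  proof (intro conjI ballI)
    show "I \<in> bops H1 U"
      by (rule bopsI[where M = 1]) (auto simp: I_def U_def zL z1 scaleC_prod_def norm_Pair)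
  qed (simp add: I_def norm_Pair)
  have W: "isometric U U W"
    unfolding isometric_def
  proof (intro conjI ballI)
    have nW: "norm (W z) = norm z" if z: "z \<in> U" for z
    proof -
      obtain x q where xq: "z = (x, q)" "x \<in> H1" "q \<in> L \<times> H1" using z by (auto simp: U_def)
      have "cinner (V x) (fst (\<Psi> q)) = 0"
        using \<Psi>_in(1)[OF xq(3)] xq(2) cinner_eq_0_commute[of "V x" "fst (\<Psi> q)"]
        by (auto simp: R_def ominus_def)
      then have "(norm (W z))\<^sup>2 = (norm (V x))\<^sup>2 + ((norm (fst (\<Psi> q)))\<^sup>2 + (norm (snd (\<Psi> q)))\<^sup>2)"
        by (simp add: W_def xq(1) power2_norm_Pair norm_add_cinner)
      also have "(norm (fst (\<Psi> q)))\<^sup>2 + (norm (snd (\<Psi> q)))\<^sup>2 = (norm q)\<^sup>2"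
        using power2_norm_Pair[of "fst (\<Psi> q)" "snd (\<Psi> q)"] isometric_norm[OF \<Psi>(1) xq(3)] by simp
      finally have "(norm (W z))\<^sup>2 = (norm z)\<^sup>2"
        by (simp add: xq(1) power2_norm_Pair isometric_norm[OF V xq(2)])
      then show ?thesis by (simp add: power2_eq_iff_nonneg)
    qed
    show "W \<in> bops U U"
    proof (rule bopsI[where M = 1])
      fix z assume z: "z \<in> U"
      then have z': "fst z \<in> H1" "snd z \<in> L \<times> H1" by (auto simp: U_def)
      show "W z \<in> U"
        using z' \<Psi>_in[OF z'(2)] RH1 zL
        by (auto simp: W_def U_def intro!: csubspace_add[OF cs1] bops_in[OF Vb])
      show "W (c *\<^sub>C z) = c *\<^sub>C W z" for c
        using z' by (simp add: W_def scaleC_prod_def[of c z] bops_scaleC[OF Vb] bops_scaleC[OF \<Psi>b])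
          (simp add: scaleC_prod_def scaleC_add_right)
      fix w assume w: "w \<in> U"
      then have w': "fst w \<in> H1" "snd w \<in> L \<times> H1" by (auto simp: U_def)
      show "W (z + w) = W z + W w"
        using z' w' by (simp add: W_def bops_add[OF Vb] bops_add[OF \<Psi>b])
    qed (simp add: nW)
    fix z assume "z \<in> U"
    then show "norm (W z) = norm z" by (rule nW)
  qed
  have F: "F \<in> bops K U" and norm_F: "\<And>k. k \<in> K \<Longrightarrow> norm (B k) = norm (F k)"
  proof -
    note Eji = bops_comp[OF isometric_bops[OF ji(1)] E]
    note EjiP = bops_comp[OF bops_ortho_proj[OF J(1)] Eji]
    note QB = bops_comp[OF bops_diff_op[OF csub_K bops_id bops_mono[OF bops_ortho_proj[OF J(1)] subset_UNIV PK]] Bb]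
    have F_in: "F k \<in> U" if "k \<in> K" for k
      using closure_subset[of "B ` (K \<ominus>\<^sub>H J)"] Q_in[OF that] bops_in[OF EjiP] z1
      by (auto simp: F_def U_def L_def)
    show nF: "norm (B k) = norm (F k)" if k: "k \<in> K" for k
    proof -
      have Qk: "k - ?P k \<in> K"
        by (rule subsetD[OF KJ(2) Q_in[OF k]])
      have BP: "norm (B (?P k)) = norm (E (ji (?P k)))"
      proof -
        have h: "ji (?P k) \<in> H"
          by (rule bops_in[OF isometric_bops[OF ji(1)] P_in])
        have "B (?P k) = j (abs_op H H1 E (ji (?P k)))"
          using B(3)[OF h] ji(3)[OF P_in] by simp
        then show ?thesis
          using isometric_norm[OF iso_j bops_in[OF E.abs_op_bops h]] E.norm_abs_op[OF h] by simp
      qed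
      have "B k = B (?P k + (k - ?P k))" by simp
      also have "\<dots> = B (?P k) + B (k - ?P k)"
        by (rule bops_add[OF Bb PK Qk])
      finally have Bk: "B k = B (?P k) + B (k - ?P k)" .
      \<comment> \<open>The cross term vanishes because B^2 maps J into itself and the other
        component of k is orthogonal to J.\<close>
      have "cinner (B (?P k)) (B (k - ?P k)) = cinner (B (B (?P k))) (k - ?P k)"
        by (rule sa[OF Bin[OF PK] Qk, symmetric])
      also have "\<dots> = 0"
        using cinner_ortho_proj[OF J(1) BJ[OF BJ[OF P_in]], of k k] cinner_eq_0_commute by blast
      finally have "(norm (B k))\<^sup>2 = (norm (F k))\<^sup>2"
        by (simp add: Bk norm_add_cinner F_def power2_norm_Pair BP)
      then show ?thesis by (simp add: power2_eq_iff_nonneg)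
    qed
    obtain M where M: "M > 0" "\<And>k. k \<in> K \<Longrightarrow> norm (B k) \<le> M * norm k"
      using bops_bound[OF Bb] by blast
    show "F \<in> bops K U"
    proof (rule bopsI[where M = M])
      show "F (x + y) = F x + F y" if "x \<in> K" "y \<in> K" for x y
        using bops_add[OF QB that] bops_add[OF EjiP] by (simp add: F_def)
      show "F (c *\<^sub>C x) = c *\<^sub>C F x" if "x \<in> K" for c x
        using bops_scaleC[OF QB that] bops_scaleC[OF EjiP] by (simp add: F_def scaleC_prod_def)
      show "norm (F x) \<le> M * norm x" if "x \<in> K" for x
        using M(2)[OF that] nF[OF that] by simp
    qed (rule F_in)
  qed

  let ?j1 = "\<lambda>x. \<Phi> (I x)" and ?V' = "\<lambda>y. \<Phi> (W (\<Phi>i y))" and ?E' = "\<lambda>k. \<Phi> (F k)"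
  note I_in = bops_in[OF isometric_bops[OF I]] and W_in = bops_in[OF isometric_bops[OF W]] and F_in = bops_in[OF F]
  note cinner_\<Phi> = isometric_cinner[OF csU \<Phi>(1)]
  have W_I: "W (I x) = I (V x)" for x
    using bops_0[OF ccs_csubspace[OF LH] \<Psi>b] by (simp add: W_def zI) (simp add: zero_prod_def)
  have F_j: "F (j h) = I (E h)" if "h \<in> H" for h
    using that ortho_proj_id[OF J(1), of "j h"] bops_0[OF csub_K Bb]
    by (simp add: F_def I_def J_def ji(2))
  have WF: "cinner (W z) (F k) = 0" if z: "z \<in> U" and k: "k \<in> K" for z k
  proof -
    have h: "ji (?P k) \<in> H"
      by (rule bops_in[OF isometric_bops[OF ji(1)] P_in])
    have z': "fst z \<in> H1" "snd z \<in> L \<times> H1" using z by (auto simp: U_def)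
    have "cinner (fst (\<Psi> (snd z))) (E (ji (?P k))) = 0"
      using \<Psi>_in(1)[OF z'(2)] h by (auto simp: R_def ominus_def)
    then show ?thesis
      using VE[OF z'(1) h] by (simp add: W_def F_def cinner_prod_def cinner_add_left)
  qed
  show ?thesis
  proof (rule that)
    show "brownian_normal_extension H1 H V E S H1 K ?j1 j ?V' ?E' N"
    proof (rule brownian_normal_extensionI[OF H1(1) H1 H0 Vb E B])
      show "isometric H1 H1 ?j1"
        by (rule isometric_comp[OF I \<Phi>(1)])
      show "isometric H1 H1 ?V'"
        by (rule isometric_comp[OF isometric_comp[OF \<Phi>i(1) W] \<Phi>(1)])
      show "?E' \<in> bops K H1"
        by (rule bops_comp[OF F \<Phi>b])
      show "norm (B x) = norm (?E' x)" if "x \<in> K" for x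
        using norm_F[OF that] isometric_norm[OF \<Phi>(1) F_in[OF that]] by simp
      show "?j1 (V x) = ?V' (?j1 x)" if "x \<in> H1" for x
        using that by (simp add: \<Phi>i(2) I_in W_I)
      show "?j1 (E y) = ?E' (j y)" if "y \<in> H" for y
        by (simp add: F_j[OF that])
      show "cinner (?V' x) (?E' y) = 0" if "x \<in> H1" "y \<in> K" for x y
        using that by (simp add: cinner_\<Phi> W_in \<Phi>i_in F_in WF)
    qed
    show "?j1 ` D = H1 \<ominus>\<^sub>H {u + v |u v. u \<in> ?V' ` H1 \<and> v \<in> closure (?E' ` K)}"
    proof (intro equalityI subsetI)
      fix y assume "y \<in> ?j1 ` D"
      then obtain d where d: "d \<in> D" "y = \<Phi> (I d)" by blast
      then have dH1: "d \<in> H1" using DH1 by blast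
      have 1: "cinner y (?V' x) = 0" if x: "x \<in> H1" for x
      proof -
        have z: "fst (\<Phi>i x) \<in> H1" "snd (\<Phi>i x) \<in> L \<times> H1"
          using \<Phi>i_in[OF x] by (auto simp: U_def)
        have "cinner d (fst (\<Psi> (snd (\<Phi>i x)))) = 0"
          using \<Psi>_in(1)[OF z(2)] d(1) cinner_eq_0_commute[of d "fst (\<Psi> (snd (\<Phi>i x)))"]
          by (auto simp: R_def ominus_def)
        moreover have "cinner d (V (fst (\<Phi>i x))) = 0"
          using D(2) d(1) z(1) by (auto simp: ominus_def)
        ultimately have "cinner (I d) (W (\<Phi>i x)) = 0"
          by (simp add: I_def W_def cinner_prod_def cinner_add_right)
        then show ?thesis
          unfolding d(2) by (simp add: cinner_\<Phi> I_in W_in \<Phi>i_in dH1 x)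
      qed
      have 2: "cinner y (?E' k) = 0" if k: "k \<in> K" for k
      proof -
        have "cinner d (E (ji (?P k))) = 0"
          using D(2) d(1) bops_in[OF isometric_bops[OF ji(1)] P_in] by (auto simp: ominus_def)
        then have "cinner (I d) (F k) = 0"
          by (simp add: I_def F_def cinner_prod_def)
        then show ?thesis
          unfolding d(2) by (simp add: cinner_\<Phi> I_in F_in dH1 k)
      qed
      have "cinner y v = 0" if "v \<in> closure (?E' ` K)" for v
        by (rule cinner_closure_zero[OF _ that]) (use 2 in auto)
      then show "y \<in> H1 \<ominus>\<^sub>H {u + v |u v. u \<in> ?V' ` H1 \<and> v \<in> closure (?E' ` K)}"
        using 1 d(2) \<Phi>_in[OF I_in[OF dH1]] by (auto simp: ominus_def cinner_add_right)
    next
      fix y assume "y \<in> H1 \<ominus>\<^sub>H {u + v |u v. u \<in> ?V' ` H1 \<and> v \<in> closure (?E' ` K)}"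
      then have y: "y \<in> H1"
        and o: "\<And>u v. u \<in> ?V' ` H1 \<Longrightarrow> v \<in> closure (?E' ` K) \<Longrightarrow> cinner y (u + v) = 0"
        by (auto simp: ominus_def)
      \<comment> \<open>Zero in both ranges allows each summand of u + v to be tested alone.\<close>
      have 0: "0 \<in> ?V' ` H1" "0 \<in> ?E' ` K"
        by (rule csubspace_0[OF csubspace_bops_image[OF cs1
              isometric_bops[OF isometric_comp[OF isometric_comp[OF \<Phi>i(1) W] \<Phi>(1)]]]],
            rule csubspace_0[OF csubspace_bops_image[OF csub_K bops_comp[OF F \<Phi>b]]])
      obtain x l w where xlw: "\<Phi>i y = (x, (l, w))" "x \<in> H1" "l \<in> L" "w \<in> H1"
        using \<Phi>i_in[OF y] by (auto simp: U_def)
      let ?z = "(x, (l, w))"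
      have zU: "?z \<in> U" "y = \<Phi> ?z"
        using xlw \<Phi>i(3)[OF y] by (auto simp: U_def)
      have oW: "cinner ?z (W z) = 0" if z: "z \<in> U" for z
      proof -
        have "cinner y (?V' (\<Phi> z) + 0) = 0"
          by (intro o imageI \<Phi>_in[OF z] subsetD[OF closure_subset 0(2)])
        then show ?thesis
          using z zU by (simp add: \<Phi>i(2) cinner_\<Phi> W_in)
      qed
      have oF: "cinner ?z (F k) = 0" if k: "k \<in> K" for k
      proof -
        have "cinner y (0 + ?E' k) = 0"
          by (intro o 0(1) subsetD[OF closure_subset imageI[OF k]])
        then show ?thesis
          using k zU by (simp add: cinner_\<Phi> F_in)
      qed
      \<comment> \<open>Surjectivity of \<Psi> lets the three test vectors vary independently;
        putting two of them to zero separates the conditions.\<close>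
      have xrw: "cinner x (V x') + cinner x r + cinner w w' = 0"
        if x': "x' \<in> H1" and r: "r \<in> R" and w': "w' \<in> H1" for x' r w'
      proof -
        obtain q where q: "q \<in> L \<times> H1" "\<Psi> q = (r, w')"
          using \<Psi>(2) r w' by (metis (no_types, lifting) SigmaI imageE)
        have "cinner ?z (W (x', q)) = 0"
          using x' q(1) by (intro oW) (auto simp: U_def)
        then show ?thesis
          by (simp add: W_def q(2) cinner_prod_def cinner_add_right)
      qed
      have xV: "cinner x (V x') = 0" if "x' \<in> H1" for x'
        using xrw[OF that ccs_0[OF R] z1] by simp
      have xR: "cinner x r = 0" if "r \<in> R" for r
        using xrw[OF z1 that z1] bops_0[OF cs1 Vb] by simp
      have "cinner w w = 0"
        using xrw[OF z1 ccs_0[OF R] xlw(4)] bops_0[OF cs1 Vb] by simp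
      then have w0: "w = 0" by simp
      have xE: "cinner x (E h) = 0" if "h \<in> H" for h
        using oF[OF j_in[OF that]] by (simp add: F_j[OF that] I_def cinner_prod_def)
      have "cinner l v = 0" if v: "v \<in> B ` (K \<ominus>\<^sub>H J)" for v
      proof -
        obtain m where m: "m \<in> K \<ominus>\<^sub>H J" "v = B m" using v by blast
        have "?P m = 0"
          by (rule ortho_proj_unique[OF J(1) ccs_0[OF J(1)]]) (use m in \<open>auto simp: ominus_def\<close>)
        then have "F m = (0, (v, 0))"
          using bops_0[OF ccs_csubspace[OF J(1)] isometric_bops[OF ji(1)]] bops_0[OF csub_H E]
          by (simp add: F_def m(2))
        then show ?thesis
          using oF[of m] m(1) KJ(2) by (auto simp: cinner_prod_def)
      qed
      then have "cinner l l = 0"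
        by (rule cinner_closure_zero) (use xlw(3) L_def in auto)
      then have l0: "l = 0" by simp
      let ?d = "ortho_proj D x"
      have d: "?d \<in> D" by (rule ortho_proj_in[OF D(1)])
      have dH1: "?d \<in> H1" using d DH1 by blast
      \<comment> \<open>The residual lies in R. Both x and its projection onto D are orthogonal to
        R, so the residual is orthogonal to itself and x lies in D.\<close>
      have xd: "x - ?d \<in> R"
        unfolding R_def ominus_def
      proof (intro CollectI conjI ballI)
        show "x - ?d \<in> H1"
          by (rule csubspace_diff[OF cs1 xlw(2) dH1])
        fix u assume "u \<in> V ` H1 \<union> E ` H \<union> D"
        then consider "u \<in> D" | "cinner x u = 0" "cinner ?d u = 0"
          using xV xE D(2) d by (auto simp: ominus_def)
        then show "cinner (x - ?d) u = 0"
        proof cases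
          case 1
          then show ?thesis by (rule cinner_ortho_proj[OF D(1)])
        qed (simp add: cinner_diff_left)
      qed
      have "cinner (x - ?d) (x - ?d) = cinner x (x - ?d) - cinner ?d (x - ?d)"
        by (simp add: cinner_diff_left)
      also have "\<dots> = 0"
        using xR[OF xd] cinner_ortho_proj[OF D(1) d, of x] cinner_eq_0_commute[of ?d "x - ?d"] by simp
      finally have "x \<in> D"
        using d by simp
      then show "y \<in> ?j1 ` D"
        using zU(2) by (auto simp: w0 l0 I_def)
    qed
  qed
qed

text \<open>A finite-dimensional \<open>H1\<close> could not accommodate a second copy of itself,
  but there V is onto, so that E and D vanish and V itself can serve as V'. In the remaining case
  the infinite-dimensional construction applies.\<close>

lemma brownian_extension_exists:
  fixes H1 D :: "'c::chilbert set"
  assumes Z: "Zspace = K" and H1: "closed_csubspace H1" "H1 \<noteq> {0}" and H0: "H \<noteq> {0}"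
    and V: "isometric H1 H1 V" and E: "E \<in> bops H H1"
    and VE: "\<And>x y. x \<in> H1 \<Longrightarrow> y \<in> H \<Longrightarrow> cinner (V x) (E y) = 0"
    and comm: "\<And>y. y \<in> H \<Longrightarrow> S (adj H H1 E (E y)) = adj H H1 E (E (S y))"
    and D: "closed_csubspace D" "D \<subseteq> H1 \<ominus>\<^sub>H closed_cspan (V ` H1 \<union> closure (E ` H))"
  obtains j1 V' E' where "brownian_normal_extension H1 H V E S H1 K j1 j V' E' N"
    "j1 ` D = H1 \<ominus>\<^sub>H {u + v |u v. u \<in> V' ` H1 \<and> v \<in> closure (E' ` K)}"
proof -
  have D': "D \<subseteq> H1 \<ominus>\<^sub>H (V ` H1 \<union> E ` H)"
    using D(2) closed_cspan_superset[of "V ` H1 \<union> closure (E ` H)"] closure_subset[of "E ` H"]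
    unfolding ominus_def by blast
  obtain X where X: "orthonormal_basis H1 X"
    by (rule orthonormal_basis_exists[OF H1(1)])
  show ?thesis
  proof (cases "finite X")
    case True
    have surj: "V ` H1 = H1"
      by (rule isometric_surj_finite[OF H1(1) X True V])
    have zero: "x = 0" if "x \<in> H1" "\<And>y. y \<in> H1 \<Longrightarrow> cinner x y = 0" for x
      using that(2)[OF that(1)] by simp
    have "x = 0" if "x \<in> D" for x
      using subsetD[OF D' that] unfolding surj by (intro zero) (simp_all add: ominus_def)
    then have D0: "D = {0}"
      using ccs_0[OF D(1)] by blast
    have "(\<lambda>x. x) ` D = H1 \<ominus>\<^sub>H {u + v |u v. u \<in> V ` H1 \<and> v \<in> closure ((\<lambda>_. 0) ` K)}"
    proof (intro equalityI subsetI)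
      fix x assume x: "x \<in> H1 \<ominus>\<^sub>H {u + v |u v. u \<in> V ` H1 \<and> v \<in> closure ((\<lambda>_. 0) ` K)}"
      have "0 \<in> closure ((\<lambda>_. 0 :: 'c) ` K)"
        by (rule subsetD[OF closure_subset image_eqI[OF refl csubspace_0[OF csub_K]]])
      then have "\<exists>u v. y + 0 = u + v \<and> u \<in> H1 \<and> v \<in> closure ((\<lambda>_. 0 :: 'c) ` K)" if "y \<in> H1" for y
        using that by blast
      then have "cinner x (y + 0) = 0" if "y \<in> H1" for y
        using x that unfolding surj ominus_def mem_Collect_eq by blast
      then have "x = 0"
        using x by (intro zero) (auto simp: ominus_def)
      then show "x \<in> (\<lambda>x. x) ` D" by (simp add: D0)
    qed (use D0 ccs_0[OF H1(1)] in \<open>auto simp: ominus_def\<close>)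
    with brownian_extension_surjective[OF H1 H0 V surj E VE] show ?thesis
      by (rule that)
  next
    case False
    show ?thesis
      by (rule brownian_extension_infinite[OF Z H1 H0 V E VE comm D(1) D' X False]) (auto intro: that)
  qed
qed

end

section \<open>The equivalences and the properties of the lift\<close>

theorem theorem1p4:
  fixes H1 D :: "'a::chilbert set" and H2 :: "'b::chilbert set"
    and V :: "'a \<Rightarrow> 'a" and E :: "'b \<Rightarrow> 'a" and S :: "'b \<Rightarrow> 'b"
    and T :: "'a \<times> 'b \<Rightarrow> 'a \<times> 'b"
  assumes "closed_csubspace H1" and "H1 \<noteq> {0}"
    and "closed_csubspace H2" and "H2 \<noteq> {0}"
    and "V \<in> bops H1 H1" and "E \<in> bops H2 H1" and "S \<in> bops H2 H2"
    and "T = op_matrix V E (\<lambda>_. 0) S"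
    and "closed_csubspace D"
    and "D \<subseteq> H1 \<ominus>\<^sub>H closed_cspan (V ` H1 \<union> closure (E ` H2))"
  shows
    "(T \<in> brownian_subnormal H1 H2 \<longleftrightarrow>
        (\<exists>(K1 :: 'a set) (K2 :: 'b set) j1 j2 V' E' N.
          brownian_normal_extension H1 H2 V E S K1 K2 j1 j2 V' E' N)) \<and>
     (T \<in> brownian_subnormal H1 H2 \<longleftrightarrow>
        subnormal H2 S \<and>
        (\<forall>(K2 :: 'b set) j2 N. minimal_normal_extension H2 S K2 j2 N \<longrightarrow>
          (\<exists>(K1 :: 'a set) j1 V' E'.
            brownian_normal_extension H1 H2 V E S K1 K2 j1 j2 V' E' N \<and>
            same_hilbert_dim K1 H1 \<and> same_hilbert_dim K2 H2 \<and>
            j1 ` D = K1 \<ominus>\<^sub>H {u + v |u v. u \<in> V' ` K1 \<and> v \<in> closure (E' ` K2)}))) \<and>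
     (\<forall>(K1 :: 'a set) (K2 :: 'b set) j1 j2 V' E' N.
        brownian_normal_extension H1 H2 V E S K1 K2 j1 j2 V' E' N \<and>
        minimal_normal_extension H2 S K2 j2 N \<longrightarrow>
          is_lift H2 S K2 j2 N (abs_op H2 H1 E) (abs_op K2 K1 E') \<and>
          (inj_on E H2 \<longleftrightarrow> inj_on E' K2) \<and>
          (left_invertible H2 H1 E \<longleftrightarrow> left_invertible K2 K1 E') \<and>
          (isometric H2 H1 E \<longleftrightarrow> isometric K2 K1 E'))"
proof -
  note H1 = assms(1,2) and H2 = assms(3,4) and V = assms(5) and E = assms(6) and S = assms(7)
  note T = assms(8) and D = assms(9,10)
  note i_iff = op_matrix_brownian_subnormal_iff[OF H1 H2 V E S, folded T]
  note ext_iff = brownian_normal_extension_iff[OF H1(1) H2(1) V E S]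
  have ii_i: "T \<in> brownian_subnormal H1 H2"
    if "brownian_normal_extension H1 H2 V E S K1 K2 j1 j2 V' E' N"
    for K1 :: "'a set" and K2 :: "'b set" and j1 j2 V' E' N
    unfolding T by (rule brownian_subnormal_of_extension[OF H1 H2 V E S that])
  have i_iii: "\<exists>(K1 :: 'a set) j1 V' E'.
      brownian_normal_extension H1 H2 V E S K1 K2 j1 j2 V' E' N \<and>
      same_hilbert_dim K1 H1 \<and> same_hilbert_dim K2 H2 \<and>
      j1 ` D = K1 \<ominus>\<^sub>H {u + v |u v. u \<in> V' ` K1 \<and> v \<in> closure (E' ` K2)}"
    if i: "T \<in> brownian_subnormal H1 H2" and min: "minimal_normal_extension H2 S K2 j2 N"
    for K2 :: "'b set" and j2 N
  proof -
    interpret normal_ext H2 S K2 j2 N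
      by unfold_locales (use H2 S min in \<open>auto simp: minimal_normal_extension_def\<close>)
    have Z: "Zspace = K2"
      using min by (simp add: minimal_iff)
    \<comment> \<open>\<open>H1\<close> itself serves as the larger space, with an embedding
      \<open>j1\<close> that need not be onto; equality of dimensions is then trivial on this
      side.\<close>
    obtain j1 V' E' where "brownian_normal_extension H1 H2 V E S H1 K2 j1 j2 V' E' N"
      "j1 ` D = H1 \<ominus>\<^sub>H {u + v |u v. u \<in> V' ` H1 \<and> v \<in> closure (E' ` K2)}"
      by (rule brownian_extension_exists[OF Z H1 H2(2) _ E _ _ D])
        (use i[unfolded i_iff] in auto)
    moreover have "same_hilbert_dim H1 H1"
      using orthonormal_basis_exists[OF H1(1)] unfolding same_hilbert_dim_def by blast
    ultimately show ?thesis
      using same_hilbert_dim_minimal[OF Z] by blast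
  qed
  \<comment> \<open>Without a minimal normal extension the universal statement (iii) would be
    vacuous; its existence is what leads from (iii) to an extension as in (ii).\<close>
  have min_ex: "\<exists>(K2 :: 'b set) j2 N. minimal_normal_extension H2 S K2 j2 N" if "subnormal H2 S"
    using minimal_normal_extension_exists[OF H2(1) that] by blast
  have i_sub: "subnormal H2 S" if "T \<in> brownian_subnormal H1 H2"
    using that i_iff by blast
  have more: "is_lift H2 S K2 j2 N (abs_op H2 H1 E) (abs_op K2 K1 E') \<and>
      (inj_on E H2 \<longleftrightarrow> inj_on E' K2) \<and>
      (left_invertible H2 H1 E \<longleftrightarrow> left_invertible K2 K1 E') \<and>
      (isometric H2 H1 E \<longleftrightarrow> isometric K2 K1 E')"
    if e: "brownian_normal_extension H1 H2 V E S K1 K2 j1 j2 V' E' N"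
      and min: "minimal_normal_extension H2 S K2 j2 N"
    for K1 :: "'a set" and K2 :: "'b set" and j1 j2 V' E' N
  proof -
    interpret normal_ext H2 S K2 j2 N
      by unfold_locales (use H2 S min in \<open>auto simp: minimal_normal_extension_def\<close>)
    have Z: "Zspace = K2"
      using min by (simp add: minimal_iff)
    have E': "E' \<in> bops K2 K1" and K1: "closed_csubspace K1"
      and comm: "\<And>x. x \<in> K2 \<Longrightarrow> N (adj K2 K1 E' (E' x)) = adj K2 K1 E' (E' (N x))"
      and ae: "op_extends H2 j2 (abs_op H2 H1 E) (abs_op K2 K1 E')"
      using e[unfolded ext_iff] by auto
    show ?thesis
      using is_lift_abs_op[OF E E' comm ae] inj_on_lift[OF E E' comm ae Z]
        left_invertible_lift[OF E E' comm ae Z H1(1) K1] isometric_lift[OF E E' comm ae Z] by blast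
  qed
  have 1: "T \<in> brownian_subnormal H1 H2 \<longleftrightarrow>
        (\<exists>(K1 :: 'a set) (K2 :: 'b set) j1 j2 V' E' N.
          brownian_normal_extension H1 H2 V E S K1 K2 j1 j2 V' E' N)"
    using ii_i i_iii min_ex i_sub by metis
  show ?thesis
    by (intro conjI 1 iffI allI impI i_sub i_iii) (use ii_i min_ex more in \<open>blast+\<close>)
qed

end
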